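(* Let $G=(V,E)$ be a finite simple graph with a fixed total order on $V$, and let $\lambda$ be a partition. Then the coefficient of $\overline{p}_\lambda$ in the $\overline{p}$-expansion of $\omega(\overline{X}_G)$ equals the number of families $(M_k)_{k\ge1}$ where, for each $k$, $M_k$ is a set of $i_k(\lambda)$ distinct Lyndon heaps on $G$ each of size $k/2^j$ for some integer $j\ge0$, such that every vertex of $G$ is used by at least one Lyndon heap in some $M_k$. Equivalently, this coefficient equals $$\sum_{W\subseteq V}(-1)^{|V\setminus W|}\prod_{k\ge1}\binom{\sum_{j\ge0,\ 2^j\mid k}|\mathcal{L}_{G|_W}(k/2^j)|}{i_k(\lambda)}.$$ In particular $\omega(\overline{X}_G)$ is $\overline{p}$-positive.
   Context: Graphs are finite, simple, unweighted; $G|_W$ is the induced subgraph on $W$; $i_k(\lambda)$ is the number of parts of $\lambda$ equal to $k$. Kromatic symmetric function: a proper set coloring of $G$ is a map $\kappa$ from $V$ to nonempty subsets of $\mathbb{Z}_{>0}$ with adjacent vertices receiving disjoint sets; $\overline{X}_G=\sum_\kappa\prod_{v}\prod_{i\in\kappa(v)}x_i$. $1+\overline{p}_k=\prod_{i\ge1}(1+x_i^k)$, $\overline{p}_\lambda=\prod_i\overline{p}_{\lambda_i}$. $\omega$ is the standard involution of symmetric functions (ring automorphism with $\omega(p_\lambda)=(-1)^{|\lambda|-\ell(\lambda)}p_\lambda$, $\omega(h_n)=e_n$), extended to symmetric power series degree-wise. Heaps: fix a total order on $V$. A heap on $G$ is an equivalence class of finite words over $V$ under the equivalence generated by swapping adjacent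 letters $u\ne v$ that are nonadjacent in $G$. Size = length; a vertex is used if it occurs. Composition $\circ$ = concatenation. Pieces = letter occurrences, partially ordered by the transitive closure of: piece $i\prec$ piece $j$ if $i<j$ and the letters are equal or adjacent in $G$. A pyramid has exactly one minimal piece. Periodic: $H=K^{\circ m}$ with $m>1$. Rotation: for a piece $p$ of $H$, with $V_p$ the heap of pieces $\succeq p$ and $H=U\circ V_p$, set $A_p(H)=V_p\circ U$; iterates stabilize at a pyramid $A_p^\infty(H)$ with minimal piece $p$; pyramids are rotation-equivalent if one is $A_p^\infty$ of the other; in each class all are periodic or all aperiodic. Standard word = lexicographically maximal representative. A Lyndon heap is an aperiodic pyramid whose standard word is lexicographically minimal in its rotation class. $\mathcal{L}_G(k)$ = set of Lyndon heaps of size $k$. *)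

theory Defs
  imports Complex_Main "HOL-Library.Poly_Mapping" "HOL-Library.FuncSet"
begin

type_synonym mono = "nat \<Rightarrow>\<^sub>0 nat"   (* exponent vector of a monomial *)
type_synonym ser = "mono \<Rightarrow> real"     (* coefficient function of a formal power series *)

definition ser_one :: ser where
  "ser_one \<alpha> = (if \<alpha> = 0 then 1 else 0)"

definition ser_mul :: "ser \<Rightarrow> ser \<Rightarrow> ser" where
  "ser_mul f g \<alpha> = (\<Sum>(\<beta>, \<gamma>) \<in> {(\<beta>, \<gamma>). \<beta> + \<gamma> = \<alpha>}. f \<beta> * g \<gamma>)"

definition ser_prod_list :: "ser list \<Rightarrow> ser" where
  "ser_prod_list fs = foldr ser_mul fs ser_one"

definition is_partition :: "nat list \<Rightarrow> bool" where
  "is_partition lam \<longleftrightarrow> sorted_wrt (\<ge>) lam \<and> 0 \<notin> set lam"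

text \<open>Coefficientwise sum over all partitions (each coefficient is a finite sum).\<close>
definition psum_ser :: "(nat list \<Rightarrow> real) \<Rightarrow> (nat list \<Rightarrow> ser) \<Rightarrow> ser" where
  "psum_ser c f \<alpha> = (\<Sum>lam \<in> {lam. is_partition lam \<and> f lam \<alpha> \<noteq> 0}. c lam * f lam \<alpha>)"

definition pow_sum :: "nat \<Rightarrow> ser" where
  "pow_sum k \<alpha> = (if \<exists>i. \<alpha> = Poly_Mapping.single i k then 1 else 0)"

definition p_part :: "nat list \<Rightarrow> ser" where
  "p_part lam = ser_prod_list (map pow_sum lam)"

text \<open>pbar_k = prod_i (1 + x_i^k) - 1 (k >= 1), written out coefficientwise:
  the monomials are the nonempty products of distinct x_i^k, each with coefficient 1.\<close>
definition pbar :: "nat \<Rightarrow> ser" where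
  "pbar k \<alpha> = (if \<alpha> \<noteq> 0 \<and> (\<forall>i \<in> Poly_Mapping.keys \<alpha>. Poly_Mapping.lookup \<alpha> i = k) then 1 else 0)"

definition pbar_part :: "nat list \<Rightarrow> ser" where
  "pbar_part lam = ser_prod_list (map pbar lam)"

definition omega_rel :: "ser \<Rightarrow> ser \<Rightarrow> bool" where
  "omega_rel f g \<longleftrightarrow> (\<exists>c. f = psum_ser c p_part \<and>
      g = psum_ser (\<lambda>lam. (-1) ^ (sum_list lam - length lam) * c lam) p_part)"

definition omega :: "ser \<Rightarrow> ser" where
  "omega f = (THE g. omega_rel f g)"

definition set_colorings :: "'a set \<Rightarrow> ('a \<Rightarrow> 'a \<Rightarrow> bool) \<Rightarrow> ('a \<Rightarrow> nat set) set" where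
  "set_colorings V E = {\<kappa> \<in> V \<rightarrow>\<^sub>E {S. S \<noteq> {} \<and> finite S}.
      \<forall>u\<in>V. \<forall>v\<in>V. E u v \<longrightarrow> \<kappa> u \<inter> \<kappa> v = {}}"

definition col_mono :: "'a set \<Rightarrow> ('a \<Rightarrow> nat set) \<Rightarrow> mono" where
  "col_mono V \<kappa> = (\<Sum>v\<in>V. \<Sum>i\<in>\<kappa> v. Poly_Mapping.single i 1)"

definition kromatic :: "'a set \<Rightarrow> ('a \<Rightarrow> 'a \<Rightarrow> bool) \<Rightarrow> ser" where
  "kromatic V E \<alpha> = real (card {\<kappa> \<in> set_colorings V E. col_mono V \<kappa> = \<alpha>})"

text \<open>A heap is represented as its equivalence class of words.\<close>
definition swap_step :: "('a \<Rightarrow> 'a \<Rightarrow> bool) \<Rightarrow> 'a list \<Rightarrow> 'a list \<Rightarrow> bool" where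
  "swap_step E w w' \<longleftrightarrow> (\<exists>xs u v ys. w = xs @ u # v # ys \<and> w' = xs @ v # u # ys
      \<and> u \<noteq> v \<and> \<not> E u v)"

definition heap_equiv :: "('a \<Rightarrow> 'a \<Rightarrow> bool) \<Rightarrow> 'a list \<Rightarrow> 'a list \<Rightarrow> bool" where
  "heap_equiv E = (swap_step E)\<^sup>*\<^sup>*"

definition heap_of :: "('a \<Rightarrow> 'a \<Rightarrow> bool) \<Rightarrow> 'a list \<Rightarrow> 'a list set" where
  "heap_of E w = {w'. heap_equiv E w w'}"

definition heaps :: "'a set \<Rightarrow> ('a \<Rightarrow> 'a \<Rightarrow> bool) \<Rightarrow> 'a list set set" where
  "heaps V E = {heap_of E w | w. set w \<subseteq> V}"

definition heap_size :: "'a list set \<Rightarrow> nat" where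
  "heap_size H = length (SOME w. w \<in> H)"

definition heap_uses :: "'a list set \<Rightarrow> 'a \<Rightarrow> bool" where
  "heap_uses H v \<longleftrightarrow> (\<exists>w\<in>H. v \<in> set w)"

text \<open>Pieces of a representative word w are its positions.\<close>
definition piece_prec :: "('a \<Rightarrow> 'a \<Rightarrow> bool) \<Rightarrow> 'a list \<Rightarrow> nat \<Rightarrow> nat \<Rightarrow> bool" where
  "piece_prec E w i j \<longleftrightarrow> i < j \<and> j < length w \<and> (w ! i = w ! j \<or> E (w ! i) (w ! j))"

definition piece_le :: "('a \<Rightarrow> 'a \<Rightarrow> bool) \<Rightarrow> 'a list \<Rightarrow> nat \<Rightarrow> nat \<Rightarrow> bool" where
  "piece_le E w = (piece_prec E w)\<^sup>*\<^sup>*"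

definition is_pyramid :: "('a \<Rightarrow> 'a \<Rightarrow> bool) \<Rightarrow> 'a list set \<Rightarrow> bool" where
  "is_pyramid E H \<longleftrightarrow> (\<exists>w\<in>H. card {j. j < length w \<and> (\<forall>i. \<not> piece_prec E w i j)} = 1)"

definition periodic :: "('a \<Rightarrow> 'a \<Rightarrow> bool) \<Rightarrow> 'a list set \<Rightarrow> bool" where
  "periodic E H \<longleftrightarrow> (\<exists>w\<in>H. \<exists>u m. m > (1::nat) \<and> heap_equiv E w (concat (replicate m u)))"

text \<open>Rotation A_p: V_p (pieces above p) followed by the rest U. In the result the piece p
  is at position 0.\<close>
definition rot :: "('a \<Rightarrow> 'a \<Rightarrow> bool) \<Rightarrow> 'a list \<Rightarrow> nat \<Rightarrow> 'a list" where
  "rot E w p = nths w {j. piece_le E w p j} @ nths w {j. \<not> piece_le E w p j}"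

definition rot_limit :: "('a \<Rightarrow> 'a \<Rightarrow> bool) \<Rightarrow> 'a list \<Rightarrow> nat \<Rightarrow> 'a list set \<Rightarrow> bool" where
  "rot_limit E w p H' \<longleftrightarrow>
     (\<exists>N. \<forall>n\<ge>N. heap_of E (((\<lambda>u. rot E u 0) ^^ n) (rot E w p)) = H')"

definition rotation_class :: "('a \<Rightarrow> 'a \<Rightarrow> bool) \<Rightarrow> 'a list set \<Rightarrow> 'a list set set" where
  "rotation_class E H = {H'. \<exists>w\<in>H. \<exists>p < length w. rot_limit E w p H'}"

definition std_word :: "('a::linorder) list set \<Rightarrow> 'a list" where
  "std_word H = (THE w. w \<in> H \<and> (\<forall>w'\<in>H. w' \<noteq> w \<longrightarrow> ord_class.lexordp w' w))"

definition lyndon_heap :: "('a::linorder) set \<Rightarrow> ('a \<Rightarrow> 'a \<Rightarrow> bool) \<Rightarrow> 'a list set \<Rightarrow> bool" where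
  "lyndon_heap V E H \<longleftrightarrow> H \<in> heaps V E \<and> is_pyramid E H \<and> \<not> periodic E H \<and>
     (\<forall>H'\<in>rotation_class E H. std_word H = std_word H' \<or> ord_class.lexordp (std_word H) (std_word H'))"

definition lyndon_set :: "('a::linorder) set \<Rightarrow> ('a \<Rightarrow> 'a \<Rightarrow> bool) \<Rightarrow> nat \<Rightarrow> 'a list set set" where
  "lyndon_set V E k = {H. lyndon_heap V E H \<and> heap_size H = k}"

definition induced :: "('a \<Rightarrow> 'a \<Rightarrow> bool) \<Rightarrow> 'a set \<Rightarrow> 'a \<Rightarrow> 'a \<Rightarrow> bool" where
  "induced E W u v \<longleftrightarrow> u \<in> W \<and> v \<in> W \<and> E u v"

definition lyn_families :: "('a::linorder) set \<Rightarrow> ('a \<Rightarrow> 'a \<Rightarrow> bool) \<Rightarrow> nat list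
    \<Rightarrow> (nat \<Rightarrow> 'a list set set) set" where
  "lyn_families V E lam = {M. (\<forall>k. (k = 0 \<longrightarrow> M k = {}) \<and>
        (k > 0 \<longrightarrow> finite (M k) \<and> card (M k) = count_list lam k \<and>
          M k \<subseteq> {H. lyndon_heap V E H \<and> (\<exists>j. 2 ^ j dvd k \<and> heap_size H = k div 2 ^ j)})) \<and>
      (\<forall>v\<in>V. \<exists>k. \<exists>H\<in>M k. heap_uses H v)}"

definition alt_formula :: "('a::linorder) set \<Rightarrow> ('a \<Rightarrow> 'a \<Rightarrow> bool) \<Rightarrow> nat list \<Rightarrow> int" where
  "alt_formula V E lam = (\<Sum>W\<in>Pow V. (-1) ^ card (V - W) *
     (\<Prod>k\<in>set lam. int ((\<Sum>j\<in>{j. 2 ^ j dvd k}. card (lyndon_set W (induced E W) (k div 2 ^ j)))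
                          choose count_list lam k)))"

end

theory Submission
  imports Defs "HOL-Library.Multiset" "HOL-Library.List_Lexorder" "HOL-Library.Nat_Bijection"
    "HOL-Computational_Algebra.Formal_Power_Series"
begin

text \<open>Inclusion-exclusion over the set \<open>W\<close> of vertices that are allowed to occur reduces the
  Kromatic function to the products \<open>\<Prod>i. I\<^sub>W(x\<^sub>i)\<close> of independence polynomials. The involution \<open>\<omega>\<close> sends
  such a product to \<open>\<Prod>i. 1 / I\<^sub>W(-x\<^sub>i)\<close>, and \<open>1 / I\<^sub>W(-x)\<close> is the generating function of all heaps on
  \<open>W\<close> (Cartier and Foata). A heap is a multiset of Lyndon heaps: its standard word factors into
  nonincreasing Lyndon words, each of which is again a standard word. Writing the multiplicities in
  binary turns this multiset into a set of pairs \<open>(L, j)\<close> of weight \<open>2\<^sup>j |L|\<close>, so the generating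
  function is \<open>\<Prod>k. (1 + x\<^sup>k) ^ N k\<close> with \<open>N k\<close> the number of pairs of weight \<open>k\<close>, and the product
  over all variables becomes \<open>\<Prod>k. (1 + pbar k) ^ N k\<close>.\<close>

section \<open>Formal power series in infinitely many variables\<close>

text \<open>That \<open>omega\<close> acts as described rests on logarithmic derivatives: the
  product of the F(x_i) is the exponential of the sum of a_k p_k / k, where the a_k are the
  coefficients of x F'/F. Passing from F to 1/F(-x) multiplies a_k by (-1)^(k-1), as the involution
  does to p_k. No exponential is formed: both sides satisfy the recurrence given by the Euler
  operator. As \<open>omega\<close> is a definite description, linear independence of the power sums
  is needed too. Families of Lyndon heaps obey the same inclusion-exclusion as colourings, so the
  two expansions are matched for each W and no signs have to be cancelled. There are infinitely many
  pairs (L, j); an infinite product is never written, each coefficient being computed from the pairs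
  of bounded weight. The obstacle on the heap side is that rotation classes are given by limits of
  iterated heap rotations, which in general are not cyclic shifts of words. At the least letter they
  become cyclic shifts, and at a larger letter the limit begins with that letter; so the Lyndon
  heaps are exactly the heaps with a Lyndon standard word.\<close>

unbundle fps_syntax

abbreviation keys where "keys \<equiv> Poly_Mapping.keys"
abbreviation lookup where "lookup \<equiv> Poly_Mapping.lookup"
abbreviation single where "single \<equiv> Poly_Mapping.single"

definition splits :: "mono \<Rightarrow> (mono \<times> mono) set" where
  "splits \<alpha> = {(\<beta>, \<gamma>). \<beta> + \<gamma> = \<alpha>}"

lemma ser_mul_eq: "ser_mul f g \<alpha> = (\<Sum>(\<beta>, \<gamma>)\<in>splits \<alpha>. f \<beta> * g \<gamma>)"
  by (simp add: ser_mul_def splits_def)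

lemma keys_add_mono: "keys (\<beta> + \<gamma> :: mono) = keys \<beta> \<union> keys \<gamma>"
  by (auto simp: in_keys_iff lookup_add)

definition on_keys :: "nat set \<Rightarrow> (nat \<Rightarrow> nat) \<Rightarrow> mono" where
  "on_keys A g = Abs_poly_mapping (\<lambda>i. if i \<in> A then g i else 0)"

lemma lookup_on_keys: "finite A \<Longrightarrow> lookup (on_keys A g) i = (if i \<in> A then g i else 0)"
  unfolding on_keys_def by (subst Abs_poly_mapping_inverse) (auto intro: finite_subset)

text \<open>A summand of \<alpha> is a choice, independent for each variable of \<alpha>, of an
  exponent at most \<open>lookup \<alpha> i\<close>. This makes the convolution a finite sum and
  lets it be exchanged with a product over variables.\<close>

lemma bij_splits:
  "bij_betw (\<lambda>g. (on_keys (keys \<alpha>) g, on_keys (keys \<alpha>) (\<lambda>i. lookup \<alpha> i - g i)))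
    (PiE (keys \<alpha>) (\<lambda>i. {..lookup \<alpha> i})) (splits \<alpha>)"
proof (rule bij_betw_byWitness[where f' = "\<lambda>p. restrict (lookup (fst p)) (keys \<alpha>)"])
  show "\<forall>g\<in>PiE (keys \<alpha>) (\<lambda>i. {..lookup \<alpha> i}). restrict (lookup (fst (on_keys (keys \<alpha>) g,
      on_keys (keys \<alpha>) (\<lambda>i. lookup \<alpha> i - g i)))) (keys \<alpha>) = g"
    by (auto simp: lookup_on_keys fun_eq_iff PiE_def extensional_def restrict_def)
  show "\<forall>p\<in>splits \<alpha>. (on_keys (keys \<alpha>) (restrict (lookup (fst p)) (keys \<alpha>)),
      on_keys (keys \<alpha>) (\<lambda>i. lookup \<alpha> i - restrict (lookup (fst p)) (keys \<alpha>) i)) = p"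
  proof
    fix p assume "p \<in> splits \<alpha>"
    then obtain \<beta> \<gamma> where p: "p = (\<beta>, \<gamma>)" and \<alpha>: "\<alpha> = \<beta> + \<gamma>" by (auto simp: splits_def)
    have "on_keys (keys \<alpha>) (restrict (lookup \<beta>) (keys \<alpha>)) = \<beta>"
      by (rule poly_mapping_eqI) (auto simp: lookup_on_keys \<alpha> keys_add_mono in_keys_iff)
    moreover have "on_keys (keys \<alpha>) (\<lambda>i. lookup \<alpha> i - restrict (lookup \<beta>) (keys \<alpha>) i) = \<gamma>"
      by (rule poly_mapping_eqI) (auto simp: lookup_on_keys \<alpha> keys_add_mono in_keys_iff lookup_add)
    ultimately show "(on_keys (keys \<alpha>) (restrict (lookup (fst p)) (keys \<alpha>)),
      on_keys (keys \<alpha>) (\<lambda>i. lookup \<alpha> i - restrict (lookup (fst p)) (keys \<alpha>) i)) = p"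
      using p by simp
  qed
  show "(\<lambda>g. (on_keys (keys \<alpha>) g, on_keys (keys \<alpha>) (\<lambda>i. lookup \<alpha> i - g i))) `
      PiE (keys \<alpha>) (\<lambda>i. {..lookup \<alpha> i}) \<subseteq> splits \<alpha>"
  proof
    fix p assume "p \<in> (\<lambda>g. (on_keys (keys \<alpha>) g, on_keys (keys \<alpha>) (\<lambda>i. lookup \<alpha> i - g i))) `
      PiE (keys \<alpha>) (\<lambda>i. {..lookup \<alpha> i})"
    then obtain g where p: "p = (on_keys (keys \<alpha>) g, on_keys (keys \<alpha>) (\<lambda>i. lookup \<alpha> i - g i))"
      and g: "\<And>i. i \<in> keys \<alpha> \<Longrightarrow> g i \<le> lookup \<alpha> i" by (auto simp: PiE_def Pi_def)
    have "on_keys (keys \<alpha>) g + on_keys (keys \<alpha>) (\<lambda>i. lookup \<alpha> i - g i) = \<alpha>"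
      by (rule poly_mapping_eqI) (use g in \<open>auto simp: lookup_on_keys lookup_add in_keys_iff\<close>)
    then show "p \<in> splits \<alpha>" by (simp add: p splits_def)
  qed
  show "(\<lambda>p. restrict (lookup (fst p)) (keys \<alpha>)) ` splits \<alpha> \<subseteq> PiE (keys \<alpha>) (\<lambda>i. {..lookup \<alpha> i})"
    by (auto simp: splits_def lookup_add)
qed

lemma finite_splits [simp]: "finite (splits \<alpha>)"
  using bij_betw_finite[OF bij_splits] by (simp add: finite_PiE)

lemma ser_mul_commute: "ser_mul f g = ser_mul g f"
proof
  fix \<alpha>
  show "ser_mul f g \<alpha> = ser_mul g f \<alpha>"
    unfolding ser_mul_eq
    by (rule sum.reindex_bij_witness[where i = prod.swap and j = prod.swap])
      (auto simp: splits_def add.commute mult.commute)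
qed

lemma ser_mul_assoc: "ser_mul (ser_mul f g) h = ser_mul f (ser_mul g h)"
proof
  fix \<alpha>
  have "ser_mul (ser_mul f g) h \<alpha> =
      (\<Sum>p\<in>splits \<alpha>. \<Sum>q\<in>splits (fst p). f (fst q) * g (snd q) * h (snd p))"
    unfolding ser_mul_eq by (simp add: case_prod_unfold sum_distrib_right)
  also have "\<dots> = (\<Sum>(p, q)\<in>(SIGMA p:splits \<alpha>. splits (fst p)). f (fst q) * g (snd q) * h (snd p))"
    by (rule sum.Sigma) auto
  also have "\<dots> = (\<Sum>(p, q)\<in>(SIGMA p:splits \<alpha>. splits (snd p)). f (fst p) * (g (fst q) * h (snd q)))"
    by (rule sum.reindex_bij_witness
        [where i = "\<lambda>(p, q). ((fst p + fst q, snd q), (fst p, fst q))"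
          and j = "\<lambda>(p, q). ((fst q, snd q + snd p), (snd q, snd p))"])
      (auto simp: splits_def add.assoc mult.assoc)
  also have "\<dots> = (\<Sum>p\<in>splits \<alpha>. \<Sum>q\<in>splits (snd p). f (fst p) * (g (fst q) * h (snd q)))"
    by (rule sum.Sigma[symmetric]) auto
  also have "\<dots> = ser_mul f (ser_mul g h) \<alpha>"
    unfolding ser_mul_eq by (simp add: case_prod_unfold sum_distrib_left)
  finally show "ser_mul (ser_mul f g) h \<alpha> = ser_mul f (ser_mul g h) \<alpha>" .
qed

lemma ser_mul_left_commute: "ser_mul f (ser_mul g h) = ser_mul g (ser_mul f h)"
  using ser_mul_assoc ser_mul_commute by metis

lemma ser_one_mul [simp]: "ser_mul ser_one f = f"
proof
  fix \<alpha>
  have "ser_mul ser_one f \<alpha> = (\<Sum>(\<beta>, \<gamma>)\<in>{(0, \<alpha>)}. ser_one \<beta> * f \<gamma>)"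
    unfolding ser_mul_eq
  proof (rule sum.mono_neutral_right)
    show "\<forall>p\<in>splits \<alpha> - {(0, \<alpha>)}. (case p of (\<beta>, \<gamma>) \<Rightarrow> ser_one \<beta> * f \<gamma>) = 0"
      by (auto simp: splits_def ser_one_def split: if_splits)
  qed (simp_all add: splits_def finite_splits[unfolded splits_def])
  then show "ser_mul ser_one f \<alpha> = f \<alpha>" by (simp add: ser_one_def)
qed

lemma ser_mul_nonzero:
  assumes "ser_mul f g \<alpha> \<noteq> 0"
  obtains \<beta> \<gamma> where "\<alpha> = \<beta> + \<gamma>" "f \<beta> \<noteq> 0" "g \<gamma> \<noteq> 0"
proof -
  have "\<exists>p\<in>splits \<alpha>. f (fst p) * g (snd p) \<noteq> 0"
    using assms unfolding ser_mul_eq case_prod_unfold by (meson sum.neutral)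
  then show ?thesis using that by (auto simp: splits_def)
qed

lemma ser_mul_add_left: "ser_mul (\<lambda>\<alpha>. f \<alpha> + g \<alpha>) h \<alpha> = ser_mul f h \<alpha> + ser_mul g h \<alpha>"
  by (simp add: ser_mul_eq case_prod_unfold distrib_right sum.distrib)

lemma ser_mul_sum_right: "ser_mul f (\<lambda>\<alpha>. \<Sum>x\<in>A. g x \<alpha>) \<alpha> = (\<Sum>x\<in>A. ser_mul f (g x) \<alpha>)"
  unfolding ser_mul_eq case_prod_unfold sum_distrib_left by (rule sum.swap)

lemma ser_prod_list_Cons: "ser_prod_list (f # fs) = ser_mul f (ser_prod_list fs)"
  by (simp add: ser_prod_list_def)

lemma ser_prod_list_remove1:
  "x \<in> set xs \<Longrightarrow> ser_prod_list (map F xs) = ser_mul (F x) (ser_prod_list (map F (remove1 x xs)))"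
  by (induction xs) (auto simp: ser_prod_list_Cons ser_mul_left_commute)

lemma ser_prod_list_mset_cong:
  "mset xs = mset ys \<Longrightarrow> ser_prod_list (map F xs) = ser_prod_list (map F ys)"
proof (induction xs arbitrary: ys)
  case (Cons x xs)
  have "x \<in> set ys" using Cons.prems by (metis list.set_intros(1) set_mset_mset)
  moreover have "mset xs = mset (remove1 x ys)" using Cons.prems by (metis mset_remove1 remove1.simps(2))
  ultimately show ?case
    using ser_prod_list_remove1[of x ys F] Cons.IH[of "remove1 x ys"] by (simp add: ser_prod_list_Cons)
qed simp

text \<open>The product of the series \<open>F(x\<^sub>i)\<close> over all variables \<open>x\<^sub>i\<close>; meaningful only if \<open>F $ 0 = 1\<close>.\<close>

definition var_prod :: "real fps \<Rightarrow> ser" where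
  "var_prod F \<alpha> = (\<Prod>i\<in>keys \<alpha>. F $ lookup \<alpha> i)"

lemma var_prod_superset:
  assumes "F $ 0 = 1" "finite A" "keys \<alpha> \<subseteq> A"
  shows "var_prod F \<alpha> = (\<Prod>i\<in>A. F $ lookup \<alpha> i)"
  unfolding var_prod_def
  by (rule prod.mono_neutral_left) (use assms in \<open>auto simp: in_keys_iff\<close>)

text \<open>Expanding the product over variables of one-variable convolutions chooses one exponent
  per variable, and by \<open>bij_splits\<close> that is a splitting of \<alpha>. Constant terms 1
  let the variables absent from one summand contribute a factor 1.\<close>

lemma ser_mul_var_prod:
  assumes "F $ 0 = 1" "G $ 0 = 1"
  shows "ser_mul (var_prod F) (var_prod G) = var_prod (F * G)"
proof
  fix \<alpha> :: mono
  let ?K = "keys \<alpha>"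
  let ?h = "\<lambda>g. (on_keys ?K g, on_keys ?K (\<lambda>i. lookup \<alpha> i - g i))"
  have "var_prod (F * G) \<alpha> = (\<Prod>i\<in>?K. \<Sum>j\<in>{..lookup \<alpha> i}. F $ j * G $ (lookup \<alpha> i - j))"
    by (simp add: var_prod_def fps_mult_nth atLeast0AtMost)
  also have "\<dots> = (\<Sum>g\<in>PiE ?K (\<lambda>i. {..lookup \<alpha> i}). \<Prod>i\<in>?K. F $ g i * G $ (lookup \<alpha> i - g i))"
    by (rule prod_sum_PiE) auto
  also have "\<dots> = (\<Sum>g\<in>PiE ?K (\<lambda>i. {..lookup \<alpha> i}). var_prod F (fst (?h g)) * var_prod G (snd (?h g)))"
  proof (rule sum.cong[OF refl])
    fix g assume "g \<in> PiE ?K (\<lambda>i. {..lookup \<alpha> i})"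
    have sub: "keys (on_keys ?K f) \<subseteq> ?K" for f by (auto simp: in_keys_iff lookup_on_keys split: if_splits)
    show "(\<Prod>i\<in>?K. F $ g i * G $ (lookup \<alpha> i - g i)) = var_prod F (fst (?h g)) * var_prod G (snd (?h g))"
      using var_prod_superset[OF assms(1) finite_keys sub, of g]
        var_prod_superset[OF assms(2) finite_keys sub, of "\<lambda>i. lookup \<alpha> i - g i"]
      by (simp add: lookup_on_keys prod.distrib)
  qed
  also have "\<dots> = (\<Sum>p\<in>splits \<alpha>. var_prod F (fst p) * var_prod G (snd p))"
    by (rule sum.reindex_bij_betw[OF bij_splits])
  also have "\<dots> = ser_mul (var_prod F) (var_prod G) \<alpha>"
    by (simp add: ser_mul_eq case_prod_unfold)
  finally show "ser_mul (var_prod F) (var_prod G) \<alpha> = var_prod (F * G) \<alpha>" ..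
qed

lemma var_prod_1: "var_prod 1 = ser_one"
proof
  fix \<alpha>
  show "var_prod 1 \<alpha> = ser_one \<alpha>"
  proof (cases "\<alpha> = 0")
    case False
    then obtain i where "i \<in> keys \<alpha>" by fastforce
    then have "var_prod 1 \<alpha> = 0" unfolding var_prod_def
      by (intro prod_zero) (auto simp: in_keys_iff)
    then show ?thesis using False by (simp add: ser_one_def)
  qed (simp add: var_prod_def ser_one_def)
qed

text \<open>Each variable contributes 1 or x^k. This is the bridge between series in one variable
  and the \<open>pbar\<close> expansion.\<close>

lemma var_prod_pbar:
  assumes "k > 0"
  shows "var_prod (1 + fps_X ^ k) = (\<lambda>\<alpha>. ser_one \<alpha> + pbar k \<alpha>)"
proof
  fix \<alpha>
  have *: "(1 + fps_X ^ k) $ n = (if n = k then 1 else 0 :: real)" if "n > 0" for n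
    using that by (simp add: fps_X_power_nth)
  show "var_prod (1 + fps_X ^ k) \<alpha> = ser_one \<alpha> + pbar k \<alpha>"
  proof (cases "\<forall>i\<in>keys \<alpha>. lookup \<alpha> i = k")
    case True
    then have "var_prod (1 + fps_X ^ k) \<alpha> = 1"
      unfolding var_prod_def using * assms by (intro prod.neutral) simp
    then show ?thesis using True by (simp add: ser_one_def pbar_def)
  next
    case False
    then obtain i where "i \<in> keys \<alpha>" "lookup \<alpha> i \<noteq> k" by blast
    then have "var_prod (1 + fps_X ^ k) \<alpha> = 0" unfolding var_prod_def
      using * by (intro prod_zero bexI[of _ i]) (auto simp: in_keys_iff)
    moreover have "\<alpha> \<noteq> 0" using False by auto
    ultimately show ?thesis using False by (simp add: ser_one_def pbar_def)
  qed
qed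

section \<open>Degrees of monomials and truncation\<close>

definition mdeg :: "mono \<Rightarrow> nat" where
  "mdeg \<alpha> = (\<Sum>i\<in>keys \<alpha>. lookup \<alpha> i)"

lemma mdeg_superset: "finite A \<Longrightarrow> keys \<alpha> \<subseteq> A \<Longrightarrow> mdeg \<alpha> = (\<Sum>i\<in>A. lookup \<alpha> i)"
  unfolding mdeg_def by (rule sum.mono_neutral_left) (auto simp: in_keys_iff)

lemma mdeg_add: "mdeg (\<beta> + \<gamma>) = mdeg \<beta> + mdeg \<gamma>"
  using mdeg_superset[of "keys (\<beta> + \<gamma>)" \<beta>] mdeg_superset[of "keys (\<beta> + \<gamma>)" \<gamma>]
  by (simp add: mdeg_def[of "\<beta> + \<gamma>"] keys_add_mono lookup_add sum.distrib)

lemma mdeg_single: "mdeg (single i k) = k"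
  by (simp add: mdeg_def)

lemma lookup_le_mdeg: "lookup \<alpha> i \<le> mdeg \<alpha>"
proof (cases "i \<in> keys \<alpha>")
  case True
  then show ?thesis unfolding mdeg_def by (intro member_le_sum) auto
qed (simp add: in_keys_iff)

lemma mdeg_eq_0_iff: "mdeg \<alpha> = 0 \<longleftrightarrow> \<alpha> = 0"
proof
  assume "mdeg \<alpha> = 0"
  then show "\<alpha> = 0" using lookup_le_mdeg[of \<alpha>] by (intro poly_mapping_eqI) simp
qed (simp add: mdeg_def)

text \<open>Only coefficients up to the degree of \<alpha> enter, so an infinite product of
  one-variable series may later be replaced by a finite part of it.\<close>

lemma var_prod_cong:
  assumes "\<And>j. j \<le> mdeg \<alpha> \<Longrightarrow> F $ j = G $ j"
  shows "var_prod F \<alpha> = var_prod G \<alpha>"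
  unfolding var_prod_def using assms lookup_le_mdeg by (intro prod.cong) auto

lemma single_plus_diff:
  "k \<le> lookup \<alpha> i \<Longrightarrow> single i k + (\<alpha> - single i k) = (\<alpha> :: mono)"
  by (rule poly_mapping_eqI) (auto simp: lookup_add lookup_minus lookup_single when_def)

text \<open>The monomials of p_k that fit into \<alpha> are the x_i^k for variables of exponent at
  least k; since k is positive, different i give different splittings.\<close>

lemma ser_mul_pow_sum:
  assumes "k > 0"
  shows "ser_mul (pow_sum k) g \<alpha> = (\<Sum>i\<in>{i\<in>keys \<alpha>. k \<le> lookup \<alpha> i}. g (\<alpha> - single i k))"
proof -
  let ?I = "{i\<in>keys \<alpha>. k \<le> lookup \<alpha> i}"
  let ?h = "\<lambda>i. (single i k, \<alpha> - single i k)"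
  have inj: "inj_on ?h ?I"
    using assms by (auto simp: inj_on_def dest: arg_cong[where f = keys])
  have "ser_mul (pow_sum k) g \<alpha> = (\<Sum>(\<beta>, \<gamma>)\<in>?h ` ?I. pow_sum k \<beta> * g \<gamma>)"
    unfolding ser_mul_eq
  proof (rule sum.mono_neutral_right)
    show "?h ` ?I \<subseteq> splits \<alpha>" by (auto simp: splits_def single_plus_diff)
    show "\<forall>p\<in>splits \<alpha> - ?h ` ?I. (case p of (\<beta>, \<gamma>) \<Rightarrow> pow_sum k \<beta> * g \<gamma>) = 0"
    proof
      fix p assume p: "p \<in> splits \<alpha> - ?h ` ?I"
      obtain \<beta> \<gamma> where [simp]: "p = (\<beta>, \<gamma>)" by fastforce
      have "pow_sum k \<beta> = 0"
      proof (rule ccontr)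
        assume "pow_sum k \<beta> \<noteq> 0"
        then obtain i where i: "\<beta> = single i k" by (auto simp: pow_sum_def split: if_splits)
        have \<alpha>: "\<alpha> = single i k + \<gamma>" using p i by (auto simp: splits_def)
        then have "lookup \<alpha> i \<ge> k" by (simp add: lookup_add)
        then have "i \<in> ?I" using assms by (auto simp: in_keys_iff)
        moreover have "p = ?h i" using i \<alpha> by simp
        ultimately show False using p by blast
      qed
      then show "(case p of (\<beta>, \<gamma>) \<Rightarrow> pow_sum k \<beta> * g \<gamma>) = 0" by simp
    qed
  qed simp
  also have "\<dots> = (\<Sum>i\<in>?I. g (\<alpha> - single i k))"
    unfolding sum.reindex[OF inj] by (auto simp: pow_sum_def intro!: sum.cong)
  finally show ?thesis .
qed

section \<open>Partitions as multisets of positive parts\<close>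

abbreviation nonincreasing :: "'a::linorder list \<Rightarrow> bool" where
  "nonincreasing \<equiv> sorted_wrt (\<ge>)"

lemma nonincreasing_conv_mset:
  assumes "nonincreasing ls"
  shows "rev (sorted_list_of_multiset (mset ls)) = (ls :: 'a::linorder list)"
proof -
  have "sorted (rev ls)" using assms by (simp add: sorted_wrt_rev)
  then have "sorted_list_of_multiset (mset (rev ls)) = rev ls"
    unfolding sorted_list_of_multiset_mset by (rule sorted_sort_id)
  then show ?thesis by simp
qed

definition partition_of :: "nat multiset \<Rightarrow> nat list" where
  "partition_of M = rev (sorted_list_of_multiset M)"

lemma mset_partition_of [simp]: "mset (partition_of M) = M"
  by (simp add: partition_of_def)

lemma set_partition_of [simp]: "set (partition_of M) = set_mset M"
  by (simp add: partition_of_def)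

lemma is_partition_partition_of: "0 \<notin># M \<Longrightarrow> is_partition (partition_of M)"
  by (simp add: is_partition_def partition_of_def sorted_wrt_rev)

lemma partition_of_mset: "is_partition lam \<Longrightarrow> partition_of (mset lam) = lam"
  unfolding is_partition_def partition_of_def by (intro nonincreasing_conv_mset) simp

lemma partition_eqI: "is_partition lam \<Longrightarrow> is_partition mu \<Longrightarrow> mset lam = mset mu \<Longrightarrow> lam = mu"
  using partition_of_mset by metis

lemma sum_list_mset_cong: "mset xs = mset ys \<Longrightarrow> sum_list xs = (sum_list ys :: nat)"
  by (metis sum_mset_sum_list)

lemma is_partition_remove1:
  assumes "is_partition lam"
  shows "is_partition (remove1 k lam)"
proof -
  have "sorted_wrt (\<ge>) (remove1 k lam)" if "sorted_wrt (\<ge>) lam"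
    using that
  proof (induction lam)
    case (Cons a lam)
    then show ?case using set_remove1_subset[of k lam] by auto
  qed simp
  then show ?thesis using assms set_remove1_subset[of k lam] by (auto simp: is_partition_def)
qed

definition parts :: "nat \<Rightarrow> nat list set" where
  "parts n = {lam. is_partition lam \<and> sum_list lam = n}"

lemma length_le_sum_list: "0 \<notin> set lam \<Longrightarrow> length lam \<le> sum_list (lam :: nat list)"
  by (induction lam) auto

lemma finite_partitions_le: "finite {lam. is_partition lam \<and> sum_list lam \<le> n}"
proof (rule finite_subset)
  show "{lam. is_partition lam \<and> sum_list lam \<le> n} \<subseteq> {lam. set lam \<subseteq> {..n} \<and> length lam \<le> n}"
    using length_le_sum_list by (auto simp: is_partition_def dest: member_le_sum_list intro: order_trans)
qed (rule finite_lists_length_le, simp)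

lemma finite_parts: "finite (parts n)"
  by (rule finite_subset[OF _ finite_partitions_le[of n]]) (auto simp: parts_def)

section \<open>Products of power sums: degree and linear independence\<close>

lemma p_part_Nil: "p_part [] = ser_one"
  by (simp add: p_part_def ser_prod_list_def)

lemma p_part_Cons: "p_part (k # lam) = ser_mul (pow_sum k) (p_part lam)"
  by (simp add: p_part_def ser_prod_list_Cons)

lemma p_part_remove1: "k \<in> set lam \<Longrightarrow> p_part lam = ser_mul (pow_sum k) (p_part (remove1 k lam))"
  unfolding p_part_def by (rule ser_prod_list_remove1)

lemma p_part_degree: "p_part lam \<alpha> \<noteq> 0 \<Longrightarrow> mdeg \<alpha> = sum_list lam"
proof (induction lam arbitrary: \<alpha>)
  case Nil
  then show ?case by (auto simp: p_part_Nil ser_one_def mdeg_def split: if_splits)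
next
  case (Cons k lam)
  from Cons.prems obtain \<beta> \<gamma> where "\<alpha> = \<beta> + \<gamma>" "pow_sum k \<beta> \<noteq> 0" "p_part lam \<gamma> \<noteq> 0"
    unfolding p_part_Cons by (rule ser_mul_nonzero)
  then show ?case using Cons.IH[of \<gamma>]
    by (auto simp: mdeg_add mdeg_single pow_sum_def split: if_splits)
qed

text \<open>By homogeneity of \<open>p_part lam\<close>, the index set of \<open>psum_ser\<close>,
  which depends on the vanishing of the summand, can be replaced by the fixed finite set of
  partitions of the degree of \<alpha>.\<close>

lemma psum_p_part: "psum_ser c p_part \<alpha> = (\<Sum>lam\<in>parts (mdeg \<alpha>). c lam * p_part lam \<alpha>)"
  unfolding psum_ser_def
  by (rule sum.mono_neutral_left) (use finite_parts p_part_degree in \<open>auto simp: parts_def\<close>)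

text \<open>Unlike p_k, the series pbar_k is inhomogeneous, but its lowest degree is k. This bound
  makes every coefficient of a \<open>pbar\<close> expansion a finite sum.\<close>

lemma pbar_part_degree: "pbar_part lam \<alpha> \<noteq> 0 \<Longrightarrow> sum_list lam \<le> mdeg \<alpha>"
proof (induction lam arbitrary: \<alpha>)
  case (Cons k lam)
  then have "ser_mul (pbar k) (pbar_part lam) \<alpha> \<noteq> 0"
    by (simp add: pbar_part_def ser_prod_list_Cons)
  then obtain \<beta> \<gamma> where *: "\<alpha> = \<beta> + \<gamma>" "pbar k \<beta> \<noteq> 0" "pbar_part lam \<gamma> \<noteq> 0"
    by (rule ser_mul_nonzero)
  from *(2) have "\<beta> \<noteq> 0" "\<forall>i\<in>keys \<beta>. lookup \<beta> i = k" by (auto simp: pbar_def split: if_splits)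
  moreover from this obtain i where "i \<in> keys \<beta>" by fastforce
  ultimately have "k \<le> mdeg \<beta>" using lookup_le_mdeg[of \<beta> i] by simp
  then show ?case using Cons.IH[OF *(3)] *(1) by (simp add: mdeg_add)
qed simp

lemma finite_pbar_support: "finite {lam. is_partition lam \<and> pbar_part lam \<alpha> \<noteq> 0}"
  by (rule finite_subset[OF _ finite_partitions_le[of "mdeg \<alpha>"]]) (auto dest: pbar_part_degree)

text \<open>Linear independence of the power sums: \<open>p_part lam\<close> only contains monomials with at most
  \<open>length lam\<close> variables, and exactly \<open>length lam\<close> only if the exponents are the parts of \<open>lam\<close>.\<close>

lemma p_part_support:
  assumes "0 \<notin> set lam" "p_part lam \<alpha> \<noteq> 0"
  shows "card (keys \<alpha>) \<le> length lam \<and>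
    (card (keys \<alpha>) = length lam \<longrightarrow> image_mset (lookup \<alpha>) (mset_set (keys \<alpha>)) = mset lam)"
  using assms
proof (induction lam arbitrary: \<alpha>)
  case Nil
  then show ?case by (auto simp: p_part_Nil ser_one_def split: if_splits)
next
  case (Cons k lam)
  from Cons.prems(2) obtain \<beta> \<gamma> where *: "\<alpha> = \<beta> + \<gamma>" "pow_sum k \<beta> \<noteq> 0" "p_part lam \<gamma> \<noteq> 0"
    unfolding p_part_Cons by (rule ser_mul_nonzero)
  from *(2) obtain i where \<beta>: "\<beta> = single i k" by (auto simp: pow_sum_def split: if_splits)
  have IH: "card (keys \<gamma>) \<le> length lam"
    "card (keys \<gamma>) = length lam \<Longrightarrow> image_mset (lookup \<gamma>) (mset_set (keys \<gamma>)) = mset lam"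
    using Cons.IH[OF _ *(3)] Cons.prems(1) by auto
  have keys: "keys \<alpha> = insert i (keys \<gamma>)" using *(1) \<beta> Cons.prems(1) by (simp add: keys_add_mono)
  show ?case
  proof (cases "i \<in> keys \<gamma>")
    case True
    then show ?thesis using keys IH(1) by (simp add: insert_absorb)
  next
    case False
    have "image_mset (lookup \<alpha>) (mset_set (keys \<gamma>)) = image_mset (lookup \<gamma>) (mset_set (keys \<gamma>))"
      using False *(1) \<beta> by (intro image_mset_cong) (auto simp: lookup_add lookup_single when_def)
    moreover have "lookup \<alpha> i = k" using False *(1) \<beta> by (simp add: lookup_add in_keys_iff)
    ultimately show ?thesis using keys IH False by simp
  qed
qed

lemma pow_sum_nonneg: "pow_sum k \<alpha> \<ge> 0"
  by (simp add: pow_sum_def)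

lemma p_part_nonneg: "p_part lam \<alpha> \<ge> 0"
proof (induction lam arbitrary: \<alpha>)
  case (Cons k lam)
  then show ?case unfolding p_part_Cons ser_mul_eq
    by (intro sum_nonneg) (auto simp: pow_sum_nonneg)
qed (simp add: p_part_Nil ser_one_def)

text \<open>The parts become exponents of distinct consecutive variables, so that no two of them
  merge; this monomial serves to detect the partition.\<close>

fun part_mono :: "nat \<Rightarrow> nat list \<Rightarrow> mono" where
  "part_mono s [] = 0"
| "part_mono s (k # lam) = single s k + part_mono (Suc s) lam"

lemma keys_part_mono: "0 \<notin> set lam \<Longrightarrow> keys (part_mono s lam) = {s..<s + length lam}"
  by (induction lam arbitrary: s) (auto simp: keys_add_mono)

lemma p_part_part_mono: "p_part lam (part_mono s lam) > 0"
proof (induction lam arbitrary: s)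
  case (Cons k lam)
  let ?p = "(single s k, part_mono (Suc s) lam)"
  have "0 < (case ?p of (\<beta>, \<gamma>) \<Rightarrow> pow_sum k \<beta> * p_part lam \<gamma>)"
    using Cons by (auto simp: pow_sum_def)
  also have "\<dots> \<le> p_part (k # lam) (part_mono s (k # lam))"
    unfolding p_part_Cons ser_mul_eq
    by (rule member_le_sum) (auto simp: pow_sum_nonneg p_part_nonneg, simp add: splits_def)
  finally show ?case .
qed (simp add: p_part_Nil ser_one_def)

lemma p_part_independent:
  assumes zero: "\<And>\<alpha>. psum_ser d p_part \<alpha> = 0" and part: "is_partition mu"
  shows "d mu = 0"
proof (rule ccontr)
  assume "d mu \<noteq> 0"
  define P where "P = {lam \<in> parts (sum_list mu). d lam \<noteq> 0}"
  have "finite P" unfolding P_def using finite_parts by simp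
  have "P \<noteq> {}" using \<open>d mu \<noteq> 0\<close> part by (auto simp: P_def parts_def)
  then have "Max (length ` P) \<in> length ` P" using \<open>finite P\<close> by simp
  \<comment> \<open>A partition of maximal length in the support of \<open>d\<close> is tested on
    its own monomial: a \<open>p_part lam\<close> containing that monomial has at least
    \<open>length nu\<close> parts, hence exactly that many, and then the exponents are its
    parts.\<close>
  then obtain nu where nu: "nu \<in> P" "length nu = Max (length ` P)" by auto
  have max: "length lam \<le> length nu" if "lam \<in> P" for lam
    using nu(2) that \<open>finite P\<close> by simp
  have pnu: "is_partition nu" "sum_list nu = sum_list mu" "d nu \<noteq> 0" "0 \<notin> set nu"
    using nu(1) by (auto simp: P_def parts_def is_partition_def)
  define \<alpha> where "\<alpha> = part_mono 0 nu"
  have pos: "p_part nu \<alpha> > 0" unfolding \<alpha>_def by (rule p_part_part_mono)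
  have deg: "mdeg \<alpha> = sum_list mu" using p_part_degree[of nu \<alpha>] pos pnu(2) by simp
  have card: "card (keys \<alpha>) = length nu" using keys_part_mono[OF pnu(4), of 0] by (simp add: \<alpha>_def)
  have other: "d lam * p_part lam \<alpha> = 0" if lam: "lam \<in> parts (sum_list mu) - {nu}" for lam
  proof (rule ccontr)
    assume "d lam * p_part lam \<alpha> \<noteq> 0"
    then have nz: "p_part lam \<alpha> \<noteq> 0" and "lam \<in> P" using lam by (auto simp: P_def)
    have p: "is_partition lam" "0 \<notin> set lam" using lam by (auto simp: parts_def is_partition_def)
    have "card (keys \<alpha>) = length lam"
      using p_part_support[OF p(2) nz] max[OF \<open>lam \<in> P\<close>] card by simp
    then have "mset lam = mset nu"
      using p_part_support[OF p(2) nz] p_part_support[OF pnu(4), of \<alpha>] pos card by simp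
    then show False using partition_eqI[OF p(1) pnu(1)] lam by simp
  qed
  have "psum_ser d p_part \<alpha> = (\<Sum>lam\<in>{nu}. d lam * p_part lam \<alpha>)"
    unfolding psum_p_part deg
    by (rule sum.mono_neutral_right) (use other finite_parts pnu in \<open>auto simp: parts_def\<close>)
  then show False using zero[of \<alpha>] pos pnu(3) by simp
qed

lemma psum_ser_cong: "(\<And>lam. is_partition lam \<Longrightarrow> c lam = d lam) \<Longrightarrow> psum_ser c f = psum_ser d f"
  unfolding psum_ser_def by (intro ext sum.cong) auto

lemma psum_ser_sum:
  "psum_ser (\<lambda>lam. \<Sum>x\<in>A. a x * c x lam) f \<alpha> = (\<Sum>x\<in>A. a x * psum_ser (c x) f \<alpha>)"
  unfolding psum_ser_def sum_distrib_left sum_distrib_right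
  by (subst sum.swap) (simp add: mult.assoc)

section \<open>The involution as a sign change of power sum coefficients\<close>

definition twist :: "(nat list \<Rightarrow> real) \<Rightarrow> nat list \<Rightarrow> real" where
  "twist c lam = (-1) ^ (sum_list lam - length lam) * c lam"

lemma twist_eq: "twist c = (\<lambda>lam. (-1) ^ (sum_list lam - length lam) * c lam)"
  by (simp add: twist_def fun_eq_iff)

text \<open>A definite description needs uniqueness: by linear independence any other expansion of
  \<open>f\<close> has the same coefficients at partitions.\<close>

lemma omega_eqI:
  assumes "f = psum_ser c p_part" "g = psum_ser (twist c) p_part"
  shows "omega f = g"
  unfolding omega_def
proof (rule the_equality)
  show "omega_rel f g" using assms unfolding omega_rel_def twist_eq by blast
next
  fix h assume "omega_rel f h"
  then obtain d where d: "f = psum_ser d p_part" "h = psum_ser (twist d) p_part"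
    unfolding omega_rel_def twist_eq by blast
  have "c lam - d lam = 0" if "is_partition lam" for lam
  proof (rule p_part_independent[OF _ that])
    fix \<alpha>
    have "psum_ser c p_part \<alpha> = psum_ser d p_part \<alpha>" using assms(1) d(1) by simp
    then show "psum_ser (\<lambda>lam. c lam - d lam) p_part \<alpha> = 0"
      unfolding psum_p_part by (simp add: left_diff_distrib sum_subtractf)
  qed
  then have "psum_ser (twist d) p_part = psum_ser (twist c) p_part"
    by (intro psum_ser_cong) (simp add: twist_def)
  then show "h = g" using assms(2) d(2) by simp
qed

section \<open>The involution on products over all variables\<close>

text \<open>The coefficient of \<open>p_part lam\<close> in \<open>exp (\<Sum>k. a k / k * p\<^sub>k)\<close>.\<close>

definition exp_coeff :: "(nat \<Rightarrow> real) \<Rightarrow> nat list \<Rightarrow> real" where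
  "exp_coeff a lam = (\<Prod>k\<in>set lam. (a k / real k) ^ count (mset lam) k / fact (count (mset lam) k))"

lemma exp_coeff_superset:
  "finite S \<Longrightarrow> set lam \<subseteq> S \<Longrightarrow>
    exp_coeff a lam = (\<Prod>k\<in>S. (a k / real k) ^ count (mset lam) k / fact (count (mset lam) k))"
  unfolding exp_coeff_def by (rule prod.mono_neutral_left) (auto simp: count_mset)

text \<open>For m parts equal to k this is k m (a/k)^m / m! = a (a/k)^(m-1) / (m-1)!, the effect of
  differentiation on one factor of the exponential.\<close>

lemma exp_coeff_remove1:
  assumes "k \<in> set lam" "k > 0"
  shows "real (k * count (mset lam) k) * exp_coeff a lam = a k * exp_coeff a (remove1 k lam)"
proof -
  let ?t = "\<lambda>l j. (a j / real j) ^ count (mset l) j / fact (count (mset l) j)"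
  obtain m where m: "count (mset lam) k = Suc m" using assms(1) by (metis count_mset_0_iff not0_implies_Suc)
  have rest: "(\<Prod>j\<in>set lam - {k}. ?t (remove1 k lam) j) = (\<Prod>j\<in>set lam - {k}. ?t lam j)"
    by (rule prod.cong) auto
  have "exp_coeff a lam = ?t lam k * (\<Prod>j\<in>set lam - {k}. ?t lam j)"
    unfolding exp_coeff_def using assms(1) by (simp add: prod.remove)
  moreover have "exp_coeff a (remove1 k lam) = ?t (remove1 k lam) k * (\<Prod>j\<in>set lam - {k}. ?t lam j)"
    unfolding exp_coeff_superset[OF finite_set[of lam] set_remove1_subset] rest[symmetric]
    using assms(1) by (simp add: prod.remove)
  moreover have "real (k * count (mset lam) k) * ?t lam k = a k * ?t (remove1 k lam) k"
  proof -
    define x where "x = a k / real k"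
    have "real k * y * (x ^ Suc m / (y * fact m)) = real k * x * (x ^ m / fact m)" if "y \<noteq> 0" for y :: real
      using that by simp
    from this[of "real (Suc m)"] have "real (k * Suc m) * (x ^ Suc m / fact (Suc m)) = real k * x * (x ^ m / fact m)"
      by (simp only: of_nat_mult fact_Suc of_nat_eq_0_iff nat.simps simp_thms)
    moreover have "real k * x = a k" using assms(2) by (simp add: x_def)
    ultimately show ?thesis using m by (simp add: x_def)
  qed
  ultimately show ?thesis by (simp only: mult.assoc[symmetric])
qed

lemma sum_list_eq_sum_count: "sum_list lam = (\<Sum>k\<in>set lam. k * count (mset lam) k)"
proof -
  have "finite A \<Longrightarrow> set lam \<subseteq> A \<Longrightarrow> sum_list lam = (\<Sum>k\<in>A. k * count (mset lam) k)" for A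
  proof (induction lam)
    case (Cons a lam)
    have "(\<Sum>k\<in>A. k * count (mset (a # lam)) k) = (\<Sum>k\<in>A. k * count (mset lam) k + (if k = a then k else 0))"
      by (rule sum.cong) auto
    then show ?case using Cons by (simp add: sum.distrib)
  qed simp
  then show ?thesis by simp
qed

lemma mdeg_diff_single: "k \<le> lookup \<alpha> i \<Longrightarrow> mdeg (\<alpha> - single i k) = mdeg \<alpha> - k"
  using arg_cong[OF single_plus_diff[of k \<alpha> i], of mdeg] by (simp add: mdeg_add mdeg_single)

text \<open>Let P be the exponential of the sum of a_k p_k / k. The Euler operator multiplies
  monomials by their degree and sends p_k to k p_k, hence P to P times the sum of a_k p_k. On
  coefficients: write the degree as the sum of the parts and remove one part k.\<close>

lemma exp_coeff_psum_recurrence: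
  "real (mdeg \<alpha>) * psum_ser (exp_coeff a) p_part \<alpha> =
    (\<Sum>k\<in>{1..mdeg \<alpha>}. \<Sum>i\<in>{i\<in>keys \<alpha>. k \<le> lookup \<alpha> i}.
      a k * psum_ser (exp_coeff a) p_part (\<alpha> - single i k))"
proof -
  let ?n = "mdeg \<alpha>"
  let ?t = "\<lambda>k mu. a k * exp_coeff a mu * ser_mul (pow_sum k) (p_part mu) \<alpha>"
  have "real ?n * psum_ser (exp_coeff a) p_part \<alpha> =
      (\<Sum>lam\<in>parts ?n. \<Sum>k\<in>set lam. ?t k (remove1 k lam))"
    unfolding psum_p_part sum_distrib_left
  proof (rule sum.cong[OF refl])
    fix lam assume lam: "lam \<in> parts ?n"
    have "?n = (\<Sum>k\<in>set lam. k * count (mset lam) k)"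
      using lam sum_list_eq_sum_count[of lam] by (simp add: parts_def)
    then have "real ?n = (\<Sum>k\<in>set lam. real (k * count (mset lam) k))"
      by (simp only: of_nat_sum)
    then have "real ?n * (exp_coeff a lam * p_part lam \<alpha>) =
        (\<Sum>k\<in>set lam. real (k * count (mset lam) k) * exp_coeff a lam * p_part lam \<alpha>)"
      by (simp only: sum_distrib_right mult.assoc)
    also have "\<dots> = (\<Sum>k\<in>set lam. ?t k (remove1 k lam))"
    proof (rule sum.cong[OF refl])
      fix k assume k: "k \<in> set lam"
      then have "k > 0" using lam by (metis parts_def is_partition_def mem_Collect_eq not_gr0)
      show "real (k * count (mset lam) k) * exp_coeff a lam * p_part lam \<alpha> = ?t k (remove1 k lam)"
        unfolding exp_coeff_remove1[OF k \<open>k > 0\<close>] p_part_remove1[OF k] ..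
    qed
    finally show "real ?n * (exp_coeff a lam * p_part lam \<alpha>) = (\<Sum>k\<in>set lam. ?t k (remove1 k lam))" .
  qed
  also have "\<dots> = (\<Sum>(lam, k)\<in>(SIGMA lam:parts ?n. set lam). ?t k (remove1 k lam))"
    by (rule sum.Sigma) (auto simp: finite_parts)
  also have "\<dots> = (\<Sum>(k, mu)\<in>(SIGMA k:{1..?n}. parts (?n - k)). ?t k mu)"
  proof (rule sum.reindex_bij_witness
      [where j = "\<lambda>(lam, k). (k, remove1 k lam)" and i = "\<lambda>(k, mu). (partition_of (add_mset k (mset mu)), k)"])
    fix p assume "p \<in> (SIGMA lam:parts ?n. set lam)"
    then obtain lam k where p: "p = (lam, k)" "lam \<in> parts ?n" "k \<in> set lam" by blast
    have part: "is_partition lam" "sum_list lam = ?n" using p(2) by (auto simp: parts_def)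
    have "add_mset k (mset (remove1 k lam)) = mset lam" using p(3) by simp
    then show "(case (case p of (lam, k) \<Rightarrow> (k, remove1 k lam)) of
        (k, mu) \<Rightarrow> (partition_of (add_mset k (mset mu)), k)) = p"
      using p(1) partition_of_mset[OF part(1)] by simp
    have k: "k \<le> ?n" "k \<ge> 1" using p(3) part member_le_sum_list[of k lam]
      by (auto simp: is_partition_def Suc_le_eq intro: Nat.gr0I)
    have "sum_list (remove1 k lam) = ?n - k" using p(3) part(2) by (simp add: sum_list_map_remove1[of k lam "\<lambda>x. x", simplified])
    then show "(case p of (lam, k) \<Rightarrow> (k, remove1 k lam)) \<in> (SIGMA k:{1..?n}. parts (?n - k))"
      using k p(1) is_partition_remove1[OF part(1)] by (simp add: parts_def)
    show "(case case p of (lam, k) \<Rightarrow> (k, remove1 k lam) of (k, mu) \<Rightarrow> ?t k mu) =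
        (case p of (lam, k) \<Rightarrow> ?t k (remove1 k lam))" using p(1) by simp
  next
    fix q assume "q \<in> (SIGMA k:{1..?n}. parts (?n - k))"
    then obtain k mu where q: "q = (k, mu)" "k \<in> {1..?n}" "mu \<in> parts (?n - k)" by blast
    have part: "is_partition mu" "sum_list mu = ?n - k" using q(3) by (auto simp: parts_def)
    let ?lam = "partition_of (add_mset k (mset mu))"
    have lam: "is_partition ?lam"
      by (rule is_partition_partition_of) (use q(2) part(1) in \<open>auto simp: is_partition_def\<close>)
    have "mset (remove1 k ?lam) = mset mu" by simp
    then have rem: "remove1 k ?lam = mu" using partition_eqI is_partition_remove1[OF lam] part(1) by blast
    then show "(case case q of (k, mu) \<Rightarrow> (partition_of (add_mset k (mset mu)), k) of
        (lam, k) \<Rightarrow> (k, remove1 k lam)) = q" using q(1) by simp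
    have "sum_list ?lam = sum_list (k # mu)" by (rule sum_list_mset_cong) simp
    then show "(case q of (k, mu) \<Rightarrow> (partition_of (add_mset k (mset mu)), k)) \<in> (SIGMA lam:parts ?n. set lam)"
      using q part lam by (simp add: parts_def)
  qed
  also have "\<dots> = (\<Sum>k\<in>{1..?n}. \<Sum>mu\<in>parts (?n - k). ?t k mu)"
    by (rule sum.Sigma[symmetric]) (auto simp: finite_parts)
  also have "\<dots> = (\<Sum>k\<in>{1..?n}. \<Sum>i\<in>{i\<in>keys \<alpha>. k \<le> lookup \<alpha> i}.
      a k * psum_ser (exp_coeff a) p_part (\<alpha> - single i k))"
  proof (rule sum.cong[OF refl])
    fix k assume "k \<in> {1..?n}"
    then have "k > 0" by simp
    let ?I = "{i\<in>keys \<alpha>. k \<le> lookup \<alpha> i}"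
    have "(\<Sum>mu\<in>parts (?n - k). ?t k mu) =
        (\<Sum>mu\<in>parts (?n - k). \<Sum>i\<in>?I. a k * (exp_coeff a mu * p_part mu (\<alpha> - single i k)))"
      unfolding ser_mul_pow_sum[OF \<open>k > 0\<close>] by (simp add: sum_distrib_left mult.assoc)
    also have "\<dots> = (\<Sum>i\<in>?I. \<Sum>mu\<in>parts (?n - k). a k * (exp_coeff a mu * p_part mu (\<alpha> - single i k)))"
      by (rule sum.swap)
    also have "\<dots> = (\<Sum>i\<in>?I. a k * psum_ser (exp_coeff a) p_part (\<alpha> - single i k))"
      by (rule sum.cong[OF refl]) (simp add: psum_p_part mdeg_diff_single sum_distrib_left)
    finally show "(\<Sum>mu\<in>parts (?n - k). ?t k mu) =
      (\<Sum>i\<in>?I. a k * psum_ser (exp_coeff a) p_part (\<alpha> - single i k))" .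
  qed
  finally show ?thesis .
qed

text \<open>In each variable the Euler operator multiplies the product by x F'/F = A, altogether by
  the sum of the A(x_i), which is the sum of A_k p_k: the same recurrence as for the
  exponential.\<close>

lemma var_prod_recurrence:
  assumes F: "F $ 0 = 1" and A: "fps_X * fps_deriv F = A * F" "A $ 0 = 0"
  shows "real (mdeg \<alpha>) * var_prod F \<alpha> =
    (\<Sum>k\<in>{1..mdeg \<alpha>}. \<Sum>i\<in>{i\<in>keys \<alpha>. k \<le> lookup \<alpha> i}. A $ k * var_prod F (\<alpha> - single i k))"
proof -
  let ?K = "keys \<alpha>"
  \<comment> \<open>Coefficient n of x F' = A F; the summand k = 0 drops out because A has no
    constant term.\<close>
  have coeff: "real n * F $ n = (\<Sum>k\<in>{1..n}. A $ k * F $ (n - k))" for n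
  proof -
    have "real n * F $ n = (fps_X * fps_deriv F) $ n" by (cases n) auto
    also have "\<dots> = (\<Sum>k=0..n. A $ k * F $ (n - k))" unfolding A(1) fps_mult_nth ..
    also have "\<dots> = (\<Sum>k\<in>{1..n}. A $ k * F $ (n - k))"
      by (rule sum.mono_neutral_right) (auto simp: A(2) not_less_eq_eq)
    finally show ?thesis .
  qed
  have shift: "var_prod F (\<alpha> - single i k) = F $ (lookup \<alpha> i - k) * (\<Prod>j\<in>?K - {i}. F $ lookup \<alpha> j)"
    if "i \<in> ?K" for i k
  proof -
    have "var_prod F (\<alpha> - single i k) = (\<Prod>j\<in>?K. F $ lookup (\<alpha> - single i k) j)"
      by (rule var_prod_superset[OF F]) (auto simp: in_keys_iff lookup_minus)
    also have "\<dots> = F $ lookup (\<alpha> - single i k) i * (\<Prod>j\<in>?K - {i}. F $ lookup (\<alpha> - single i k) j)"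
      using that by (simp add: prod.remove)
    also have "(\<Prod>j\<in>?K - {i}. F $ lookup (\<alpha> - single i k) j) = (\<Prod>j\<in>?K - {i}. F $ lookup \<alpha> j)"
      by (rule prod.cong) (auto simp: lookup_minus lookup_single when_def)
    finally show ?thesis by (simp add: lookup_minus)
  qed
  have "real (mdeg \<alpha>) * var_prod F \<alpha> = (\<Sum>i\<in>?K. real (lookup \<alpha> i) * var_prod F \<alpha>)"
    by (simp add: mdeg_def sum_distrib_right)
  also have "\<dots> = (\<Sum>i\<in>?K. \<Sum>k\<in>{1..lookup \<alpha> i}. A $ k * var_prod F (\<alpha> - single i k))"
  proof (rule sum.cong[OF refl])
    fix i assume i: "i \<in> ?K"
    have "var_prod F \<alpha> = F $ lookup \<alpha> i * (\<Prod>j\<in>?K - {i}. F $ lookup \<alpha> j)"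
      unfolding var_prod_def using i by (simp add: prod.remove)
    then have "real (lookup \<alpha> i) * var_prod F \<alpha> =
        (\<Sum>k\<in>{1..lookup \<alpha> i}. A $ k * F $ (lookup \<alpha> i - k)) * (\<Prod>j\<in>?K - {i}. F $ lookup \<alpha> j)"
      using coeff[of "lookup \<alpha> i"] by (simp add: mult.assoc[symmetric])
    then show "real (lookup \<alpha> i) * var_prod F \<alpha> =
        (\<Sum>k\<in>{1..lookup \<alpha> i}. A $ k * var_prod F (\<alpha> - single i k))"
      unfolding shift[OF i] by (simp add: sum_distrib_right mult.assoc)
  qed
  also have "\<dots> = (\<Sum>i\<in>?K. \<Sum>k\<in>{k\<in>{1..mdeg \<alpha>}. k \<le> lookup \<alpha> i}. A $ k * var_prod F (\<alpha> - single i k))"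
  proof (rule sum.cong[OF refl], rule sum.cong)
    fix i
    show "{1..lookup \<alpha> i} = {k\<in>{1..mdeg \<alpha>}. k \<le> lookup \<alpha> i}"
      using lookup_le_mdeg[of \<alpha> i] by auto
  qed simp
  also have "\<dots> = (\<Sum>k\<in>{1..mdeg \<alpha>}. \<Sum>i\<in>{i\<in>?K. k \<le> lookup \<alpha> i}. A $ k * var_prod F (\<alpha> - single i k))"
    by (rule sum.swap_restrict) auto
  finally show ?thesis .
qed

text \<open>Both sides satisfy the same recurrence, and the degree factor in it is nonzero unless
  \<alpha> = 0, so induction on the degree leaves only the constant terms to compare.\<close>

lemma var_prod_p_expansion:
  assumes "F $ 0 = 1" "fps_X * fps_deriv F = A * F" "A $ 0 = 0"
  shows "var_prod F = psum_ser (exp_coeff (fps_nth A)) p_part"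
proof
  fix \<alpha>
  show "var_prod F \<alpha> = psum_ser (exp_coeff (fps_nth A)) p_part \<alpha>"
  proof (induction "mdeg \<alpha>" arbitrary: \<alpha> rule: less_induct)
    case less
    show ?case
    proof (cases "\<alpha> = 0")
      case True
      have "lam = []" if "lam \<in> parts 0" for lam
        using that by (cases lam) (auto simp: parts_def is_partition_def)
      moreover have "[] \<in> parts 0" by (simp add: parts_def is_partition_def)
      ultimately have "parts 0 = {[]}" by blast
      then show ?thesis using True by (simp add: psum_p_part mdeg_def var_prod_def exp_coeff_def p_part_Nil ser_one_def)
    next
      case False
      then have pos: "mdeg \<alpha> > 0" using mdeg_eq_0_iff[of \<alpha>] by simp
      have "real (mdeg \<alpha>) * var_prod F \<alpha> = real (mdeg \<alpha>) * psum_ser (exp_coeff (fps_nth A)) p_part \<alpha>"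
        unfolding var_prod_recurrence[OF assms] exp_coeff_psum_recurrence
      proof (intro sum.cong refl)
        fix k i assume "k \<in> {1..mdeg \<alpha>}" "i \<in> {i \<in> keys \<alpha>. k \<le> lookup \<alpha> i}"
        then have "mdeg (\<alpha> - single i k) < mdeg \<alpha>" using mdeg_diff_single[of k \<alpha> i] pos by auto
        from less[OF this] show "A $ k * var_prod F (\<alpha> - single i k) =
            A $ k * psum_ser (exp_coeff (fps_nth A)) p_part (\<alpha> - single i k)" by simp
      qed
      then show ?thesis using pos by simp
    qed
  qed
qed

text \<open>This is F(-x). It is multiplicative and commutes with x d/dx, so logarithmic derivatives
  can be carried through the substitution.\<close>

definition alternate :: "real fps \<Rightarrow> real fps" where
  "alternate F = Abs_fps (\<lambda>n. (-1) ^ n * F $ n)"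

lemma alternate_mult: "alternate (F * G) = alternate F * alternate G"
proof (rule fps_ext)
  fix n
  have eq: "(-1) ^ n * (F $ i * G $ (n - i)) = (-1) ^ i * F $ i * ((-1) ^ (n - i) * G $ (n - i))"
    if "i \<in> {0..n}" for i
  proof -
    have "(-1 :: real) ^ n = (-1) ^ i * (-1) ^ (n - i)"
      using that by (simp add: power_add[symmetric])
    then show ?thesis by (simp add: mult_ac)
  qed
  have "alternate (F * G) $ n = (\<Sum>i\<in>{0..n}. (-1) ^ n * (F $ i * G $ (n - i)))"
    by (simp add: alternate_def fps_mult_nth sum_distrib_left)
  also have "\<dots> = (\<Sum>i\<in>{0..n}. (-1) ^ i * F $ i * ((-1) ^ (n - i) * G $ (n - i)))"
    by (rule sum.cong[OF refl eq])
  also have "\<dots> = (alternate F * alternate G) $ n"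
    by (simp add: alternate_def fps_mult_nth)
  finally show "alternate (F * G) $ n = (alternate F * alternate G) $ n" .
qed

lemma alternate_X_deriv: "alternate (fps_X * fps_deriv F) = fps_X * fps_deriv (alternate F)"
proof (rule fps_ext)
  fix n
  show "alternate (fps_X * fps_deriv F) $ n = (fps_X * fps_deriv (alternate F)) $ n"
    by (cases n) (auto simp: alternate_def)
qed

text \<open>Here G = 1/F(-x). If x F'/F = A, then x G'/G = -A(-x), with coefficients (-1)^(k+1) A_k.
  So the coefficient of \<open>p_part lam\<close> is multiplied by the product of (-1)^(k+1) over
  the parts k, which is the sign in \<open>twist\<close>.\<close>

lemma var_prod_twist:
  assumes F: "F $ 0 = 1" and G: "alternate F * G = 1"
  obtains c where "var_prod F = psum_ser c p_part" "var_prod G = psum_ser (twist c) p_part"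
proof -
  define A where "A = fps_X * fps_deriv F * inverse F"
  have inv: "inverse F * F = 1" using F by (intro inverse_mult_eq_1) simp
  have A: "fps_X * fps_deriv F = A * F" "A $ 0 = 0"
    using inv by (simp_all add: A_def mult.assoc)
  let ?F = "alternate F" and ?A = "alternate A"
  have XF: "fps_X * fps_deriv ?F = ?A * ?F"
    by (simp only: alternate_X_deriv[symmetric] A(1) alternate_mult)
  have F0: "?F $ 0 = 1" using F by (simp add: alternate_def)
  have G0: "G $ 0 = 1" using arg_cong[OF G, of "\<lambda>H. H $ 0"] F0 by simp
  \<comment> \<open>Differentiating F(-x) G = 1 and multiplying by x G isolates x G', because the
    relation F(-x) G = 1 can be inserted again.\<close>
  have "fps_deriv ?F * G + ?F * fps_deriv G = 0"
    using arg_cong[OF G, of fps_deriv] by (simp add: add.commute)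
  then have "fps_X * fps_deriv ?F * G * G + ?F * G * (fps_X * fps_deriv G) = 0"
    by (metis (no_types, lifting) distrib_left mult.assoc mult.commute mult_zero_right)
  then have "?A * (?F * G) * G + ?F * G * (fps_X * fps_deriv G) = 0"
    unfolding XF by (simp add: mult.assoc)
  then have XG: "fps_X * fps_deriv G = - ?A * G"
    unfolding G by (simp add: eq_neg_iff_add_eq_0 add.commute)
  have "twist (exp_coeff (fps_nth A)) lam = exp_coeff (fps_nth (- ?A)) lam" if "is_partition lam" for lam
  proof -
    have le: "length lam \<le> sum_list lam" using that length_le_sum_list by (simp add: is_partition_def)
    have len: "length lam = (\<Sum>k\<in>set lam. count (mset lam) k)"
      using size_multiset_overloaded_eq[of "mset lam"] by simp
    have "exp_coeff (fps_nth (- ?A)) lam =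
        (\<Prod>k\<in>set lam. ((-1) ^ (k * count (mset lam) k + count (mset lam) k)) *
          ((A $ k / real k) ^ count (mset lam) k / fact (count (mset lam) k)))"
      unfolding exp_coeff_def
    proof (rule prod.cong[OF refl])
      fix k
      let ?c = "count (mset lam) k"
      have "(- ?A) $ k / real k = (-1) ^ (k + 1) * (A $ k / real k)" by (simp add: alternate_def)
      then have "((- ?A) $ k / real k) ^ ?c = ((-1) ^ (k + 1)) ^ ?c * (A $ k / real k) ^ ?c"
        by (simp only: power_mult_distrib)
      also have "((-1) ^ (k + 1)) ^ ?c = (-1 :: real) ^ (k * ?c + ?c)"
        by (simp only: power_mult[symmetric] distrib_right mult_1)
      finally show "((- ?A) $ k / real k) ^ ?c / fact ?c =
          (-1) ^ (k * ?c + ?c) * ((A $ k / real k) ^ ?c / fact ?c)" by simp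
    qed
    also have "\<dots> = (-1) ^ (sum_list lam + length lam) * exp_coeff (fps_nth A) lam"
      unfolding prod.distrib exp_coeff_def power_sum[symmetric] sum.distrib
        sum_list_eq_sum_count[symmetric] len[symmetric] ..
    \<comment> \<open>Sum and difference have the same parity; the truncated difference is the true
      one because all parts are positive.\<close>
    also have "(-1 :: real) ^ (sum_list lam + length lam) = (-1) ^ (sum_list lam - length lam)"
    proof -
      have "sum_list lam + length lam = (sum_list lam - length lam) + 2 * length lam" using le by simp
      then have "(-1 :: real) ^ (sum_list lam + length lam) =
          (-1) ^ (sum_list lam - length lam) * ((-1) ^ 2) ^ length lam"
        by (simp only: power_add power_mult)
      then show ?thesis by simp
    qed
    finally show ?thesis unfolding twist_def by (rule sym)
  qed
  then have tw: "psum_ser (twist (exp_coeff (fps_nth A))) p_part = psum_ser (exp_coeff (fps_nth (- ?A))) p_part"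
    by (rule psum_ser_cong)
  have "var_prod G = psum_ser (exp_coeff (fps_nth (- ?A))) p_part"
    by (rule var_prod_p_expansion[OF G0 XG]) (simp add: alternate_def A(2))
  then show ?thesis
    using that[of "exp_coeff (fps_nth A)"] var_prod_p_expansion[OF F A] tw by simp
qed

section \<open>Products of (1 + pbar k)\<close>

text \<open>The partition formed by the weights of S; it records which product of
  \<open>pbar\<close> the choice S contributes when a product of factors 1 + pbar is
  expanded.\<close>

definition type_of :: "('b \<Rightarrow> nat) \<Rightarrow> 'b set \<Rightarrow> nat list" where
  "type_of wt S = partition_of (image_mset wt (mset_set S))"

lemma sum_list_type_of: "sum_list (type_of wt S) = (\<Sum>b\<in>S. wt b)"
proof -
  have "sum_list (type_of wt S) = sum_mset (mset (type_of wt S))" by (rule sum_mset_sum_list[symmetric])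
  then show ?thesis by (simp add: type_of_def sum_unfold_sum_mset)
qed

lemma is_partition_type_of: "finite S \<Longrightarrow> (\<And>b. b \<in> S \<Longrightarrow> wt b > 0) \<Longrightarrow> is_partition (type_of wt S)"
  unfolding type_of_def by (rule is_partition_partition_of) force

lemma pbar_part_type_of_insert:
  assumes "finite S" "b \<notin> S"
  shows "pbar_part (type_of wt (insert b S)) = ser_mul (pbar (wt b)) (pbar_part (type_of wt S))"
proof -
  have "pbar_part (type_of wt (insert b S)) = ser_prod_list (map pbar (wt b # type_of wt S))"
    unfolding pbar_part_def by (rule ser_prod_list_mset_cong) (use assms in \<open>simp add: type_of_def\<close>)
  then show ?thesis by (simp add: ser_prod_list_Cons pbar_part_def)
qed

text \<open>Expand the product of the 1 + pbar (wt b) over the set of factors from which pbar is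
  taken. Each factor is a \<open>var_prod\<close>, and multiplicativity of \<open>var_prod\<close>
  collects them into one series in one variable.\<close>

lemma sum_pbar_part_Pow:
  assumes "finite B" "\<And>b. b \<in> B \<Longrightarrow> wt b > 0"
  shows "(\<Sum>S\<in>Pow B. pbar_part (type_of wt S) \<alpha>) = var_prod (\<Prod>b\<in>B. 1 + fps_X ^ wt b) \<alpha>"
  using assms
proof (induction B arbitrary: \<alpha> rule: finite_induct)
  case empty
  have "type_of wt {} = []" by (simp add: type_of_def partition_of_def)
  then show ?case by (simp add: var_prod_1 pbar_part_def ser_prod_list_def)
next
  case (insert b B)
  let ?T = "\<lambda>\<alpha>. \<Sum>S\<in>Pow B. pbar_part (type_of wt S) \<alpha>"
  have pos: "wt b > 0" using insert.prems by simp
  have IH: "?T = var_prod (\<Prod>b\<in>B. 1 + fps_X ^ wt b)"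
    using insert.IH insert.prems by (simp add: fun_eq_iff)
  have inj: "inj_on (insert b) (Pow B)" using insert.hyps(2) by (auto simp: inj_on_def)
  have "(\<Sum>S\<in>Pow (insert b B). pbar_part (type_of wt S) \<alpha>) =
      ?T \<alpha> + (\<Sum>S\<in>insert b ` Pow B. pbar_part (type_of wt S) \<alpha>)"
    unfolding Pow_insert by (rule sum.union_disjoint) (use insert.hyps in auto)
  also have "(\<Sum>S\<in>insert b ` Pow B. pbar_part (type_of wt S) \<alpha>) =
      (\<Sum>S\<in>Pow B. ser_mul (pbar (wt b)) (pbar_part (type_of wt S)) \<alpha>)"
    unfolding sum.reindex[OF inj] comp_def
  proof (rule sum.cong[OF refl])
    fix S assume "S \<in> Pow B"
    then have "finite S" "b \<notin> S" using insert.hyps finite_subset by auto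
    then show "pbar_part (type_of wt (insert b S)) \<alpha> = ser_mul (pbar (wt b)) (pbar_part (type_of wt S)) \<alpha>"
      by (simp add: pbar_part_type_of_insert)
  qed
  also have "\<dots> = ser_mul (pbar (wt b)) ?T \<alpha>" by (rule ser_mul_sum_right[symmetric])
  also have "?T \<alpha> + ser_mul (pbar (wt b)) ?T \<alpha> = ser_mul (\<lambda>\<alpha>. ser_one \<alpha> + pbar (wt b) \<alpha>) ?T \<alpha>"
    by (simp only: ser_mul_add_left ser_one_mul)
  also have "\<dots> = var_prod ((1 + fps_X ^ wt b) * (\<Prod>b\<in>B. 1 + fps_X ^ wt b)) \<alpha>"
  proof -
    have 1: "(1 + fps_X ^ wt b :: real fps) $ 0 = 1" using pos by simp
    have 2: "(\<Prod>b\<in>B. 1 + fps_X ^ wt b :: real fps) $ 0 = 1"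
      using insert.hyps(1) insert.prems
    proof (induction B rule: finite_induct)
      case (insert x F)
      have "wt x > 0" using insert.prems by blast
      moreover have "(\<Prod>b\<in>F. 1 + fps_X ^ wt b :: real fps) $ 0 = 1" using insert.IH insert.prems by blast
      ultimately show ?case using insert.hyps by simp
    qed simp
    show ?thesis unfolding IH var_prod_pbar[OF pos, symmetric] ser_mul_var_prod[OF 1 2] ..
  qed
  finally show ?case using insert.hyps by simp
qed

lemma prod_one_plus_power_nth:
  assumes "finite B"
  shows "(\<Prod>b\<in>B. 1 + fps_X ^ wt b :: real fps) $ n = card {S \<in> Pow B. (\<Sum>b\<in>S. wt b) = n}"
proof -
  have "(\<Prod>b\<in>B. 1 + fps_X ^ wt b :: real fps) = (\<Sum>S\<in>Pow B. fps_X ^ (\<Sum>b\<in>S. wt b))"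
    using prod_add[OF assms, of "\<lambda>b. fps_X ^ wt b :: real fps" "\<lambda>_. 1"]
    by (simp add: power_sum add.commute)
  then have "(\<Prod>b\<in>B. 1 + fps_X ^ wt b :: real fps) $ n = (\<Sum>S\<in>Pow B. if n = (\<Sum>b\<in>S. wt b) then 1 else 0)"
    by (simp add: fps_sum_nth fps_X_power_nth)
  also have "\<dots> = card {S \<in> Pow B. (\<Sum>b\<in>S. wt b) = n}"
    using assms by (simp add: sum.inter_filter[symmetric] eq_commute)
  finally show ?thesis .
qed

text \<open>H stands for the possibly infinite product of the 1 + x^(wt b). At a monomial of degree
  N both sides see only elements of weight at most N, and for those the finite expansion applies;
  its subsets are then grouped by type.\<close>

lemma psum_pbar_part_subsets:
  assumes fin: "\<And>n. finite {b \<in> B. wt b \<le> n}" and pos: "\<And>b. b \<in> B \<Longrightarrow> wt b > 0"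
    and H: "\<And>n. H $ n = card {S. S \<subseteq> B \<and> finite S \<and> (\<Sum>b\<in>S. wt b) = n}"
  shows "psum_ser (\<lambda>lam. real (card {S. S \<subseteq> B \<and> finite S \<and> type_of wt S = lam})) pbar_part = var_prod H"
proof
  fix \<alpha>
  define N where "N = mdeg \<alpha>"
  define BN where "BN = {b \<in> B. wt b \<le> N}"
  define T where "T = {lam. is_partition lam \<and> pbar_part lam \<alpha> \<noteq> 0}"
  have finBN: "finite BN" unfolding BN_def by (rule fin)
  have inBN: "S \<subseteq> BN" if "S \<subseteq> B" "finite S" "(\<Sum>b\<in>S. wt b) \<le> N" for S
    using that member_le_sum[of _ S wt] by (fastforce simp: BN_def)
  have "var_prod H \<alpha> = var_prod (\<Prod>b\<in>BN. 1 + fps_X ^ wt b) \<alpha>"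
  proof (rule var_prod_cong)
    fix j assume "j \<le> mdeg \<alpha>"
    then have "{S \<in> Pow BN. (\<Sum>b\<in>S. wt b) = j} = {S. S \<subseteq> B \<and> finite S \<and> (\<Sum>b\<in>S. wt b) = j}"
      using inBN finite_subset[OF _ finBN] by (auto simp: BN_def N_def)
    then show "H $ j = (\<Prod>b\<in>BN. 1 + fps_X ^ wt b) $ j"
      unfolding H prod_one_plus_power_nth[OF finBN] by simp
  qed
  also have "\<dots> = (\<Sum>S\<in>Pow BN. pbar_part (type_of wt S) \<alpha>)"
    by (rule sum_pbar_part_Pow[symmetric, OF finBN]) (use pos in \<open>simp add: BN_def\<close>)
  also have "\<dots> = (\<Sum>S\<in>{S\<in>Pow BN. type_of wt S \<in> T}. pbar_part (type_of wt S) \<alpha>)"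
  proof (rule sum.mono_neutral_right)
    show "\<forall>S\<in>Pow BN - {S \<in> Pow BN. type_of wt S \<in> T}. pbar_part (type_of wt S) \<alpha> = 0"
    proof
      fix S assume S: "S \<in> Pow BN - {S \<in> Pow BN. type_of wt S \<in> T}"
      then have "is_partition (type_of wt S)"
        using pos finite_subset[OF _ finBN] by (intro is_partition_type_of) (auto simp: BN_def)
      then show "pbar_part (type_of wt S) \<alpha> = 0" using S by (auto simp: T_def)
    qed
  qed (use finBN in auto)
  also have "\<dots> = (\<Sum>lam\<in>T. \<Sum>S\<in>{S\<in>{S\<in>Pow BN. type_of wt S \<in> T}. type_of wt S = lam}. pbar_part (type_of wt S) \<alpha>)"
    by (rule sum.group[symmetric]) (use finBN finite_pbar_support in \<open>auto simp: T_def\<close>)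
  also have "\<dots> = (\<Sum>lam\<in>T. real (card {S. S \<subseteq> B \<and> finite S \<and> type_of wt S = lam}) * pbar_part lam \<alpha>)"
  proof (rule sum.cong[OF refl])
    fix lam assume lam: "lam \<in> T"
    have "sum_list lam \<le> N" using lam pbar_part_degree[of lam \<alpha>] by (auto simp: T_def N_def)
    then have "S \<subseteq> BN" if "S \<subseteq> B" "finite S" "type_of wt S = lam" for S
      using inBN[OF that(1,2)] sum_list_type_of[of wt S] that(3) by simp
    then have "{S\<in>{S\<in>Pow BN. type_of wt S \<in> T}. type_of wt S = lam} = {S. S \<subseteq> B \<and> finite S \<and> type_of wt S = lam}"
      using lam finite_subset[OF _ finBN] by (auto simp: BN_def)
    moreover have "(\<Sum>S\<in>{S. S \<subseteq> B \<and> finite S \<and> type_of wt S = lam}. pbar_part (type_of wt S) \<alpha>) =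
        (\<Sum>S\<in>{S. S \<subseteq> B \<and> finite S \<and> type_of wt S = lam}. pbar_part lam \<alpha>)"
      by (rule sum.cong) auto
    ultimately show "(\<Sum>S\<in>{S\<in>{S\<in>Pow BN. type_of wt S \<in> T}. type_of wt S = lam}. pbar_part (type_of wt S) \<alpha>) =
        real (card {S. S \<subseteq> B \<and> finite S \<and> type_of wt S = lam}) * pbar_part lam \<alpha>" by simp
  qed
  also have "\<dots> = psum_ser (\<lambda>lam. real (card {S. S \<subseteq> B \<and> finite S \<and> type_of wt S = lam})) pbar_part \<alpha>"
    by (simp add: psum_ser_def T_def)
  finally show "psum_ser (\<lambda>lam. real (card {S. S \<subseteq> B \<and> finite S \<and> type_of wt S = lam})) pbar_part \<alpha> = var_prod H \<alpha>" ..
qed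

section \<open>Words up to commutation and their standard representatives\<close>

locale trace_graph =
  fixes E :: "'a::linorder \<Rightarrow> 'a \<Rightarrow> bool"
  assumes E_sym: "E u v \<Longrightarrow> E v u"
begin

definition dep :: "'a \<Rightarrow> 'a \<Rightarrow> bool" where
  "dep a b \<longleftrightarrow> a = b \<or> E a b"

lemma dep_sym: "dep a b \<longleftrightarrow> dep b a"
  unfolding dep_def by (metis E_sym)

lemma dep_refl [simp]: "dep a a"
  by (simp add: dep_def)

abbreviation equ :: "'a list \<Rightarrow> 'a list \<Rightarrow> bool" (infix "\<approx>" 50) where
  "w \<approx> w' \<equiv> heap_equiv E w w'"

lemma swap_step_dep:
  "swap_step E w w' \<longleftrightarrow> (\<exists>xs u v ys. w = xs @ u # v # ys \<and> w' = xs @ v # u # ys \<and> \<not> dep u v)"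
  by (simp add: swap_step_def dep_def)

lemma equ_refl [simp]: "w \<approx> w"
  by (simp add: heap_equiv_def)

lemma equ_trans [trans]: "u \<approx> v \<Longrightarrow> v \<approx> w \<Longrightarrow> u \<approx> w"
  by (simp add: heap_equiv_def)

lemma equ_sym: "u \<approx> v \<Longrightarrow> v \<approx> u"
proof -
  have "symp (swap_step E)"
    unfolding symp_def swap_step_dep using dep_sym by metis
  then show "u \<approx> v \<Longrightarrow> v \<approx> u"
    unfolding heap_equiv_def by (meson sympD symp_rtranclp)
qed

lemma equ_swap: "\<not> dep u v \<Longrightarrow> u # v # w \<approx> v # u # w"
  unfolding heap_equiv_def swap_step_dep by (rule r_into_rtranclp) (metis append_Nil)

lemma swap_step_Cons: "swap_step E w w' \<Longrightarrow> swap_step E (a # w) (a # w')"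
  unfolding swap_step_dep by (metis append_Cons)

lemma equ_Cons: "w \<approx> w' \<Longrightarrow> a # w \<approx> a # w'"
  unfolding heap_equiv_def
proof (induction rule: rtranclp_induct)
  case (step y z)
  then show ?case by (meson rtranclp.rtrancl_into_rtrancl swap_step_Cons)
qed simp

text \<open>Equivalence is the congruence generated by swapping the first two letters. In this form
  a function defined by recursion on words is seen to be invariant without following the position of
  a swap.\<close>

lemma equ_induct [consumes 1, case_names refl swap Cons trans]:
  assumes "w \<approx> w'"
    and R: "\<And>w. P w w"
    and S: "\<And>u v ys. \<not> dep u v \<Longrightarrow> P (u # v # ys) (v # u # ys)"
    and C: "\<And>a w w'. w \<approx> w' \<Longrightarrow> P w w' \<Longrightarrow> P (a # w) (a # w')"
    and T: "\<And>x y z. x \<approx> y \<Longrightarrow> P x y \<Longrightarrow> y \<approx> z \<Longrightarrow> P y z \<Longrightarrow> P x z"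
  shows "P w w'"
proof -
  have step: "P x y \<and> x \<approx> y" if "swap_step E x y" for x y
  proof -
    from that obtain xs u v ys where *: "x = xs @ u # v # ys" "y = xs @ v # u # ys" "\<not> dep u v"
      by (auto simp: swap_step_dep)
    have "P (xs @ u # v # ys) (xs @ v # u # ys) \<and> (xs @ u # v # ys) \<approx> (xs @ v # u # ys)"
      by (induction xs) (use * in \<open>auto intro: S C equ_swap equ_Cons\<close>)
    then show ?thesis using * by simp
  qed
  from assms(1)[unfolded heap_equiv_def] have "P w w' \<and> w \<approx> w'"
    by (induction rule: rtranclp_induct) (auto intro: R dest: step T equ_trans)
  then show ?thesis ..
qed

lemma equ_mset: "w \<approx> w' \<Longrightarrow> mset w = mset w'"
  by (induction rule: equ_induct) auto

lemma equ_set: "w \<approx> w' \<Longrightarrow> set w = set w'"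
  using equ_mset mset_eq_setD by blast

lemma equ_length: "w \<approx> w' \<Longrightarrow> length w = length w'"
  using equ_mset mset_eq_length by blast

lemma equ_append1: "w \<approx> w' \<Longrightarrow> x @ w \<approx> x @ w'"
  by (induction x) (auto intro: equ_Cons)

lemma equ_append2: "w \<approx> w' \<Longrightarrow> w @ x \<approx> w' @ x"
  by (induction rule: equ_induct) (auto intro: equ_Cons equ_swap equ_trans)

lemma equ_append: "u \<approx> u' \<Longrightarrow> v \<approx> v' \<Longrightarrow> u @ v \<approx> u' @ v'"
  using equ_append1 equ_append2 equ_trans by blast

lemma equ_concat_replicate: "u \<approx> u' \<Longrightarrow> concat (replicate m u) \<approx> concat (replicate m u')"
  by (induction m) (auto intro: equ_append)

text \<open>Equal letters never change their order, so deleting the first occurrence is well defined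
  on heaps. This yields left cancellation.\<close>

lemma equ_remove1: "w \<approx> w' \<Longrightarrow> remove1 a w \<approx> remove1 a w'"
  by (induction rule: equ_induct) (auto intro: equ_Cons equ_swap equ_trans)

lemma equ_Cons_cancel: "a # w \<approx> a # w' \<longleftrightarrow> w \<approx> w'"
  using equ_remove1[of "a # w" "a # w'" a] equ_Cons by auto

lemma equ_append_cancel: "x @ w \<approx> x @ w' \<longleftrightarrow> w \<approx> w'"
  by (induction x) (auto simp: equ_Cons_cancel)

lemma heap_of_eq_iff: "heap_of E w = heap_of E w' \<longleftrightarrow> w \<approx> w'"
  unfolding heap_of_def using equ_sym equ_trans equ_refl by blast

text \<open>The labels of the minimal pieces.\<close>

fun minl :: "'a list \<Rightarrow> 'a set" where
  "minl [] = {}"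
| "minl (a # w) = insert a {b \<in> minl w. \<not> dep a b}"

lemma minl_equ: "w \<approx> w' \<Longrightarrow> minl w = minl w'"
  by (induction rule: equ_induct) (auto simp: dep_sym)

lemma minl_subset: "minl w \<subseteq> set w"
  by (induction w) auto

lemma finite_minl: "finite (minl w)"
  using minl_subset finite_subset by blast

lemma minl_append: "minl (x @ y) = minl x \<union> {b \<in> minl y. \<forall>a\<in>set x. \<not> dep a b}"
  by (induction x) auto

lemma minl_indep: "a \<in> minl w \<Longrightarrow> b \<in> minl w \<Longrightarrow> a \<noteq> b \<Longrightarrow> \<not> dep a b"
  by (induction w) (auto simp: dep_sym)

lemma minl_eq_empty [simp]: "minl w = {} \<longleftrightarrow> w = []"
  by (cases w) auto

lemma equ_move_front: "a \<in> minl w \<Longrightarrow> w \<approx> a # remove1 a w"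
proof (induction w)
  case (Cons c w)
  show ?case
  proof (cases "c = a")
    case False
    with Cons.prems have "a \<in> minl w" "\<not> dep c a" by auto
    with Cons.IH have "c # w \<approx> c # a # remove1 a w" by (auto intro: equ_Cons)
    also have "c # a # remove1 a w \<approx> a # c # remove1 a w" using \<open>\<not> dep c a\<close> by (rule equ_swap)
    finally show ?thesis using False by simp
  qed simp
qed simp

lemma minl_remove1: "b \<in> minl w \<Longrightarrow> b \<noteq> a \<Longrightarrow> b \<in> minl (remove1 a w)"
  by (induction w) auto

text \<open>A local form of lexicographic maximality among all representatives of the heap.\<close>

fun std :: "'a list \<Rightarrow> bool" where
  "std [] \<longleftrightarrow> True"
| "std (a # w) \<longleftrightarrow> std w \<and> (\<forall>b\<in>minl (a # w). b \<le> a)"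

lemma std_hd: "std w \<Longrightarrow> b \<in> minl w \<Longrightarrow> b \<le> hd w"
  by (cases w) auto

lemma hd_in_minl: "w \<noteq> [] \<Longrightarrow> hd w \<in> minl w"
  by (cases w) auto

text \<open>Every representative begins with a minimal label, so its first letter is at most that of
  the standard word; if the two agree, cancel them and continue. Hence the local condition implies
  global maximality.\<close>

lemma std_max: "std w \<Longrightarrow> w \<approx> w' \<Longrightarrow> w' \<le> w"
proof (induction w arbitrary: w')
  case Nil
  then have "w' = []" using equ_length by fastforce
  then show ?case by simp
next
  case (Cons a w)
  then obtain b v where w': "w' = b # v" using equ_length[OF Cons.prems(2)] by (cases w') auto
  have "b \<in> minl (a # w)" using minl_equ[OF Cons.prems(2)] w' by simp
  then have "b \<le> a" using Cons.prems(1) by (simp only: std.simps)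
  show ?case
  proof (cases "b = a")
    case True
    then have "w \<approx> v" using Cons.prems w' equ_Cons_cancel by simp
    then show ?thesis using Cons w' True by simp
  next
    case False
    then show ?thesis using \<open>b \<le> a\<close> w' by simp
  qed
qed

lemma std_unique: "std w \<Longrightarrow> std w' \<Longrightarrow> w \<approx> w' \<Longrightarrow> w = w'"
  by (rule order.antisym) (auto intro: std_max equ_sym)

lemma std_exists: "\<exists>w'. std w' \<and> w \<approx> w'"
proof (induction "length w" arbitrary: w)
  case 0
  then show ?case by (intro exI[of _ "[]"]) auto
next
  case (Suc n)
  define a where "a = Max (minl w)"
  have ne: "minl w \<noteq> {}" using Suc.hyps(2) by auto
  have a: "a \<in> minl w" unfolding a_def using ne finite_minl Max_in by blast
  have "n = length (remove1 a w)"
    using Suc.hyps(2) minl_subset a by (auto simp: length_remove1)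
  from Suc.hyps(1)[OF this] obtain v where v: "std v" "remove1 a w \<approx> v" by blast
  have eq: "w \<approx> a # v" using equ_move_front[OF a] equ_Cons[OF v(2)] equ_trans by blast
  have "\<forall>b\<in>minl (a # v). b \<le> a" 
    using minl_equ[OF eq] a_def finite_minl by simp
  then show ?case using v eq by (intro exI[of _ "a # v"]) simp
qed

definition nf :: "'a list \<Rightarrow> 'a list" where
  "nf w = (SOME w'. std w' \<and> w \<approx> w')"

lemma std_nf: "std (nf w)" and equ_nf: "w \<approx> nf w"
  using someI_ex[OF std_exists[of w]] by (auto simp: nf_def)

lemma lexordp_eq_less: "ord_class.lexordp (xs :: 'a list) ys \<longleftrightarrow> xs < ys"
  by (simp add: lexordp_conv_lexord list_less_def)

lemma std_word_heap_of:
  assumes "std w"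
  shows "std_word (heap_of E w) = w"
  unfolding std_word_def lexordp_eq_less
proof (rule the_equality)
  show "w \<in> heap_of E w \<and> (\<forall>w'\<in>heap_of E w. w' \<noteq> w \<longrightarrow> w' < w)"
    using std_max[OF assms] by (auto simp: heap_of_def intro: le_neq_trans)
next
  fix v assume v: "v \<in> heap_of E w \<and> (\<forall>w'\<in>heap_of E w. w' \<noteq> v \<longrightarrow> w' < v)"
  then have "w \<noteq> v \<Longrightarrow> w < v" "w \<approx> v" by (auto simp: heap_of_def)
  then show "v = w" using std_max[OF assms, of v] by fastforce
qed

lemma std_word_nf: "std_word (heap_of E w) = nf w"
  using std_word_heap_of[OF std_nf, of w] heap_of_eq_iff[of w "nf w"] equ_nf[of w] by simp

lemma std_appendD: "std (u @ v) \<Longrightarrow> std u \<and> std v"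
  by (induction u) (auto simp: minl_append)

text \<open>A minimal label coming from v is at most \<open>hd v\<close>, hence at most every letter
  of u, and cannot spoil standardness. Powers, cyclic shifts and products of Lyndon factors all have
  this shape.\<close>

lemma std_append: "std u \<Longrightarrow> std v \<Longrightarrow> (\<And>a. v \<noteq> [] \<Longrightarrow> a \<in> set u \<Longrightarrow> hd v \<le> a) \<Longrightarrow> std (u @ v)"
proof (induction u)
  case (Cons a u)
  have "b \<le> a" if b: "b \<in> minl ((a # u) @ v)" for b
  proof -
    consider "b \<in> minl (a # u)" | "b \<in> minl v" using b unfolding minl_append by blast
    then show ?thesis
    proof cases
      case 2
      then show ?thesis using Cons.prems std_hd[of v b] by fastforce
    qed (use Cons.prems in auto)
  qed
  then show ?case using Cons by auto
qed simp

lemma std_concat_replicate: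
  assumes "std u" "\<And>a. a \<in> set u \<Longrightarrow> hd u \<le> a"
  shows "std (concat (replicate m u))"
proof (induction m)
  case (Suc m)
  show ?case
  proof (cases m)
    case (Suc k)
    have "hd (concat (replicate m u)) = hd u" if "u \<noteq> []"
      using Suc that by simp
    then have "std (u @ concat (replicate m u))"
      using assms \<open>std (concat (replicate m u))\<close>
      by (intro std_append) auto
    then show ?thesis by simp
  qed (use assms in simp)
qed simp

text \<open>Standardness bounds a minimal label above by the first letter, leastness bounds it
  below; so such a word represents a pyramid.\<close>

lemma std_minl_single:
  assumes "std w" "w \<noteq> []" "\<And>a. a \<in> set w \<Longrightarrow> hd w \<le> a"
  shows "minl w = {hd w}"
proof -
  have "b = hd w" if "b \<in> minl w" for b
    using std_hd[OF assms(1) that] assms(3)[of b] minl_subset[of w] that by force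
  then show ?thesis using hd_in_minl[OF assms(2)] by blast
qed

end

section \<open>Rotation of heaps\<close>

lemma nths_cong: "(\<And>i. i < length w \<Longrightarrow> i \<in> A \<longleftrightarrow> i \<in> B) \<Longrightarrow> nths w A = nths w B"
  unfolding nths_def by (intro arg_cong[where f = "map fst"] filter_cong) (auto simp: set_zip)

context trace_graph
begin

text \<open>If \<open>A\<close> contains the labels of pieces below \<open>y\<close>, then \<open>upp A y\<close> consists of the pieces of \<open>y\<close> that
  lie above one of them and \<open>low A y\<close> of the others.\<close>

fun upp :: "'a set \<Rightarrow> 'a list \<Rightarrow> 'a list" where
  "upp A [] = []"
| "upp A (b # y) = (if \<exists>a\<in>A. dep a b then b # upp (insert b A) y else upp A y)"

fun low :: "'a set \<Rightarrow> 'a list \<Rightarrow> 'a list" where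
  "low A [] = []"
| "low A (b # y) = (if \<exists>a\<in>A. dep a b then low (insert b A) y else b # low A y)"

lemma upp_append: "upp A (x @ y) = upp A x @ upp (A \<union> set (upp A x)) y"
  by (induction x arbitrary: A) auto

lemma low_append: "low A (x @ y) = low A x @ low (A \<union> set (upp A x)) y"
  by (induction x arbitrary: A) auto

lemma upp_upp [simp]: "upp A (upp A y) = upp A y"
  by (induction y arbitrary: A) auto

lemma mset_upp_low: "mset (upp A y) + mset (low A y) = mset y"
  by (induction y arbitrary: A) auto

lemma length_upp_low: "length (upp A y) + length (low A y) = length y"
  using arg_cong[OF mset_upp_low[of A y], of size] by simp

lemma low_eq_Nil_iff: "low A y = [] \<longleftrightarrow> (\<forall>b\<in>minl y. \<exists>a\<in>A. dep a b)"
  by (induction y arbitrary: A) auto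

lemma upp_if_low_Nil: "low A y = [] \<Longrightarrow> upp A y = y"
  by (induction y arbitrary: A) (auto split: if_splits)

lemma low_if_upp_Nil: "upp A y = [] \<Longrightarrow> low A y = y \<and> (\<forall>b\<in>set y. \<forall>a\<in>A. \<not> dep a b)"
  by (induction y arbitrary: A) (auto split: if_splits)

lemma minl_Cons_single_iff: "minl (a # y) = {a} \<longleftrightarrow> low {a} y = []"
  unfolding low_eq_Nil_iff by auto

lemma upp_low_equ: "y \<approx> y' \<Longrightarrow> upp A y \<approx> upp A y' \<and> low A y \<approx> low A y'"
proof (induction arbitrary: A rule: equ_induct)
  case (swap u v ys)
  then have "\<not> dep v u" using dep_sym by blast
  with swap show ?case by (auto simp: insert_commute intro: equ_swap)
next
  case (Cons a w w')
  then show ?case by (auto intro: equ_Cons)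
next
  case (trans x y z)
  then show ?case by (meson equ_trans)
qed simp

text \<open>The rotation A_p at the displayed a of \<open>x @ a # y\<close>: V_p is
  \<open>a # upp {a} y\<close>, and U is \<open>x @ low {a} y\<close>.\<close>

definition rotw :: "'a list \<Rightarrow> 'a \<Rightarrow> 'a list \<Rightarrow> 'a list" where
  "rotw x a y = a # upp {a} y @ x @ low {a} y"

lemma piece_prec_snoc:
  "j < length w \<Longrightarrow> piece_prec E (w @ [b]) i j \<longleftrightarrow> piece_prec E w i j"
  "piece_prec E (w @ [b]) i (length w) \<longleftrightarrow> i < length w \<and> dep (w ! i) b"
  by (auto simp: piece_prec_def nth_append dep_def)

text \<open>Precedence respects positions, so a new last letter adds no relation between earlier
  pieces, and it can be reached from p only through a dependent piece above p.\<close>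

lemma piece_le_snoc:
  assumes "p < length w"
  shows "j < length w \<Longrightarrow> piece_le E (w @ [b]) p j \<longleftrightarrow> piece_le E w p j"
    and "piece_le E (w @ [b]) p (length w) \<longleftrightarrow> (\<exists>i<length w. piece_le E w p i \<and> dep (w ! i) b)"
proof -
  have lt: "piece_prec E w i j \<Longrightarrow> i < length w \<and> j < length w" for w i j
    by (auto simp: piece_prec_def)
  note prec = piece_prec_snoc(1)[of _ w b] and prec' = piece_prec_snoc(2)[of w b]
  have mono: "piece_le E w i j \<Longrightarrow> piece_le E (w @ [b]) i j" for i j
    unfolding piece_le_def
    using rtranclp_mono[of "piece_prec E w" "piece_prec E (w @ [b])"] lt prec by blast
  have conv: "piece_le E (w @ [b]) p j \<Longrightarrow> 
      (j < length w \<and> piece_le E w p j) \<or> (j = length w \<and> (\<exists>i<length w. piece_le E w p i \<and> dep (w ! i) b))" for j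
    unfolding piece_le_def
  proof (induction rule: rtranclp_induct)
    case base
    then show ?case using assms by simp
  next
    case (step y z)
    have z: "z < Suc (length w)" "y < z" using step.hyps(2) by (auto simp: piece_prec_def)
    then have y: "y < length w" "(piece_prec E w)\<^sup>*\<^sup>* p y" using step.IH by auto
    show ?case
    proof (cases "z < length w")
      case True
      then show ?thesis using step.hyps(2) prec y by (auto intro: rtranclp.rtrancl_into_rtrancl)
    next
      case False
      then have "z = length w" using z by simp
      then show ?thesis using step.hyps(2) prec' y by auto
    qed
  qed
  show "j < length w \<Longrightarrow> piece_le E (w @ [b]) p j \<longleftrightarrow> piece_le E w p j"
    using mono conv by blast
  show "piece_le E (w @ [b]) p (length w) \<longleftrightarrow> (\<exists>i<length w. piece_le E w p i \<and> dep (w ! i) b)"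
  proof
    assume "\<exists>i<length w. piece_le E w p i \<and> dep (w ! i) b"
    then obtain i where i: "i < length w" "piece_le E w p i" "dep (w ! i) b" by blast
    show "piece_le E (w @ [b]) p (length w)"
      using mono[OF i(2)] prec'[of i] i unfolding piece_le_def
      by (auto intro: rtranclp.rtrancl_into_rtrancl)
  qed (use conv in blast)
qed

text \<open>The transitive closure is built up by appending letters at the right. The third conjunct
  carries the induction: whether a new letter lies above the piece depends only on the labels
  already found above it.\<close>

lemma piece_le_split:
  fixes x a y
  defines "w \<equiv> x @ a # y" and "p \<equiv> length x"
  shows "nths w {j. piece_le E w p j} = a # upp {a} y
    \<and> nths w {j. \<not> piece_le E w p j} = x @ low {a} y
    \<and> (\<forall>c. (\<exists>i<length w. piece_le E w p i \<and> w ! i = c) \<longleftrightarrow> c \<in> insert a (set (upp {a} y)))"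
  unfolding w_def
proof (induction y rule: rev_induct)
  case Nil
  have le: "piece_le E (x @ [a]) p j \<longleftrightarrow> j = p" if "j \<le> p" for j
  proof -
    have "piece_le E (x @ [a]) p j \<Longrightarrow> p \<le> j" for j
      unfolding piece_le_def by (induction rule: rtranclp_induct) (auto simp: piece_prec_def)
    then show ?thesis using that by (metis le_antisym piece_le_def rtranclp.rtrancl_refl)
  qed
  have 1: "nths x {j. piece_le E (x @ [a]) p j} = []" 
    unfolding set_empty[symmetric] set_nths using le by (force simp: p_def)
  have 2: "nths x {j. \<not> piece_le E (x @ [a]) p j} = x"
    using le by (intro nths_all) (simp add: p_def)
  have "(\<exists>i<length (x @ [a]). piece_le E (x @ [a]) p i \<and> (x @ [a]) ! i = c) \<longleftrightarrow> c \<in> insert a (set (upp {a} []))" for c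
  proof -
    have "i < length (x @ [a]) \<and> piece_le E (x @ [a]) p i \<longleftrightarrow> i = p" for i
      using le[of i] le[of p] by (auto simp: p_def less_Suc_eq_le)
    then have "(\<exists>i<length (x @ [a]). piece_le E (x @ [a]) p i \<and> (x @ [a]) ! i = c) \<longleftrightarrow> (x @ [a]) ! p = c"
      by (simp only: conj_assoc[symmetric] simp_thms)
    then show ?thesis by (auto simp: p_def)
  qed
  moreover have "piece_le E (x @ [a]) (length x) (length x)" using le[of p] by (simp add: p_def)
  ultimately show ?case using 1 2 unfolding p_def by (simp add: nths_append)
next
  case (snoc b y)
  let ?w = "x @ a # y"
  have p: "p < length ?w" by (simp add: p_def)
  have W: "x @ a # y @ [b] = ?w @ [b]" by simp
  have set_eq: "nths ?w {j. piece_le E (?w @ [b]) p j} = nths ?w {j. piece_le E ?w p j}"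
    "nths ?w {j. \<not> piece_le E (?w @ [b]) p j} = nths ?w {j. \<not> piece_le E ?w p j}"
    by (rule nths_cong, use piece_le_snoc(1)[OF p] in blast)+
  have new: "piece_le E (?w @ [b]) p (length ?w) \<longleftrightarrow> (\<exists>c\<in>insert a (set (upp {a} y)). dep c b)"
    unfolding piece_le_snoc(2)[OF p] using snoc.IH by metis
  have mem: "(\<exists>i<length (?w @ [b]). piece_le E (?w @ [b]) p i \<and> (?w @ [b]) ! i = c) \<longleftrightarrow>
      (\<exists>i<length ?w. piece_le E ?w p i \<and> ?w ! i = c) \<or> piece_le E (?w @ [b]) p (length ?w) \<and> c = b"
    (is "?l \<longleftrightarrow> ?r") for c
  proof
    assume ?l
    then obtain i where i: "i < length (?w @ [b])" "piece_le E (?w @ [b]) p i" "(?w @ [b]) ! i = c" by blast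
    show ?r
    proof (cases "i < length ?w")
      case True
      then show ?thesis using i piece_le_snoc(1)[OF p True, of b] by (auto simp only: nth_append if_True)
    next
      case False
      then have "i = length ?w" using i(1) by simp
      then show ?thesis using i by (simp only: nth_append_length) simp
    qed
  next
    assume ?r
    then show ?l
    proof
      assume "\<exists>i<length ?w. piece_le E ?w p i \<and> ?w ! i = c"
      then obtain i where i: "i < length ?w" "piece_le E ?w p i" "?w ! i = c" by blast
      then show ?l using piece_le_snoc(1)[OF p i(1), of b]
        by (intro exI[of _ i]) (simp only: nth_append length_append, simp)
    next
      assume "piece_le E (?w @ [b]) p (length ?w) \<and> c = b"
      then show ?l by (intro exI[of _ "length ?w"]) (simp only: nth_append_length, simp)
    qed
  qed
  show ?case
    unfolding W nths_append[of ?w "[b]"] set_eq mem using snoc.IH new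
    by (simp add: upp_append low_append)
qed

lemma rot_eq: "rot E (x @ a # y) (length x) = rotw x a y"
  using piece_le_split[of x a y] by (simp add: rot_def rotw_def)

lemma rot_0: "rot E (a # y) 0 = a # upp {a} y @ low {a} y"
  using rot_eq[of "[]" a y] by (simp add: rotw_def)

text \<open>A piece can be followed through an equivalence: wherever the swaps move it, the pieces
  above it and the remaining ones keep their heaps.\<close>

lemma rot_equ:
  "w \<approx> w' \<Longrightarrow> w = x @ a # y \<Longrightarrow> 
    \<exists>x' y'. w' = x' @ a # y' \<and> upp {a} y \<approx> upp {a} y' \<and> x @ low {a} y \<approx> x' @ low {a} y'"
proof (induction arbitrary: x a y rule: equ_induct)
  case (refl w)
  then show ?case by (intro exI[of _ x] exI[of _ y]) auto
next
  case (swap u v ys)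
  note * = swap.prems
  have vu: "\<not> dep v u" "u \<noteq> v" using swap.hyps dep_sym by auto
  \<comment> \<open>The marked letter is the first or the second of the swapped pair, or it stands
    behind both.\<close>
  consider "x = []" | "x = [u]" | x' where "x = u # v # x'"
    using * by (cases x; cases "tl x") auto
  then show ?case
  proof cases
    case 1
    then show ?thesis using * swap.hyps
      by (intro exI[of _ "[v]"] exI[of _ ys]) auto
  next
    case 2
    then show ?thesis using * vu
      by (intro exI[of _ "[]"] exI[of _ "u # ys"]) auto
  next
    case (3 x')
    then show ?thesis using * swap.hyps
      by (intro exI[of _ "v # u # x'"] exI[of _ y]) (auto intro!: equ_swap)
  qed
next
  case (Cons c w w')
  show ?case
  proof (cases x)
    case Nil
    then show ?thesis using Cons.prems upp_low_equ[OF Cons.hyps, of "{a}"]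
      by (intro exI[of _ "[]"] exI[of _ w']) auto
  next
    case (Cons d z)
    then have d: "d = c" "w = z @ a # y" using Cons.prems by auto
    then obtain x' y' where xy: "w' = x' @ a # y'" "upp {a} y \<approx> upp {a} y'"
      "z @ low {a} y \<approx> x' @ low {a} y'" using Cons.IH by blast
    then show ?thesis using Cons d
      by (intro exI[of _ "c # x'"] exI[of _ y']) (auto intro: equ_Cons)
  qed
next
  case (trans x1 y1 z1)
  from trans.IH(1)[OF trans.prems] obtain x' y' where "y1 = x' @ a # y'"
    "upp {a} y \<approx> upp {a} y'" "x @ low {a} y \<approx> x' @ low {a} y'" by blast
  with trans.IH(2)[of x' a y'] show ?case by (meson equ_trans)
qed

lemma rotw_equ:
  assumes "x @ a # y \<approx> w'"
  obtains x' y' where "w' = x' @ a # y'" "rotw x a y \<approx> rotw x' a y'"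
  using rot_equ[OF assms refl] unfolding rotw_def by (metis equ_Cons equ_append)

end

section \<open>Lyndon heaps and Lyndon words\<close>

text \<open>The strict inequality excludes proper powers, since some proper cyclic shift of a power
  is the word itself; this mirrors the aperiodicity of Lyndon heaps.\<close>

definition lyndon :: "'a::linorder list \<Rightarrow> bool" where
  "lyndon w \<longleftrightarrow> w \<noteq> [] \<and> (\<forall>u v. w = u @ v \<longrightarrow> u \<noteq> [] \<longrightarrow> v \<noteq> [] \<longrightarrow> w < v @ u)"

lemma lyndon_hd_le:
  assumes "lyndon w" "c \<in> set w"
  shows "hd w \<le> c"
proof -
  obtain u v where w: "w = u @ c # v" using assms(2) split_list by fastforce
  show ?thesis
  proof (cases u)
    case (Cons b t)
    then have "w < (c # v) @ u" using assms(1) w unfolding lyndon_def by blast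
    then show ?thesis using Cons w by auto
  qed (use w in simp)
qed

lemma concat_replicate_Suc: "concat (replicate (Suc m) s) = concat (replicate m s) @ s"
  by (induction m) auto

context trace_graph
begin

lemma minl_eq_nth_image:
  "minl w = (!) w ` {j. j < length w \<and> (\<forall>i. \<not> piece_prec E w i j)}"
proof (induction w rule: rev_induct)
  case (snoc b w)
  have "{j. j < length (w @ [b]) \<and> (\<forall>i. \<not> piece_prec E (w @ [b]) i j)} =
      {j. j < length w \<and> (\<forall>i. \<not> piece_prec E w i j)} \<union> (if \<forall>a\<in>set w. \<not> dep a b then {length w} else {})"
    (is "?l = ?r")
  proof (rule set_eqI)
    fix j
    consider "j < length w" | "j = length w" | "j > length w" by linarith
    then show "j \<in> ?l \<longleftrightarrow> j \<in> ?r"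
      by cases (auto simp: piece_prec_snoc all_set_conv_all_nth)
  qed
  then show ?case using snoc
    by (auto simp: minl_append nth_append image_iff)
qed simp

text \<open>Two pieces with equal labels are comparable, so minimal pieces may be counted by their
  labels.\<close>

lemma card_minimal_pieces:
  "card {j. j < length w \<and> (\<forall>i. \<not> piece_prec E w i j)} = card (minl w)"
  unfolding minl_eq_nth_image
proof (rule card_image[symmetric], rule linorder_inj_onI)
  fix x y assume "x < y" "x \<in> {j. j < length w \<and> (\<forall>i. \<not> piece_prec E w i j)}"
    "y \<in> {j. j < length w \<and> (\<forall>i. \<not> piece_prec E w i j)}"
  then show "w ! x \<noteq> w ! y" by (auto simp: piece_prec_def)
qed auto

lemma is_pyramid_iff: "is_pyramid E (heap_of E w) \<longleftrightarrow> w \<noteq> [] \<and> minl w = {hd w}"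
proof -
  have "is_pyramid E (heap_of E w) \<longleftrightarrow> card (minl w) = 1"
    unfolding is_pyramid_def card_minimal_pieces heap_of_def
    by (metis equ_refl mem_Collect_eq minl_equ)
  also have "\<dots> \<longleftrightarrow> w \<noteq> [] \<and> minl w = {hd w}"
  proof
    assume "card (minl w) = 1"
    then obtain b where "minl w = {b}" by (rule card_1_singletonE)
    then show "w \<noteq> [] \<and> minl w = {hd w}" using hd_in_minl[of w] minl_eq_empty[of w] by auto
  qed simp
  finally show ?thesis .
qed

text \<open>The rotation \<open>A\<^sub>p\<close> at the first letter \<open>a\<close> of a word \<open>a # z\<close>, as a map on \<open>z\<close>.\<close>

definition resplit :: "'a \<Rightarrow> 'a list \<Rightarrow> 'a list" where
  "resplit a z = upp {a} z @ low {a} z"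

lemma mset_resplit [simp]: "mset (resplit a z) = mset z"
  by (simp add: resplit_def mset_upp_low)

lemma mset_resplit_pow [simp]: "mset ((resplit a ^^ n) z) = mset z"
  by (induction n) auto

lemma low_upp [simp]: "low A (upp A y) = []"
  by (induction y arbitrary: A) auto

text \<open>Each rotation moves into the upper part those remaining pieces that depend, directly or
  through others, on what is already there. So \<open>low\<close> shrinks until nothing is left to
  move, and then the word is fixed.\<close>

lemma resplit_stabilises: "\<exists>N. resplit a ((resplit a ^^ N) z) = (resplit a ^^ N) z"
proof (induction "length (low {a} z)" arbitrary: z rule: less_induct)
  case less
  let ?u = "upp ({a} \<union> set (upp {a} z)) (low {a} z)"
  have low: "low {a} (resplit a z) = low ({a} \<union> set (upp {a} z)) (low {a} z)"
    by (simp add: resplit_def low_append)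
  show ?case
  proof (cases "?u = []")
    case True
    then have "resplit a (resplit a z) = resplit a z"
      using low_if_upp_Nil[OF True] True by (simp add: resplit_def low_append upp_append)
    then show ?thesis by (intro exI[of _ 1]) simp
  next
    case False
    then have "length (low {a} (resplit a z)) < length (low {a} z)"
      using length_upp_low[of "{a} \<union> set (upp {a} z)" "low {a} z"] unfolding low
      by (metis add_less_cancel_right add_0 length_greater_0_conv)
    from less[OF this] obtain N where "resplit a ((resplit a ^^ N) (resplit a z)) = (resplit a ^^ N) (resplit a z)"
      by blast
    then show ?thesis by (intro exI[of _ "Suc N"]) (simp add: funpow_swap1)
  qed
qed

lemma rot_0_pow: "((\<lambda>u. rot E u 0) ^^ n) (a # z) = a # (resplit a ^^ n) z"
  by (induction n) (auto simp: rot_0 resplit_def)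

lemma rot_limit_iff_if_fixed:
  fixes x a y N
  defines "z \<equiv> (resplit a ^^ N) (upp {a} y @ x @ low {a} y)"
  assumes "resplit a z = z"
  shows "rot_limit E (x @ a # y) (length x) H \<longleftrightarrow> H = heap_of E (a # z)"
proof -
  let ?z = "upp {a} y @ x @ low {a} y"
  have stable: "(resplit a ^^ n) ?z = z" if "n \<ge> N" for n
    using that
  proof (induction rule: dec_induct)
    case base
    then show ?case by (simp add: z_def)
  next
    case (step n)
    then show ?case using assms(2) by simp
  qed
  have R: "rot_limit E (x @ a # y) (length x) H \<longleftrightarrow> (\<exists>M. \<forall>n\<ge>M. heap_of E (a # (resplit a ^^ n) ?z) = H)"
    unfolding rot_limit_def rot_eq rotw_def rot_0_pow ..
  show ?thesis
  proof
    assume "rot_limit E (x @ a # y) (length x) H"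
    then obtain M where "\<forall>n\<ge>M. heap_of E (a # (resplit a ^^ n) ?z) = H" unfolding R ..
    then have "heap_of E (a # (resplit a ^^ (max M N)) ?z) = H" by simp
    then show "H = heap_of E (a # z)" using stable[of "max M N"] by simp
  next
    assume "H = heap_of E (a # z)"
    then show "rot_limit E (x @ a # y) (length x) H" unfolding R using stable by blast
  qed
qed

lemma rot_limit_exists:
  obtains z where "resplit a z = z" "mset (a # z) = mset (x @ a # y)"
    "\<And>H. rot_limit E (x @ a # y) (length x) H \<longleftrightarrow> H = heap_of E (a # z)"
proof -
  let ?z = "upp {a} y @ x @ low {a} y"
  obtain N where N: "resplit a ((resplit a ^^ N) ?z) = (resplit a ^^ N) ?z"
    using resplit_stabilises by blast
  have "mset ((resplit a ^^ N) ?z) = mset x + mset y"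
    using mset_upp_low[of "{a}" y] by (simp add: ac_simps)
  then show ?thesis
    using that[OF N] rot_limit_iff_if_fixed[OF N] by simp
qed

text \<open>\<open>P\<close> acts as a union of connected components of the dependence graph:
  started inside P, \<open>upp\<close> never leaves it.\<close>

lemma set_upp_subset:
  assumes "A \<subseteq> P" "\<And>b. b \<in> set y \<Longrightarrow> b \<in> P \<or> (\<forall>d\<in>P. \<not> dep d b)"
  shows "set (upp A y) \<subseteq> P"
  using assms
proof (induction y arbitrary: A)
  case (Cons b y)
  show ?case
  proof (cases "\<exists>a\<in>A. dep a b")
    case True
    then have "b \<in> P" using Cons.prems(1) Cons.prems(2)[of b] by auto
    then show ?thesis using True Cons.prems Cons.IH[of "insert b A"] by simp
  next
    case False
    then show ?thesis using Cons.prems Cons.IH[of A] by simp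
  qed
qed simp

text \<open>At a fixed point the pieces outside the part above a are independent of that whole part.
  The letters of a pyramid are connected and \<open>a # z\<close> has the letters of w, so there are
  no such pieces.\<close>

lemma pyramid_if_fixed:
  assumes pyr: "w \<noteq> []" "minl w = {hd w}" and ms: "mset (a # z) = mset w" and fixed: "resplit a z = z"
  shows "minl (a # z) = {a}"
proof -
  define v u where "v = upp {a} z" and "u = low {a} z"
  have z: "z = v @ u" using fixed by (simp add: resplit_def v_def u_def)
  have "v @ upp ({a} \<union> set v) u = v"
    using arg_cong[OF z, of "upp {a}"] unfolding upp_append v_def by simp
  then have indep: "\<forall>b\<in>set u. \<forall>d\<in>insert a (set v). \<not> dep d b"
    using low_if_upp_Nil by fastforce
  have sw: "set w = insert a (set v) \<union> set u" using mset_eq_setD[OF ms] z by auto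
  obtain c y where w: "w = c # y" using pyr(1) by (cases w) auto
  then have up: "upp {c} y = y" using pyr(2) minl_Cons_single_iff upp_if_low_Nil by simp
  \<comment> \<open>The base c of the given pyramid lies on one of two mutually independent sides,
    and everything above it stays on that side.\<close>
  have "u = []"
  proof (cases "c \<in> insert a (set v)")
    case True
    have "set (upp {c} y) \<subseteq> insert a (set v)"
    proof (rule set_upp_subset)
      fix b assume "b \<in> set y"
      then have "b \<in> set w" using w by simp
      then show "b \<in> insert a (set v) \<or> (\<forall>d\<in>insert a (set v). \<not> dep d b)" using sw indep by blast
    qed (use True in simp)
    then have "set w \<subseteq> insert a (set v)" using True w up by simp
    then have "set u \<subseteq> insert a (set v)" using sw by blast
    then have "b \<notin> set u" for b using indep dep_refl[of b] by blast
    then show ?thesis by (cases u) auto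
  next
    case False
    have "c \<in> insert a (set v) \<union> set u" unfolding sw[symmetric] w by simp
    then have c: "c \<in> set u" using False by simp
    have "set (upp {c} y) \<subseteq> set u"
    proof (rule set_upp_subset)
      fix b assume "b \<in> set y"
      then have "b \<in> set w" using w by simp
      then show "b \<in> set u \<or> (\<forall>d\<in>set u. \<not> dep d b)" using sw indep dep_sym by blast
    qed (use c in simp)
    then have "set w \<subseteq> set u" using c w up by simp
    then have "a \<in> set u" using sw by blast
    then show ?thesis using indep dep_refl[of a] by blast
  qed
  then show ?thesis unfolding minl_Cons_single_iff u_def .
qed

lemma rotation_class_iff:
  "H \<in> rotation_class E (heap_of E w) \<longleftrightarrow>
    (\<exists>x a y. w \<approx> x @ a # y \<and> rot_limit E (x @ a # y) (length x) H)"
proof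
  assume "H \<in> rotation_class E (heap_of E w)"
  then obtain v p where v: "w \<approx> v" "p < length v" "rot_limit E v p H"
    by (auto simp: rotation_class_def heap_of_def)
  have "v = take p v @ v ! p # drop (Suc p) v" "length (take p v) = p"
    using v(2) id_take_nth_drop by auto
  then show "\<exists>x a y. w \<approx> x @ a # y \<and> rot_limit E (x @ a # y) (length x) H"
    using v by metis
next
  assume "\<exists>x a y. w \<approx> x @ a # y \<and> rot_limit E (x @ a # y) (length x) H"
  then obtain x a y where "w \<approx> x @ a # y" "rot_limit E (x @ a # y) (length x) H" by blast
  then show "H \<in> rotation_class E (heap_of E w)"
    unfolding rotation_class_def heap_of_def
    by (intro CollectI bexI[of _ "x @ a # y"] exI[of _ "length x"]) auto
qed

lemma hd_nf:
  assumes "minl w = {a}"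
  shows "nf w \<noteq> [] \<and> hd (nf w) = a"
proof -
  have "minl (nf w) = {a}" using minl_equ[OF equ_nf[of w]] assms by simp
  moreover from this have "nf w \<noteq> []" by (metis insert_not_empty minl_eq_empty)
  ultimately show ?thesis using hd_in_minl[of "nf w"] by simp
qed

lemma less_if_hd_less: "x \<noteq> [] \<Longrightarrow> y \<noteq> [] \<Longrightarrow> hd x < hd y \<Longrightarrow> (x :: 'a list) < y"
  by (cases x; cases y) auto

text \<open>With a least, both \<open>a # y\<close> and the shift \<open>a # y @ x\<close> are
  standard words beginning with their least letter, hence pyramids. So the heap rotation is the
  cyclic shift and is already stable after one step. The primed words mark the corresponding piece
  in another representative.\<close>

lemma rotation_at_least_letter:
  assumes "std (x @ a # y)" "x = [] \<or> hd x = a" "\<forall>c\<in>set (x @ a # y). a \<le> c"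
    and "w \<approx> x @ a # y" "w = x' @ a # y'" "rotw x' a y' \<approx> rotw x a y"
  shows "std (a # y @ x)"
    and "rot_limit E w (length x') H \<longleftrightarrow> H = heap_of E (a # y @ x)"
proof -
  have s: "std x" "std (a # y)" using std_appendD[OF assms(1)] by auto
  have "minl (a # y) = {a}" using std_minl_single[OF s(2)] assms(3) by auto
  then have "upp {a} y = y" "low {a} y = []" using minl_Cons_single_iff upp_if_low_Nil by auto
  then have r: "rotw x a y = a # y @ x" by (simp add: rotw_def)
  show st: "std (a # y @ x)" using std_append[OF s(2,1)] assms(2,3) by auto
  have "minl (a # y @ x) = {a}" using std_minl_single[OF st] assms(3) by auto
  then have "minl (rotw x' a y') = {a}" using minl_equ[OF assms(6)] r by simp
  then have "low {a} (upp {a} y' @ x' @ low {a} y') = []"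
    unfolding rotw_def minl_Cons_single_iff .
  then have fixed: "resplit a (upp {a} y' @ x' @ low {a} y') = upp {a} y' @ x' @ low {a} y'"
    using upp_if_low_Nil by (simp add: resplit_def)
  have "rot_limit E w (length x') H \<longleftrightarrow> H = heap_of E (rotw x' a y')"
    using rot_limit_iff_if_fixed[of a 0 y' x' H] fixed assms(5) by (simp add: rotw_def)
  moreover have "heap_of E (rotw x' a y') = heap_of E (a # y @ x)"
    using assms(6) r heap_of_eq_iff by simp
  ultimately show "rot_limit E w (length x') H \<longleftrightarrow> H = heap_of E (a # y @ x)" by simp
qed

text \<open>The repeated word may be taken standard. As w is a pyramid over its least letter, that
  word begins with this letter, so its power is standard and equals w as a word; a Lyndon word is
  not a proper power.\<close>

lemma lyndon_not_periodic:
  assumes "std w" "lyndon w"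
  shows "\<not> periodic E (heap_of E w)"
proof
  assume "periodic E (heap_of E w)"
  then obtain u m where m: "m > 1" "w \<approx> concat (replicate m u)"
    by (auto simp: periodic_def heap_of_def intro: equ_trans)
  define s where "s = nf u"
  have ws: "w \<approx> concat (replicate m s)" 
    using m(2) equ_concat_replicate[OF equ_nf, of m u] equ_trans s_def by blast
  obtain k where k: "m = Suc (Suc k)" using m(1) by (metis One_nat_def less_imp_Suc_add add_Suc)
  have sets: "set w = set s" using equ_set[OF ws] k by auto
  have wne: "w \<noteq> []" and hdw: "\<And>c. c \<in> set w \<Longrightarrow> hd w \<le> c"
    using assms(2) lyndon_hd_le by (auto simp: lyndon_def)
  have "s \<noteq> []" using sets wne by auto
  then have "hd s \<in> minl (concat (replicate m s))" using hd_in_minl[of s] k by (simp add: minl_append)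
  then have "hd s = hd w" using minl_equ[OF ws] std_minl_single[OF assms(1) wne hdw] by auto
  then have "std (concat (replicate m s))"
    using std_concat_replicate[of s] std_nf hdw sets s_def by simp
  then have eq: "w = concat (replicate m s)" using std_unique assms(1) ws by blast
  have "w = s @ concat (replicate (Suc k) s)" using eq k by simp
  moreover have "concat (replicate (Suc k) s) @ s = w" using eq k concat_replicate_Suc[of "Suc k" s] by simp
  ultimately show False using assms(2) \<open>s \<noteq> []\<close> unfolding lyndon_def by force
qed

lemma lyndon_heapI:
  assumes "std w" "lyndon w" "set w \<subseteq> V"
  shows "lyndon_heap V E (heap_of E w)"
  unfolding lyndon_heap_def lexordp_eq_less
proof (intro conjI ballI)
  have wne: "w \<noteq> []" and hdw: "\<And>c. c \<in> set w \<Longrightarrow> hd w \<le> c"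
    using assms(2) lyndon_hd_le by (auto simp: lyndon_def)
  have pyr: "minl w = {hd w}" using std_minl_single[OF assms(1) wne hdw] .
  show "heap_of E w \<in> heaps V E" using assms(3) by (auto simp: heaps_def)
  show "is_pyramid E (heap_of E w)" using pyr wne is_pyramid_iff by blast
  show "\<not> periodic E (heap_of E w)" using lyndon_not_periodic assms by blast
  fix H assume "H \<in> rotation_class E (heap_of E w)"
  then obtain x a y where w: "w \<approx> x @ a # y" "rot_limit E (x @ a # y) (length x) H"
    unfolding rotation_class_iff by blast
  have sw: "std_word (heap_of E w) = w" using std_word_heap_of[OF assms(1)] .
  have a: "a \<in> set w" using equ_set[OF w(1)] by auto
  show "std_word (heap_of E w) = std_word H \<or> std_word (heap_of E w) < std_word H"
  proof (cases "hd w = a")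
    case False
    \<comment> \<open>Rotation at a larger letter a ends in a pyramid over a, whose standard word
      exceeds w already at the first letter.\<close>
    then have lt: "hd w < a" using hdw[OF a] by simp
    obtain z where z: "resplit a z = z" "mset (a # z) = mset (x @ a # y)" "H = heap_of E (a # z)"
      using rot_limit_exists w(2) by metis
    have "minl (a # z) = {a}" using pyramid_if_fixed[OF wne pyr _ z(1)] z(2) equ_mset[OF w(1)] by simp
    from hd_nf[OF this] show ?thesis
      using less_if_hd_less[OF wne] lt sw z(3) std_word_nf by simp
  next
    case True
    obtain x' y' where r: "w = x' @ a # y'" "rotw x a y \<approx> rotw x' a y'"
      using rotw_equ[OF equ_sym[OF w(1)]] by metis
    have hx: "x' = [] \<or> hd x' = a" using True r(1) by (cases x') auto
    have std': "std (x' @ a # y')" using assms(1) r(1) by simp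
    have "\<forall>c\<in>set w. a \<le> c" using hdw unfolding True by blast
    note least' = this[unfolded r(1)]
    have equ: "x @ a # y \<approx> x' @ a # y'" using equ_sym[OF w(1)] r(1) by simp
    note R = rotation_at_least_letter[of x' a y' "x @ a # y" x y, OF std' hx least' equ refl r(2)]
    have H: "H = heap_of E (a # y' @ x')" using w(2) unfolding R(2) .
    have s: "std (a # y' @ x')" by (rule R(1))
    have "w = (a # y') @ x' \<or> w < (a # y') @ x'"
      using assms(2)[unfolded lyndon_def, THEN conjunct2, rule_format, of x' "a # y'"] r(1)
      by (cases "x' = []") auto
    then show ?thesis using sw H std_word_heap_of[OF s] by simp
  qed
qed

text \<open>Rotating at the least letter m ends in a pyramid over m; minimality in the class then
  forces w itself to begin with m. From there on, rotations at m are cyclic shifts whose words are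
  standard, and they can be compared with w directly.\<close>

lemma lyndon_heapD:
  assumes "std w" "lyndon_heap V E (heap_of E w)"
  shows "lyndon w" and "set w \<subseteq> V"
proof -
  have sw: "std_word (heap_of E w) = w" using std_word_heap_of[OF assms(1)] .
  obtain w' where "heap_of E w = heap_of E w'" "set w' \<subseteq> V"
    using assms(2) unfolding lyndon_heap_def heaps_def by blast
  then show "set w \<subseteq> V" using heap_of_eq_iff equ_set by blast
  have pyr: "w \<noteq> []" "minl w = {hd w}"
    using assms(2) is_pyramid_iff unfolding lyndon_heap_def by blast+
  have aper: "\<not> periodic E (heap_of E w)" using assms(2) by (simp add: lyndon_heap_def)
  have least: "w \<le> std_word H" if "rot_limit E (x @ a # y) (length x) H" "w = x @ a # y" for x a y H
  proof -
    have "H \<in> rotation_class E (heap_of E w)" using that equ_refl unfolding rotation_class_iff by blast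
    then have "std_word (heap_of E w) = std_word H \<or> std_word (heap_of E w) < std_word H"
      using assms(2) unfolding lyndon_heap_def lexordp_eq_less by blast
    then show ?thesis using sw by auto
  qed
  define m where "m = Min (set w)"
  have m: "m \<in> set w" "\<And>c. c \<in> set w \<Longrightarrow> m \<le> c" using pyr(1) by (auto simp: m_def)
  obtain x y where xy: "w = x @ m # y" using m(1) split_list by fastforce
  obtain z where z: "resplit m z = z" "mset (m # z) = mset w" "rot_limit E w (length x) (heap_of E (m # z))"
    using rot_limit_exists xy by metis
  have "minl (m # z) = {m}" using pyramid_if_fixed[OF pyr z(2,1)] .
  note nf = hd_nf[OF this]
  have "w \<le> nf (m # z)" using least[of x m y] z(3) xy std_word_nf by metis
  then have "hd w \<le> m" using nf pyr(1) by (cases w; cases "nf (m # z)") auto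
  then have hdw: "\<And>c. c \<in> set w \<Longrightarrow> hd w \<le> c" using m(2) order_trans by blast
  show "lyndon w"
    unfolding lyndon_def
  proof (intro conjI allI impI)
    fix u v assume uv: "w = u @ v" "u \<noteq> []" "v \<noteq> []"
    show "w < v @ u"
    proof (cases "hd v = hd w")
      case False
      have "hd v \<in> set w" using uv by simp
      then have "hd w < hd v" using hdw False by (metis order.not_eq_order_implies_strict)
      then show ?thesis using less_if_hd_less[OF pyr(1), of "v @ u"] uv by simp
    next
      case True
      then obtain b t where v: "v = b # t" "b = hd w" using uv(3) by (cases v) auto
      have w: "w = u @ b # t" using uv(1) v(1) by simp
      have hu: "u = [] \<or> hd u = b" using uv(1,2) v(2) by simp
      have std': "std (u @ b # t)" using assms(1) w by simp
      have "\<forall>c\<in>set w. b \<le> c" using hdw unfolding v(2) by blast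
      note least' = this[unfolded w]
      have equ: "w \<approx> u @ b # t" using w by simp
      note R = rotation_at_least_letter[of u b t w u t, OF std' hu least' equ w equ_refl]
      have "rot_limit E w (length u) (heap_of E (b # t @ u))" unfolding R(2) ..
      moreover have s: "std (b # t @ u)" by (rule R(1))
      ultimately have "w \<le> v @ u" using least[of u b t "heap_of E (b # t @ u)"] w std_word_heap_of[OF s] v(1) by simp
      moreover have "w \<noteq> v @ u"
      proof
        assume "w = v @ u"
        then have "u @ v = v @ u" unfolding uv(1) .
        \<comment> \<open>Commuting words are powers of a common word, so equality with a cyclic
          shift would make the heap periodic.\<close>
        then obtain k n zs where kn: "concat (replicate k zs) = u" "concat (replicate n zs) = v"
          using comm_append_are_replicate by blast
        then have "k \<noteq> 0" "n \<noteq> 0" using uv(2,3) by auto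
        then have gt: "k + n > 1" by linarith
        have "w = concat (replicate (k + n) zs)" unfolding uv(1) kn[symmetric] by (simp add: replicate_add)
        then have equ: "w \<approx> concat (replicate (k + n) zs)" using equ_refl by metis
        have "w \<in> heap_of E w" by (simp add: heap_of_def)
        then have "periodic E (heap_of E w)" unfolding periodic_def using gt equ by blast
        then show False using aper by blast
      qed
      ultimately show ?thesis by (rule le_neq_trans)
    qed
  qed (rule pyr(1))
qed

lemma lyndon_heap_iff:
  assumes "std w"
  shows "lyndon_heap V E (heap_of E w) \<longleftrightarrow> set w \<subseteq> V \<and> lyndon w"
  using lyndon_heapI[OF assms] lyndon_heapD[OF assms] by metis

end

section \<open>Factorization into Lyndon words\<close>

lemma append_less_append [simp]: "(x :: 'a::linorder list) @ p < x @ q \<longleftrightarrow> p < q"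
  by (induction x) auto

lemma append_le_append [simp]: "(x :: 'a::linorder list) @ p \<le> x @ q \<longleftrightarrow> p \<le> q"
  by (induction x) auto

lemma le_append: "(x :: 'a::linorder list) \<le> x @ t"
  using append_le_append[of x "[]" t] by simp

text \<open>Only an inequality decided at a differing letter survives arbitrary continuations of
  both words; a proper prefix has to be treated separately.\<close>

lemma list_less_cases:
  assumes "(x :: 'a::linorder list) < y"
  obtains (prefix) t where "t \<noteq> []" "y = x @ t" | (differ) "\<And>p q. x @ p < y @ q"
proof -
  have "(\<exists>t. t \<noteq> [] \<and> y = x @ t) \<or> (\<forall>p q. x @ p < y @ q)"
    using assms
  proof (induction x arbitrary: y)
    case Nil
    then show ?case by (intro disjI1 exI[of _ y]) auto
  next
    case (Cons a x)
    then obtain b z where y: "y = b # z" by (cases y) auto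
    show ?case
    proof (cases "a = b")
      case True
      then have "x < z" using Cons.prems y by simp
      then show ?thesis using Cons.IH[of z] True y by auto
    next
      case False
      then show ?thesis using Cons.prems y by auto
    qed
  qed
  then show ?thesis using that by blast
qed

text \<open>If v < w, then w = v t, since otherwise v u < w. From w < v u follows t < u; as t and u
  have equal length, t v < u v = w, although t v is a cyclic shift of w.\<close>

lemma lyndon_less_suffix:
  assumes "lyndon w" "w = u @ v" "u \<noteq> []" "v \<noteq> []"
  shows "w < v"
proof (rule ccontr)
  assume "\<not> w < v"
  moreover have "w \<noteq> v" using assms(2,3) by auto
  ultimately have "v < w" by simp
  have rot: "w < y @ x" if "w = x @ y" "x \<noteq> []" "y \<noteq> []" for x y
    using assms(1) that unfolding lyndon_def by blast
  have wvu: "w < v @ u" using rot assms by blast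
  from \<open>v < w\<close> show False
  proof (cases rule: list_less_cases)
    case (prefix t)
    have "v @ t < v @ u" using wvu prefix(2) by metis
    then have "t < u" by simp
    have "length t = length u" using arg_cong[OF assms(2), of length] arg_cong[OF prefix(2), of length] by simp
    have "w < t @ v" using rot[OF prefix(2)] prefix(1) assms(4) by blast
    from \<open>t < u\<close> have "t @ v < u @ v"
    proof (cases rule: list_less_cases)
      case (prefix s)
      then show ?thesis using \<open>length t = length u\<close> by simp
    qed
    then show False using \<open>w < t @ v\<close> assms(2) by (metis less_asym)
  next
    case differ
    then show False using wvu differ[of u "[]"] by simp
  qed
qed

lemma lyndonI_suffix:
  assumes "w \<noteq> []" "\<And>u v. w = u @ v \<Longrightarrow> u \<noteq> [] \<Longrightarrow> v \<noteq> [] \<Longrightarrow> w < v"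
  shows "lyndon w"
  unfolding lyndon_def
proof (intro conjI allI impI)
  fix u v assume uv: "w = u @ v" "u \<noteq> []" "v \<noteq> []"
  from assms(2)[OF uv] show "w < v @ u"
  proof (cases rule: list_less_cases)
    case (prefix t)
    then show ?thesis using arg_cong[OF uv(1), of length] arg_cong[OF prefix(2), of length] by simp
  next
    case differ
    then show ?thesis using differ[of "[]" u] by simp
  qed
qed (fact assms(1))

text \<open>The last factor is the least nonempty suffix m, and induction factors the rest. If the
  last factor k of the rest were below m, then m \<le> k m would give m = k t with t \<le> m, but a
  Lyndon word is less than its proper suffixes.\<close>

lemma lyndon_factorization_exists:
  "\<exists>ls. (\<forall>l\<in>set ls. lyndon l) \<and> nonincreasing ls \<and> concat ls = (w :: 'a::linorder list)"
proof (induction "length w" arbitrary: w rule: less_induct)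
  case less
  show ?case
  proof (cases "w = []")
    case True
    then show ?thesis by (intro exI[of _ "[]"]) simp
  next
    case False
    define Suf where "Suf = {v. v \<noteq> [] \<and> (\<exists>u. w = u @ v)}"
    have "Suf \<subseteq> (\<lambda>n. drop n w) ` {..length w}"
    proof
      fix v assume "v \<in> Suf"
      then obtain u where "w = u @ v" by (auto simp: Suf_def)
      then have "v = drop (length u) w" "length u \<le> length w" by auto
      then show "v \<in> (\<lambda>n. drop n w) ` {..length w}" by blast
    qed
    then have fin: "finite Suf" by (rule finite_subset) simp
    have ne: "Suf \<noteq> {}" using False by (auto simp: Suf_def)
    define m where "m = Min Suf"
    have "m \<in> Suf" using fin ne Min_in m_def by blast
    then obtain u where u: "w = u @ m" "m \<noteq> []" by (auto simp: Suf_def)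
    have min: "m \<le> v" if "w = x @ v" "v \<noteq> []" for x v
      using that fin by (auto simp: m_def Suf_def)
    have lm: "lyndon m"
    proof (rule lyndonI_suffix[OF u(2)])
      fix x v assume "m = x @ v" "x \<noteq> []" "v \<noteq> []"
      then have "m \<le> v" "m \<noteq> v" using min[of "u @ x" v] u(1) by auto
      then show "m < v" by (rule le_neq_trans)
    qed
    have "length u < length w" using u by simp
    from less[OF this] obtain ls where ls: "\<forall>l\<in>set ls. lyndon l" "nonincreasing ls" "concat ls = u"
      by blast
    have "m \<le> l" if "l \<in> set ls" for l
    proof -
      have "ls \<noteq> []" using that by auto
      then obtain ls' k where k: "ls = ls' @ [k]" by (cases ls rule: rev_cases) auto
      have "k \<noteq> []" using ls(1) k by (auto simp: lyndon_def)
      have "m \<le> k @ m" using min[of "concat ls'" "k @ m"] u k ls(3) by simp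
      have "m \<le> k"
      proof (rule ccontr)
        assume "\<not> m \<le> k"
        then have "k < m" by simp
        then show False
        proof (cases rule: list_less_cases)
          case (prefix t)
          have "k @ t \<le> k @ m" using \<open>m \<le> k @ m\<close> prefix(2) by metis
          then have "t \<le> m" by simp
          moreover have "m < t" using lyndon_less_suffix[OF lm prefix(2) \<open>k \<noteq> []\<close> prefix(1)] .
          ultimately show False by simp
        next
          case differ
          then show False using differ[of m "[]"] \<open>m \<le> k @ m\<close> by simp
        qed
      qed
      moreover have "k \<le> l" using ls(2) that k by (auto simp: sorted_wrt_append)
      ultimately show ?thesis by simp
    qed
    then show ?thesis
      using ls lm u by (intro exI[of _ "ls @ [m]"]) (auto simp: sorted_wrt_append)
  qed
qed

text \<open>A suffix starting inside a factor l begins with a suffix of l, which is at least l and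
  so at least k. Hence the last factor is the least nonempty suffix, and this determines it
  uniquely.\<close>

lemma last_factor_le_suffix:
  assumes "\<forall>l\<in>set (ls @ [k]). lyndon l" "nonincreasing (ls @ [k])"
    "concat (ls @ [k]) = u @ v" "v \<noteq> []"
  shows "k \<le> (v :: 'a::linorder list)"
  using assms
proof (induction ls arbitrary: u)
  case Nil
  then have k: "lyndon k" "k = u @ v" by auto
  show ?case
  proof (cases "u = []")
    case False
    then show ?thesis using lyndon_less_suffix[OF k False Nil.prems(4)] by simp
  qed (use k in simp)
next
  case (Cons l ls)
  have "l @ concat (ls @ [k]) = u @ v" using Cons.prems(3) by simp
  then consider (a) t where "l @ t = u" "concat (ls @ [k]) = t @ v"
    | (b) t where "l = u @ t" "t \<noteq> []" "v = t @ concat (ls @ [k])"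
  proof -
    let ?C = "concat (ls @ [k])"
    obtain t where t: "l = u @ t \<and> t @ ?C = v \<or> l @ t = u \<and> ?C = t @ v"
      using \<open>l @ ?C = u @ v\<close> unfolding append_eq_append_conv2 by blast
    show thesis
    proof (cases "l @ t = u \<and> ?C = t @ v")
      case False
      then have b: "l = u @ t" "v = t @ ?C" using t by auto
      show thesis
      proof (cases "t = []")
        case True
        then show thesis using b that(1)[of "[]"] by simp
      qed (use b that(2)[of t] in simp)
    qed (use that(1)[of t] in simp)
  qed
  then show ?case
  proof cases
    case (a t)
    then show ?thesis using Cons.IH[of t] Cons.prems by simp
  next
    case (b t)
    have "l \<le> t"
    proof (cases "u = []")
      case False
      then show ?thesis using lyndon_less_suffix[of l u t] b Cons.prems(1) by simp
    qed (use b in simp)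
    moreover have "k \<le> l" using Cons.prems(2) by simp
    moreover have "t \<le> v" using b(3) le_append by metis
    ultimately show ?thesis by (meson order_trans)
  qed
qed

lemma lyndon_factorization_unique:
  assumes "\<forall>l\<in>set ls. lyndon l" "nonincreasing ls" "\<forall>l\<in>set ls'. lyndon l" "nonincreasing ls'"
    "concat ls = (concat ls' :: 'a::linorder list)"
  shows "ls = ls'"
  using assms
proof (induction ls arbitrary: ls' rule: rev_induct)
  case Nil
  then have "\<forall>l\<in>set ls'. l = []" "\<forall>l\<in>set ls'. l \<noteq> []" by (auto simp: lyndon_def)
  then show ?case by (cases ls') auto
next
  case (snoc k ls)
  have "k \<noteq> []" using snoc.prems(1) by (auto simp: lyndon_def)
  then have "ls' \<noteq> []" using snoc.prems(5) by auto
  then obtain ms m where ms: "ls' = ms @ [m]" by (cases ls' rule: rev_cases) auto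
  have "m \<noteq> []" using snoc.prems(3) ms by (auto simp: lyndon_def)
  have "k \<le> m"
    using last_factor_le_suffix[of ls k "concat ms" m] snoc.prems ms \<open>m \<noteq> []\<close> by simp
  moreover have "m \<le> k"
    using last_factor_le_suffix[of ms m "concat ls" k] snoc.prems ms \<open>k \<noteq> []\<close> by simp
  ultimately have "k = m" by simp
  moreover have "ls = ms"
    by (rule snoc.IH) (use snoc.prems ms \<open>k = m\<close> in \<open>auto simp: sorted_wrt_append\<close>)
  ultimately show ?case using ms by simp
qed

section \<open>Heaps as multisets of Lyndon words\<close>

definition mconcat :: "'a::linorder list multiset \<Rightarrow> 'a list" where
  "mconcat M = concat (rev (sorted_list_of_multiset M))"

lemma length_mconcat: "length (mconcat M) = (\<Sum>l\<in>#M. length l)"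
proof -
  let ?ls = "sorted_list_of_multiset M"
  have "length (mconcat M) = sum_list (map length ?ls)"
    by (simp add: mconcat_def length_concat rev_map[symmetric])
  also have "\<dots> = (\<Sum>l\<in>#mset ?ls. length l)"
    by (simp only: mset_map[symmetric] sum_mset_sum_list)
  finally show ?thesis by simp
qed

lemma set_mconcat: "set (mconcat M) = (\<Union>l\<in>set_mset M. set l)"
  by (simp add: mconcat_def)

context trace_graph
begin

text \<open>By \<open>lyndon_heap_iff\<close> these are the standard words of the Lyndon heaps on
  W.\<close>

definition lyns :: "'a set \<Rightarrow> 'a list set" where
  "lyns W = {l. set l \<subseteq> W \<and> lyndon l \<and> std l}"

text \<open>A later factor is not larger, so it begins with a letter at most the first letter of the
  earlier factor, which is the least letter there.\<close>

lemma std_concat: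
  "nonincreasing ls \<Longrightarrow> \<forall>l\<in>set ls. lyndon l \<and> std l \<Longrightarrow> std (concat ls)"
proof (induction ls)
  case (Cons l ls)
  have "std (l @ concat ls)"
  proof (rule std_append)
    fix a assume "concat ls \<noteq> []" "a \<in> set l"
    then obtain l2 ls2 where ls: "ls = l2 # ls2" by (cases ls) auto
    have "l \<noteq> []" "l2 \<noteq> []" using Cons.prems ls by (auto simp: lyndon_def)
    moreover have "l2 \<le> l" using Cons.prems ls by simp
    ultimately have "hd l2 \<le> hd l" by (cases l; cases l2) auto
    also have "hd l \<le> a" using lyndon_hd_le[of l a] Cons.prems(2) \<open>a \<in> set l\<close> by simp
    finally show "hd (concat ls) \<le> a" using ls \<open>l2 \<noteq> []\<close> by simp
  qed (use Cons in auto)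
  then show ?case by simp
qed simp

lemma std_concatD: "std (concat ls) \<Longrightarrow> l \<in> set ls \<Longrightarrow> std l"
  by (induction ls) (auto dest: std_appendD)

lemma bij_mconcat:
  "bij_betw mconcat {M. set_mset M \<subseteq> lyns W} {w. set w \<subseteq> W \<and> std w}"
proof (rule bij_betw_imageI)
  show "inj_on mconcat {M. set_mset M \<subseteq> lyns W}"
  proof (rule inj_onI)
    fix M N assume MN: "M \<in> {M. set_mset M \<subseteq> lyns W}" "N \<in> {M. set_mset M \<subseteq> lyns W}" "mconcat M = mconcat N"
    have "rev (sorted_list_of_multiset M) = rev (sorted_list_of_multiset N)"
      by (rule lyndon_factorization_unique)
        (use MN in \<open>auto simp: lyns_def mconcat_def sorted_wrt_rev\<close>)
    then show "M = N" by (metis mset_sorted_list_of_multiset rev_is_rev_conv)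
  qed
  show "mconcat ` {M. set_mset M \<subseteq> lyns W} = {w. set w \<subseteq> W \<and> std w}"
  proof (intro equalityI subsetI)
    fix w assume "w \<in> mconcat ` {M. set_mset M \<subseteq> lyns W}"
    then obtain M where M: "set_mset M \<subseteq> lyns W" "w = mconcat M" by blast
    have "std w" unfolding M(2) mconcat_def
      by (rule std_concat) (use M(1) in \<open>auto simp: lyns_def sorted_wrt_rev\<close>)
    moreover have "set w \<subseteq> W" using M by (auto simp: set_mconcat lyns_def)
    ultimately show "w \<in> {w. set w \<subseteq> W \<and> std w}" by simp
  next
    fix w assume w: "w \<in> {w. set w \<subseteq> W \<and> std w}"
    obtain ls where ls: "\<forall>l\<in>set ls. lyndon l" "nonincreasing ls" "concat ls = w"
      using lyndon_factorization_exists by blast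
    have "mconcat (mset ls) = w" using nonincreasing_conv_mset[OF ls(2)] ls(3) by (simp add: mconcat_def)
    moreover have "set_mset (mset ls) \<subseteq> lyns W"
    proof
      fix l assume "l \<in># mset ls"
      then have "l \<in> set ls" by simp
      moreover from this have "set l \<subseteq> W" using w unfolding ls(3)[symmetric] by auto
      ultimately show "l \<in> lyns W" using ls w std_concatD[of ls l] by (simp add: lyns_def)
    qed
    ultimately show "w \<in> mconcat ` {M. set_mset M \<subseteq> lyns W}" by blast
  qed
qed

end

section \<open>Binary expansion of multiplicities\<close>

definition dyadic :: "'a list set \<Rightarrow> (nat \<times> 'a list) set" where
  "dyadic L = {(k, l). l \<in> L \<and> (\<exists>j. k = length l * 2 ^ j)}"

text \<open>One pair for each digit 1 of the multiplicity of l. The digit position is stored through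
  the weight, from which it can be recovered when l is nonempty.\<close>

definition binary_set :: "'a list multiset \<Rightarrow> (nat \<times> 'a list) set" where
  "binary_set M = {(length l * 2 ^ j, l) | l j. j \<in> set_decode (count M l)}"

lemma mem_binary_set: "l \<noteq> [] \<Longrightarrow> (length l * 2 ^ j, l) \<in> binary_set M \<longleftrightarrow> j \<in> set_decode (count M l)"
  by (auto simp: binary_set_def)

lemma binary_set_eq:
  "binary_set M = (\<lambda>(l, j). (length l * 2 ^ j, l)) ` (SIGMA l:set_mset M. set_decode (count M l))"
proof -
  have "l \<in># M" if "j \<in> set_decode (count M l)" for l j
    using that by (metis count_inI set_decode_zero empty_iff)
  then show ?thesis by (auto simp: binary_set_def image_iff)
qed

lemma finite_binary_set: "finite (binary_set M)"
  unfolding binary_set_eq by (intro finite_imageI finite_SigmaI) auto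

lemma sum_count_eq_sum_mset:
  "finite A \<Longrightarrow> set_mset M \<subseteq> A \<Longrightarrow> (\<Sum>x\<in>A. f x * count M x) = (\<Sum>x\<in>#M. (f x :: nat))"
proof (induction M)
  case (add a M)
  have "(\<Sum>x\<in>A. f x * count (add_mset a M) x) = (\<Sum>x\<in>A. f x * count M x + (if x = a then f x else 0))"
    by (rule sum.cong) auto
  also have "\<dots> = (\<Sum>x\<in>#add_mset a M. f x)"
    using add by (simp add: sum.distrib)
  finally show ?case .
qed simp

lemma sum_binary_set:
  assumes "[] \<notin># M"
  shows "(\<Sum>b\<in>binary_set M. fst b) = (\<Sum>l\<in>#M. length l)"
proof -
  have inj: "inj_on (\<lambda>(l, j). (length l * 2 ^ j, l)) (SIGMA l:set_mset M. set_decode (count M l))"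
    using assms by (auto simp: inj_on_def)
  have "(\<Sum>b\<in>binary_set M. fst b) = (\<Sum>(l, j)\<in>(SIGMA l:set_mset M. set_decode (count M l)). length l * 2 ^ j)"
    unfolding binary_set_eq sum.reindex[OF inj] by (simp add: case_prod_unfold)
  also have "\<dots> = (\<Sum>l\<in>set_mset M. \<Sum>j\<in>set_decode (count M l). length l * 2 ^ j)"
    by (subst sum.Sigma) auto
  also have "\<dots> = (\<Sum>l\<in>set_mset M. length l * count M l)"
  proof (rule sum.cong[OF refl])
    fix l
    have "(\<Sum>j\<in>set_decode (count M l). 2 ^ j) = count M l"
      using set_decode_inverse[of "count M l"] by (simp add: set_encode_def)
    then show "(\<Sum>j\<in>set_decode (count M l). length l * 2 ^ j) = length l * count M l"
      by (simp add: sum_distrib_left[symmetric])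
  qed
  also have "\<dots> = (\<Sum>l\<in>#M. length l)"
    using sum_count_eq_sum_mset[of "set_mset M" M length] by simp
  finally show ?thesis .
qed

lemma bij_binary_set:
  assumes "[] \<notin> L"
  shows "bij_betw binary_set {M. set_mset M \<subseteq> L} {S. S \<subseteq> dyadic L \<and> finite S}"
proof (rule bij_betw_imageI)
  show "inj_on binary_set {M. set_mset M \<subseteq> L}"
  proof (rule inj_onI, rule multiset_eqI)
    fix M N l assume MN: "M \<in> {M. set_mset M \<subseteq> L}" "N \<in> {M. set_mset M \<subseteq> L}" "binary_set M = binary_set N"
    show "count M l = count N l"
    proof (cases "l \<in> L")
      case True
      then have "l \<noteq> []" using assms by blast
      then have "set_decode (count M l) = set_decode (count N l)"
        using mem_binary_set[of l _ M] mem_binary_set[of l _ N] MN(3) by blast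
      then show ?thesis by (metis set_decode_inverse)
    next
      case False
      then show ?thesis using MN(1,2) by (metis count_inI mem_Collect_eq subsetD)
    qed
  qed
  show "binary_set ` {M. set_mset M \<subseteq> L} = {S. S \<subseteq> dyadic L \<and> finite S}"
  proof (intro equalityI subsetI)
    fix S assume "S \<in> binary_set ` {M. set_mset M \<subseteq> L}"
    then obtain M where M: "set_mset M \<subseteq> L" "S = binary_set M" by blast
    then have "S \<subseteq> dyadic L" unfolding M(2) binary_set_eq dyadic_def by auto
    then show "S \<in> {S. S \<subseteq> dyadic L \<and> finite S}" using M finite_binary_set by simp
  next
    fix S assume S: "S \<in> {S. S \<subseteq> dyadic L \<and> finite S}"
    define J where "J l = {j. (length l * 2 ^ j, l) \<in> S \<and> l \<in> L}" for l
    define f where "f l = set_encode (J l)" for l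
    have finJ: "finite (J l)" for l
    proof (cases "l \<in> L")
      case True
      then have "l \<noteq> []" using assms by blast
      then have "inj_on (\<lambda>j. (length l * 2 ^ j, l)) (J l)" by (auto simp: inj_on_def)
      moreover have "finite ((\<lambda>j. (length l * 2 ^ j, l)) ` J l)"
      proof (rule finite_subset)
        show "(\<lambda>j. (length l * 2 ^ j, l)) ` J l \<subseteq> S" unfolding J_def by blast
        show "finite S" using S by simp
      qed
      ultimately show ?thesis using finite_imageD by blast
    qed (simp add: J_def)
    have pos: "l \<in> snd ` S \<and> l \<in> L" if "f l > 0" for l
    proof -
      have "J l \<noteq> {}" using that by (auto simp: f_def)
      then obtain j where "(length l * 2 ^ j, l) \<in> S" "l \<in> L" by (auto simp: J_def)
      then show ?thesis by force
    qed
    then have "{l. f l > 0} \<subseteq> snd ` S" by blast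
    moreover have "finite (snd ` S)" using S by simp
    ultimately have "finite {l. f l > 0}" by (rule finite_subset)
    then have cnt: "count (Abs_multiset f) = f" by (rule count_Abs_multiset)
    have sub: "set_mset (Abs_multiset f) \<subseteq> L"
    proof
      fix l assume "l \<in># Abs_multiset f"
      then have "f l > 0" unfolding set_mset_def cnt by simp
      then show "l \<in> L" using pos by blast
    qed
    have "set_decode (f l) = J l" for l using finJ by (simp add: f_def)
    then have "binary_set (Abs_multiset f) = {(length l * 2 ^ j, l) | l j. j \<in> J l}"
      by (simp add: binary_set_def cnt)
    also have "\<dots> = S"
    proof (intro equalityI subsetI)
      fix b assume "b \<in> S"
      then have "b \<in> dyadic L" using S by blast
      then obtain l j where "b = (length l * 2 ^ j, l)" "l \<in> L" by (auto simp: dyadic_def)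
      then show "b \<in> {(length l * 2 ^ j, l) | l j. j \<in> J l}" using \<open>b \<in> S\<close> by (auto simp: J_def)
    qed (auto simp: J_def)
    finally show "S \<in> binary_set ` {M. set_mset M \<subseteq> L}" using sub by blast
  qed
qed

context trace_graph
begin

lemma card_std_words:
  "card {w. set w \<subseteq> W \<and> std w \<and> length w = n} =
   card {S. S \<subseteq> dyadic (lyns W) \<and> finite S \<and> (\<Sum>b\<in>S. fst b) = n}"
proof -
  let ?M = "{M. set_mset M \<subseteq> lyns W}"
  have ne: "[] \<notin> lyns W" by (simp add: lyns_def lyndon_def)
  have 1: "bij_betw mconcat {M \<in> ?M. (\<Sum>l\<in>#M. length l) = n} {w \<in> {w. set w \<subseteq> W \<and> std w}. length w = n}"
    by (rule bij_betw_Collect[OF bij_mconcat]) (simp add: length_mconcat)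
  have 2: "bij_betw binary_set {M \<in> ?M. (\<Sum>l\<in>#M. length l) = n}
     {S \<in> {S. S \<subseteq> dyadic (lyns W) \<and> finite S}. (\<Sum>b\<in>S. fst b) = n}"
  proof (rule bij_betw_Collect[OF bij_binary_set[OF ne]])
    fix M assume "M \<in> ?M"
    then have "[] \<notin># M" using ne by auto
    then show "((\<Sum>b\<in>binary_set M. fst b) = n) = ((\<Sum>l\<in>#M. length l) = n)"
      using sum_binary_set by metis
  qed
  show ?thesis using bij_betw_same_card[OF 1] bij_betw_same_card[OF 2] by (simp add: conj_assoc)
qed

end

section \<open>The Cartier-Foata identity\<close>

lemma sum_alternating_Pow:
  assumes "finite A"
  shows "(\<Sum>S\<in>Pow A. (-1) ^ card S) = (if A = {} then 1 else 0 :: 'r::comm_ring_1)"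
proof -
  have "(\<Sum>S\<in>Pow A. (-1) ^ card S) = (\<Prod>x\<in>A. 1 - (1::'r))"
    using prod_diff_conv_sum[OF assms, of "\<lambda>_. 1 :: 'r" "\<lambda>_. 1"] by simp
  then show ?thesis using assms by (simp add: card_gt_0_iff power_0_left)
qed

definition independent :: "('a \<Rightarrow> 'a \<Rightarrow> bool) \<Rightarrow> 'a set \<Rightarrow> bool" where
  "independent E S \<longleftrightarrow> pairwise (\<lambda>u v. \<not> E u v) S"

definition indsets :: "('a \<Rightarrow> 'a \<Rightarrow> bool) \<Rightarrow> 'a set \<Rightarrow> nat \<Rightarrow> 'a set set" where
  "indsets E W k = {S. S \<subseteq> W \<and> independent E S \<and> card S = k}"

context trace_graph
begin

definition std_words :: "'a set \<Rightarrow> nat \<Rightarrow> 'a list set" where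
  "std_words W n = {w. set w \<subseteq> W \<and> std w \<and> length w = n}"

lemma finite_std_words: "finite W \<Longrightarrow> finite (std_words W n)"
  unfolding std_words_def
  by (rule finite_subset[OF _ finite_lists_length_eq[of W n]]) auto

lemma independent_minl: "S \<subseteq> minl w \<Longrightarrow> independent E S"
  unfolding independent_def pairwise_def using minl_indep dep_def by blast

lemma minl_independent:
  assumes "distinct xs" "independent E (set xs)"
  shows "minl xs = set xs"
  using assms
proof (induction xs)
  case (Cons a xs)
  have "\<not> dep a b" if "b \<in> set xs" for b
    using Cons.prems that by (auto simp: independent_def pairwise_def dep_def)
  moreover have "independent E (set xs)"
    using Cons.prems(2) by (auto simp: independent_def pairwise_def)
  ultimately show ?case using Cons by auto
qed simp

text \<open>Minimal pieces commute with everything before them, so they can be pulled to the front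
  in any order.\<close>

lemma split_minimal_pieces:
  assumes "distinct xs" "set xs \<subseteq> minl w"
  shows "\<exists>v. w \<approx> xs @ v"
  using assms
proof (induction xs arbitrary: w)
  case Nil
  then show ?case by (intro exI[of _ w]) simp
next
  case (Cons a xs)
  have "set xs \<subseteq> minl (remove1 a w)" using Cons.prems minl_remove1 by fastforce
  then obtain v where "remove1 a w \<approx> xs @ v" using Cons.IH Cons.prems(1) by auto
  then have "a # remove1 a w \<approx> a # xs @ v" by (rule equ_Cons)
  moreover have "w \<approx> a # remove1 a w" using equ_move_front Cons.prems(2) by simp
  ultimately have "w \<approx> (a # xs) @ v" using equ_trans by simp
  then show ?case ..
qed

text \<open>A heap together with a set \<open>S\<close> of its minimal pieces is the same as the independent set \<open>S\<close>
  put below an arbitrary heap; summing the signs over \<open>S\<close> first leaves only the empty heap.\<close>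

lemma cartier_foata:
  assumes W: "finite W"
  shows "(\<Sum>k\<le>n. (-1) ^ k * real (card (indsets E W k)) * real (card (std_words W (n - k)))) =
    (if n = 0 then 1 else 0)"
proof -
  define I where "I = {S. S \<subseteq> W \<and> independent E S \<and> card S \<le> n}"
  define P where "P = (SIGMA S:I. std_words W (n - card S))"
  define Q where "Q = (SIGMA w:std_words W n. Pow (minl w))"
  define sl where "sl S = sorted_list_of_set S" for S :: "'a set"
  \<comment> \<open>\<open>sl\<close> fixes some order of S; its letters commute, so the order does
    not affect the heap, and \<open>nf\<close> returns to the standard word.\<close>
  define f where "f = (\<lambda>(S, v). (nf (sl S @ v), S))"
  have finI: "finite I" unfolding I_def using W by simp
  have sl: "distinct (sl S)" "S \<subseteq> W \<Longrightarrow> set (sl S) = S" "length (sl S) = card S" for S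
    using finite_subset[OF _ W] by (auto simp: sl_def)
  have "bij_betw f P Q"
  proof (rule bij_betw_imageI)
    show "inj_on f P"
    proof (rule inj_onI)
      fix p q assume pq: "p \<in> P" "q \<in> P" "f p = f q"
      obtain S v T u where [simp]: "p = (S, v)" "q = (T, u)" by fastforce
      have "S = T" "nf (sl S @ v) = nf (sl T @ u)" using pq(3) by (auto simp: f_def)
      then have "sl S @ v \<approx> sl S @ u" using equ_nf[of "sl S @ v"] equ_nf[of "sl S @ u"] 
        by (metis equ_sym equ_trans)
      then have "v \<approx> u" unfolding equ_append_cancel .
      moreover have "std v" "std u" using pq(1,2) by (auto simp: P_def std_words_def)
      ultimately show "p = q" using std_unique \<open>S = T\<close> by simp
    qed
    show "f ` P = Q"
    proof (intro equalityI subsetI)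
      fix x assume "x \<in> f ` P"
      then obtain S v where x: "x = (nf (sl S @ v), S)" "S \<in> I" "v \<in> std_words W (n - card S)"
        by (auto simp: f_def P_def)
      have S: "S \<subseteq> W" "independent E S" "card S \<le> n" using x(2) by (auto simp: I_def)
      have e: "sl S @ v \<approx> nf (sl S @ v)" by (rule equ_nf)
      have "set (nf (sl S @ v)) \<subseteq> W" using equ_set[OF e] sl(2)[OF S(1)] S(1) x(3) by (auto simp: std_words_def)
      moreover have "length (nf (sl S @ v)) = n" 
        using equ_length[OF e] sl(3) S(3) x(3) by (auto simp: std_words_def)
      moreover have "S \<subseteq> minl (nf (sl S @ v))"
        using minl_equ[OF e] minl_independent[OF sl(1), of S] S(2) sl(2)[OF S(1)] by (auto simp: minl_append)
      ultimately show "x \<in> Q" using x(1) std_nf by (auto simp: Q_def std_words_def)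
    next
      fix x assume "x \<in> Q"
      then obtain w S where x: "x = (w, S)" "w \<in> std_words W n" "S \<subseteq> minl w" by (auto simp: Q_def)
      have w: "set w \<subseteq> W" "std w" "length w = n" using x(2) by (auto simp: std_words_def)
      have SW: "S \<subseteq> W" using x(3) minl_subset w(1) by blast
      obtain v where v: "w \<approx> sl S @ v"
        using split_minimal_pieces[OF sl(1), of S w] sl(2)[OF SW] x(3) by auto
      then have v': "w \<approx> sl S @ nf v" using equ_append1[OF equ_nf] equ_trans by blast
      have "length w = card S + length (nf v)" using equ_length[OF v'] sl(3) by simp
      moreover have "set (nf v) \<subseteq> W" using equ_set[OF v'] w(1) by auto
      ultimately have "(S, nf v) \<in> P"
        using w SW independent_minl[OF x(3)] std_nf by (auto simp: P_def I_def std_words_def)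
      moreover have "f (S, nf v) = x"
        using std_unique[OF std_nf w(2)] v' equ_nf equ_sym equ_trans x(1) unfolding f_def by (metis case_prod_conv)
      ultimately show "x \<in> f ` P" by blast
    qed
  qed
  have "(\<Sum>k\<le>n. (-1) ^ k * real (card (indsets E W k)) * real (card (std_words W (n - k)))) =
      (\<Sum>k\<le>n. \<Sum>S\<in>{S\<in>I. card S = k}. (-1) ^ card S * real (card (std_words W (n - card S))))"
  proof (rule sum.cong[OF refl])
    fix k assume "k \<in> {..n}"
    then have "{S \<in> I. card S = k} = indsets E W k" by (auto simp: I_def indsets_def)
    moreover have "(\<Sum>S\<in>indsets E W k. (-1) ^ card S * real (card (std_words W (n - card S)))) =
        (\<Sum>S\<in>indsets E W k. (-1) ^ k * real (card (std_words W (n - k))))"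
      by (rule sum.cong) (auto simp: indsets_def)
    ultimately show "(-1) ^ k * real (card (indsets E W k)) * real (card (std_words W (n - k))) =
      (\<Sum>S\<in>{S\<in>I. card S = k}. (-1) ^ card S * real (card (std_words W (n - card S))))" by simp
  qed
  also have "\<dots> = (\<Sum>S\<in>I. (-1) ^ card S * real (card (std_words W (n - card S))))"
    by (rule sum.group) (use finI in \<open>auto simp: I_def\<close>)
  also have "\<dots> = (\<Sum>S\<in>I. \<Sum>v\<in>std_words W (n - card S). (-1) ^ card S)" by (simp add: mult.commute)
  also have "\<dots> = (\<Sum>p\<in>P. (-1) ^ card (fst p))"
    unfolding P_def by (subst sum.Sigma) (use finI finite_std_words[OF W] in \<open>auto simp: case_prod_unfold\<close>)
  also have "\<dots> = (\<Sum>q\<in>Q. (-1) ^ card (snd q))"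
    using sum.reindex_bij_betw[OF \<open>bij_betw f P Q\<close>, of "\<lambda>q. (-1) ^ card (snd q) :: real"]
    by (simp add: f_def case_prod_unfold)
  also have "\<dots> = (\<Sum>w\<in>std_words W n. \<Sum>S\<in>Pow (minl w). (-1) ^ card S)"
    unfolding Q_def by (subst sum.Sigma) (use finite_std_words[OF W] finite_minl in \<open>auto simp: case_prod_unfold\<close>)
  also have "\<dots> = (\<Sum>w\<in>std_words W n. if w = [] then 1 else 0)"
    by (simp add: sum_alternating_Pow finite_minl)
  also have "\<dots> = (if n = 0 then 1 else 0)"
    using finite_std_words[OF W] by (auto simp: std_words_def sum.delta)
  finally show ?thesis .
qed

end

section \<open>Kromatic symmetric functions and families of Lyndon heaps\<close>

text \<open>Moebius inversion on the subsets of V. The map u is left open because it is applied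
  twice: to the vertices covered by colour classes and to those used by a family of Lyndon
  heaps.\<close>

lemma card_onto_inclusion_exclusion:
  assumes "finite X" "finite V"
  shows "int (card {x \<in> X. u x = V}) =
    (\<Sum>W\<in>Pow V. (-1) ^ card (V - W) * int (card {x \<in> X. u x \<subseteq> W}))"
proof -
  define f g where "f S = int (card {x \<in> X. u x = S})" and "g S = int (card {x \<in> X. u x \<subseteq> S})" for S
  have "g S = sum f (Pow S)" if "finite S" for S
  proof -
    let ?Y = "{x \<in> X. u x \<subseteq> S}"
    have "g S = (\<Sum>x\<in>?Y. 1)" by (simp add: g_def)
    also have "\<dots> = (\<Sum>T\<in>Pow S. \<Sum>x\<in>{x \<in> ?Y. u x = T}. 1)"
      by (rule sum.group[symmetric]) (use assms(1) that in auto)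
    also have "\<dots> = sum f (Pow S)"
    proof (rule sum.cong[OF refl])
      fix T assume "T \<in> Pow S"
      then have "{x \<in> ?Y. u x = T} = {x \<in> X. u x = T}" by auto
      then show "(\<Sum>x\<in>{x \<in> ?Y. u x = T}. 1) = f T" by (simp add: f_def)
    qed
    finally show ?thesis .
  qed
  from inclusion_exclusion_mobius[of g f, OF this assms(2)]
  have "f V = (\<Sum>W\<in>Pow V. (-1) ^ (card V - card W) * g W)" .
  also have "\<dots> = (\<Sum>W\<in>Pow V. (-1) ^ card (V - W) * g W)"
    by (rule sum.cong) (use assms(2) in \<open>auto simp: card_Diff_subset finite_subset\<close>)
  finally show ?thesis by (simp add: f_def g_def)
qed

lemma finite_indsets: "finite W \<Longrightarrow> finite (indsets E W k)"
  by (rule finite_subset[of _ "Pow W"]) (auto simp: indsets_def)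

lemma lookup_col_mono:
  assumes "finite V" "\<And>v. v \<in> V \<Longrightarrow> finite (\<kappa> v)"
  shows "lookup (col_mono V \<kappa>) i = card {v \<in> V. i \<in> \<kappa> v}"
proof -
  have "lookup (col_mono V \<kappa>) i = (\<Sum>v\<in>V. \<Sum>j\<in>\<kappa> v. if j = i then 1 else 0)"
    unfolding col_mono_def lookup_sum lookup_single when_def ..
  also have "\<dots> = (\<Sum>v\<in>V. if i \<in> \<kappa> v then 1 else 0)"
    by (rule sum.cong) (use assms(2) in simp_all)
  also have "\<dots> = card {v \<in> V. i \<in> \<kappa> v}"
    using assms(1) by (simp add: sum.If_cases Int_def)
  finally show ?thesis .
qed

text \<open>Read a colouring by colours instead of vertices: colour i occupies an independent set of
  size \<open>lookup \<alpha> i\<close>, and all vertices receive nonempty sets exactly when these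
  classes cover V.\<close>

lemma card_colorings:
  assumes V: "finite V" and irrefl: "\<And>v. \<not> E v v"
  shows "card {\<kappa> \<in> set_colorings V E. col_mono V \<kappa> = \<alpha>} =
    card {s \<in> PiE (keys \<alpha>) (\<lambda>i. indsets E V (lookup \<alpha> i)). (\<Union>i\<in>keys \<alpha>. s i) = V}"
    (is "card ?A = card ?B")
proof -
  define f where "f \<kappa> = restrict (\<lambda>i. {v \<in> V. i \<in> \<kappa> v}) (keys \<alpha>)" for \<kappa> :: "'a \<Rightarrow> nat set"
  define g where "g s = restrict (\<lambda>v. {i \<in> keys \<alpha>. v \<in> s i}) V" for s :: "nat \<Rightarrow> 'a set"
  have A: "\<kappa> \<in> V \<rightarrow>\<^sub>E {S. S \<noteq> {} \<and> finite S}" "\<And>u v. u \<in> V \<Longrightarrow> v \<in> V \<Longrightarrow> E u v \<Longrightarrow> \<kappa> u \<inter> \<kappa> v = {}"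
      "\<And>i. lookup \<alpha> i = card {v \<in> V. i \<in> \<kappa> v}" "\<And>v. v \<in> V \<Longrightarrow> \<kappa> v \<subseteq> keys \<alpha>" if "\<kappa> \<in> ?A" for \<kappa>
  proof -
    show 1: "\<kappa> \<in> V \<rightarrow>\<^sub>E {S. S \<noteq> {} \<and> finite S}"
      using that by (simp add: set_colorings_def)
    show "\<And>u v. u \<in> V \<Longrightarrow> v \<in> V \<Longrightarrow> E u v \<Longrightarrow> \<kappa> u \<inter> \<kappa> v = {}"
      using that unfolding set_colorings_def by blast
    have "\<And>v. v \<in> V \<Longrightarrow> finite (\<kappa> v)" using PiE_mem[OF 1] by auto
    from lookup_col_mono[of V \<kappa>, OF V this]
    show 3: "lookup \<alpha> i = card {v \<in> V. i \<in> \<kappa> v}" for i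
      using that by auto
    show "\<kappa> v \<subseteq> keys \<alpha>" if "v \<in> V" for v
      using that V by (auto simp: in_keys_iff 3)
  qed
  have B: "s \<in> extensional (keys \<alpha>)" "\<And>i. i \<in> keys \<alpha> \<Longrightarrow> s i \<subseteq> V"
      "\<And>i. i \<in> keys \<alpha> \<Longrightarrow> independent E (s i)" "\<And>i. i \<in> keys \<alpha> \<Longrightarrow> card (s i) = lookup \<alpha> i"
      "(\<Union>i\<in>keys \<alpha>. s i) = V" if "s \<in> ?B" for s
    using that PiE_mem[of s "keys \<alpha>" "\<lambda>i. indsets E V (lookup \<alpha> i)"]
    by (auto simp: indsets_def PiE_def)
  have "bij_betw f ?A ?B"
  proof (rule bij_betw_byWitness[where f' = g])
    show "\<forall>\<kappa>\<in>?A. g (f \<kappa>) = \<kappa>"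
    proof
      fix \<kappa> assume k: "\<kappa> \<in> ?A"
      have "g (f \<kappa>) v = \<kappa> v" for v
      proof (cases "v \<in> V")
        case True
        then show ?thesis using A(4)[OF k True] by (auto simp: f_def g_def)
      next
        case False
        then show ?thesis using PiE_arb[OF A(1)[OF k] False] by (simp add: g_def)
      qed
      then show "g (f \<kappa>) = \<kappa>" by (rule ext)
    qed
    show "\<forall>s\<in>?B. f (g s) = s"
    proof
      fix s assume s: "s \<in> ?B"
      have "f (g s) i = s i" for i
      proof (cases "i \<in> keys \<alpha>")
        case True
        then show ?thesis using B(2)[OF s True] by (auto simp: f_def g_def)
      next
        case False
        then show ?thesis using B(1)[OF s] by (simp add: f_def extensional_def)
      qed
      then show "f (g s) = s" by (rule ext)
    qed
    show "f ` ?A \<subseteq> ?B"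
    proof
      fix s assume "s \<in> f ` ?A"
      then obtain \<kappa> where k: "\<kappa> \<in> ?A" "s = f \<kappa>" by blast
      have "f \<kappa> i \<in> indsets E V (lookup \<alpha> i)" if "i \<in> keys \<alpha>" for i
        using that A(2)[OF k(1)] A(3)[OF k(1), of i]
        by (fastforce simp: f_def indsets_def independent_def pairwise_def)
      then have "f \<kappa> \<in> PiE (keys \<alpha>) (\<lambda>i. indsets E V (lookup \<alpha> i))"
        by (auto simp: f_def)
      moreover have "(\<Union>i\<in>keys \<alpha>. f \<kappa> i) = V"
      proof
        show "V \<subseteq> (\<Union>i\<in>keys \<alpha>. f \<kappa> i)"
        proof
          fix v assume v: "v \<in> V"
          obtain i where "i \<in> \<kappa> v" using PiE_mem[OF A(1)[OF k(1)] v] by blast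
          then show "v \<in> (\<Union>i\<in>keys \<alpha>. f \<kappa> i)" using A(4)[OF k(1) v] v by (auto simp: f_def)
        qed
      qed (auto simp: f_def)
      ultimately show "s \<in> ?B" using k(2) by simp
    qed
    show "g ` ?B \<subseteq> ?A"
    proof
      fix \<kappa> assume "\<kappa> \<in> g ` ?B"
      then obtain s where s: "s \<in> ?B" "\<kappa> = g s" by blast
      have ne: "{i \<in> keys \<alpha>. v \<in> s i} \<noteq> {}" if "v \<in> V" for v
        using that B(5)[OF s(1)] by blast
      have "g s u \<inter> g s v = {}" if uv: "u \<in> V" "v \<in> V" "E u v" for u v
      proof (rule ccontr)
        assume "g s u \<inter> g s v \<noteq> {}"
        then obtain i where i: "i \<in> keys \<alpha>" "u \<in> s i" "v \<in> s i" using uv by (auto simp: g_def)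
        have "u \<noteq> v" using uv(3) irrefl by blast
        then show False using B(3)[OF s(1) i(1)] i uv(3) by (auto simp: independent_def pairwise_def)
      qed
      moreover have "g s \<in> V \<rightarrow>\<^sub>E {S. S \<noteq> {} \<and> finite S}"
        using ne by (auto simp: g_def)
      ultimately have col: "g s \<in> set_colorings V E" by (simp add: set_colorings_def)
      have "col_mono V (g s) = \<alpha>"
      proof (rule poly_mapping_eqI)
        fix i
        have "lookup (col_mono V (g s)) i = card {v \<in> V. i \<in> g s v}"
          by (rule lookup_col_mono[OF V]) (simp add: g_def)
        also have "{v \<in> V. i \<in> g s v} = (if i \<in> keys \<alpha> then s i else {})"
          using B(2)[OF s(1)] by (auto simp: g_def)
        also have "card \<dots> = lookup \<alpha> i"
          using B(4)[OF s(1)] by (simp add: in_keys_iff)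
        finally show "lookup (col_mono V (g s)) i = lookup \<alpha> i" .
      qed
      then show "\<kappa> \<in> ?A" using col s(2) by simp
    qed
  qed
  then show ?thesis by (rule bij_betw_same_card)
qed

definition indep_series :: "('a \<Rightarrow> 'a \<Rightarrow> bool) \<Rightarrow> 'a set \<Rightarrow> real fps" where
  "indep_series E W = Abs_fps (\<lambda>k. real (card (indsets E W k)))"

text \<open>Once covering V is relaxed to staying inside W, the colour classes are chosen
  independently, which gives a product over the variables.\<close>

lemma kromatic_inclusion_exclusion:
  assumes V: "finite V" and irrefl: "\<And>v. \<not> E v v"
  shows "kromatic V E \<alpha> = (\<Sum>W\<in>Pow V. (-1) ^ card (V - W) * var_prod (indep_series E W) \<alpha>)"
proof -
  let ?X = "PiE (keys \<alpha>) (\<lambda>i. indsets E V (lookup \<alpha> i))"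
  let ?u = "\<lambda>s. \<Union>i\<in>keys \<alpha>. s i"
  have "finite ?X" by (intro finite_PiE finite_indsets V) simp
  have "int (card {s \<in> ?X. ?u s \<subseteq> W}) = (\<Prod>i\<in>keys \<alpha>. int (card (indsets E W (lookup \<alpha> i))))"
    if "W \<in> Pow V" for W
  proof -
    have "{s \<in> ?X. ?u s \<subseteq> W} = PiE (keys \<alpha>) (\<lambda>i. indsets E W (lookup \<alpha> i))"
    proof (rule set_eqI)
      fix s
      show "s \<in> {s \<in> ?X. ?u s \<subseteq> W} \<longleftrightarrow> s \<in> PiE (keys \<alpha>) (\<lambda>i. indsets E W (lookup \<alpha> i))"
        unfolding mem_Collect_eq PiE_iff indsets_def using that by blast
    qed
    then show ?thesis by (simp add: card_PiE)
  qed
  then have "int (card {s \<in> ?X. ?u s = V}) =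
      (\<Sum>W\<in>Pow V. (-1) ^ card (V - W) * (\<Prod>i\<in>keys \<alpha>. int (card (indsets E W (lookup \<alpha> i)))))"
    using card_onto_inclusion_exclusion[OF \<open>finite ?X\<close> V, of ?u] by simp
  from arg_cong[OF this, of real_of_int]
  have "real (card {s \<in> ?X. ?u s = V}) =
      (\<Sum>W\<in>Pow V. (-1) ^ card (V - W) * (\<Prod>i\<in>keys \<alpha>. real (card (indsets E W (lookup \<alpha> i)))))"
    by simp
  moreover have "card {\<kappa> \<in> set_colorings V E. col_mono V \<kappa> = \<alpha>} = card {s \<in> ?X. ?u s = V}"
    by (rule card_colorings) (use assms in auto)
  ultimately show ?thesis
    by (simp add: kromatic_def var_prod_def indep_series_def)
qed

section \<open>Lyndon heaps and their families in terms of standard words\<close>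

context trace_graph
begin

lemma heap_size_heap_of: "heap_size (heap_of E w) = length w"
proof -
  have "w \<in> heap_of E w" by (simp add: heap_of_def)
  then have "(SOME v. v \<in> heap_of E w) \<in> heap_of E w" by (rule someI)
  then show ?thesis using equ_length by (simp add: heap_size_def heap_of_def)
qed

lemma heap_uses_heap_of: "heap_uses (heap_of E w) v \<longleftrightarrow> v \<in> set w"
proof -
  have "set w' = set w" if "w' \<in> heap_of E w" for w'
    using equ_set that by (auto simp: heap_of_def)
  moreover have "w \<in> heap_of E w" by (simp add: heap_of_def)
  ultimately show ?thesis unfolding heap_uses_def by blast
qed

lemma lyndon_heaps_eq: "{H. lyndon_heap V E H} = heap_of E ` lyns V"
proof (intro equalityI subsetI)
  fix H assume H: "H \<in> {H. lyndon_heap V E H}"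
  then obtain w where w: "H = heap_of E w" by (auto simp: lyndon_heap_def heaps_def)
  have "heap_of E w = heap_of E (nf w)" unfolding heap_of_eq_iff by (rule equ_nf)
  then have n: "H = heap_of E (nf w)" using w by simp
  then have "nf w \<in> lyns V" using H lyndon_heap_iff[OF std_nf, of V w] std_nf[of w] by (simp add: lyns_def)
  then show "H \<in> heap_of E ` lyns V" using n by blast
next
  fix H assume "H \<in> heap_of E ` lyns V"
  then obtain l where l: "l \<in> lyns V" "H = heap_of E l" by blast
  then show "H \<in> {H. lyndon_heap V E H}" using lyndon_heap_iff[of l V] by (simp add: lyns_def)
qed

lemma inj_heap_of: "inj_on (heap_of E) (lyns V)"
proof (rule inj_onI)
  fix l l' assume "l \<in> lyns V" "l' \<in> lyns V" "heap_of E l = heap_of E l'"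
  then show "l = l'" using std_unique[of l l'] by (simp add: lyns_def heap_of_eq_iff)
qed

lemma card_lyndon_set: "card (lyndon_set V E n) = card {l \<in> lyns V. length l = n}"
proof -
  have "lyndon_set V E n = {H. H \<in> {H. lyndon_heap V E H} \<and> heap_size H = n}"
    by (simp add: lyndon_set_def)
  also have "\<dots> = heap_of E ` {l \<in> lyns V. length l = n}"
    unfolding lyndon_heaps_eq by (auto simp: heap_size_heap_of)
  finally show ?thesis
    using inj_on_subset[OF inj_heap_of, of "{l \<in> lyns V. length l = n}" V] by (simp add: card_image)
qed

definition heap_series :: "'a set \<Rightarrow> real fps" where
  "heap_series W = Abs_fps (\<lambda>n. real (card (std_words W n)))"

lemma indep_series_0: 
  assumes "finite W"
  shows "indep_series E W $ 0 = 1"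
proof -
  have "indsets E W 0 = {{}}" using assms by (auto simp: indsets_def independent_def finite_subset)
  then show ?thesis by (simp add: indep_series_def)
qed

lemma indep_series_heap_series:
  assumes "finite W"
  shows "alternate (indep_series E W) * heap_series W = 1"
proof (rule fps_ext)
  fix n
  show "(alternate (indep_series E W) * heap_series W) $ n = 1 $ n"
    using cartier_foata[OF assms, of n]
    by (simp add: fps_mult_nth alternate_def indep_series_def heap_series_def atLeast0AtMost)
qed

abbreviation type_sets :: "'a set \<Rightarrow> nat list \<Rightarrow> (nat \<times> 'a list) set set" where
  "type_sets W lam \<equiv> {S. S \<subseteq> dyadic (lyns W) \<and> finite S \<and> type_of fst S = lam}"

lemma dyadic_lyns_bounds:
  assumes "b \<in> dyadic (lyns W)"
  shows "fst b > 0" "length (snd b) \<le> fst b" "set (snd b) \<subseteq> W"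
proof -
  obtain k l j where b: "b = (k, l)" "l \<in> lyns W" "k = length l * 2 ^ j"
    using assms by (auto simp: dyadic_def)
  have "l \<noteq> []" "set l \<subseteq> W" using b(2) by (auto simp: lyns_def lyndon_def)
  then show "fst b > 0" "length (snd b) \<le> fst b" "set (snd b) \<subseteq> W" using b by simp_all
qed

lemma finite_dyadic_le:
  assumes "finite W"
  shows "finite {b \<in> dyadic (lyns W). fst b \<le> n}"
proof (rule finite_subset)
  show "{b \<in> dyadic (lyns W). fst b \<le> n} \<subseteq> {..n} \<times> {l. set l \<subseteq> W \<and> length l \<le> n}"
    using dyadic_lyns_bounds by fastforce
qed (use assms in \<open>simp add: finite_lists_length_le\<close>)

lemma psum_type_sets:
  assumes "finite W"
  shows "psum_ser (\<lambda>lam. real (card (type_sets W lam))) pbar_part = var_prod (heap_series W)"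
proof (rule psum_pbar_part_subsets)
  show "finite {b \<in> dyadic (lyns W). fst b \<le> n}" for n by (rule finite_dyadic_le[OF assms])
  show "fst b > 0" if "b \<in> dyadic (lyns W)" for b by (rule dyadic_lyns_bounds[OF that])
  show "heap_series W $ n = card {S. S \<subseteq> dyadic (lyns W) \<and> finite S \<and> (\<Sum>b\<in>S. fst b) = n}" for n
    using card_std_words[of W n] by (simp add: heap_series_def std_words_def)
qed

lemma finite_type_sets:
  assumes "finite W"
  shows "finite (type_sets W lam)"
proof (rule finite_subset)
  show "type_sets W lam \<subseteq> Pow {b \<in> dyadic (lyns W). fst b \<le> sum_list lam}"
  proof
    fix S assume S: "S \<in> type_sets W lam"
    have "fst b \<le> sum_list lam" if "b \<in> S" for b
      using S member_le_sum[of b S fst] that sum_list_type_of[of fst S] by auto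
    then show "S \<in> Pow {b \<in> dyadic (lyns W). fst b \<le> sum_list lam}" using S by blast
  qed
qed (simp add: finite_dyadic_le[OF assms])

lemma type_of_eq_iff:
  fixes S :: "(nat \<times> 'b) set"
  assumes "finite S" "is_partition lam"
  shows "type_of fst S = lam \<longleftrightarrow> (\<forall>k. card {l. (k, l) \<in> S} = count_list lam k)"
proof -
  have "type_of fst S = lam \<longleftrightarrow> image_mset fst (mset_set S) = mset lam"
    unfolding type_of_def using partition_of_mset[OF assms(2)] mset_partition_of by metis
  also have "\<dots> \<longleftrightarrow> (\<forall>k. count (image_mset fst (mset_set S)) k = count_list lam k)"
    by (simp add: multiset_eq_iff count_mset)
  finally have "type_of fst S = lam \<longleftrightarrow> (\<forall>k. count (image_mset fst (mset_set S)) k = count_list lam k)" .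
  moreover have "count (image_mset fst (mset_set S)) k = card {l. (k, l) \<in> S}" for k
  proof -
    have "count (image_mset fst (mset_set S)) k = (\<Sum>b\<in>{b \<in> S. fst b = k}. 1)"
      unfolding count_image_mset using assms(1) by (intro sum.cong) auto
    also have "\<dots> = card {b \<in> S. fst b = k}" by simp
    also have "{b \<in> S. fst b = k} = Pair k ` {l. (k, l) \<in> S}" by force
    also have "card \<dots> = card {l. (k, l) \<in> S}" by (rule card_image) (auto simp: inj_on_def)
    finally show ?thesis .
  qed
  ultimately show ?thesis by simp
qed

lemma mem_dyadic_iff:
  "(k, l) \<in> dyadic L \<longleftrightarrow> l \<in> L \<and> (\<exists>j. 2 ^ j dvd k \<and> length l = k div 2 ^ j)"
proof -
  have "k = length l * 2 ^ j \<longleftrightarrow> 2 ^ j dvd k \<and> length l = k div 2 ^ j" for j by auto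
  then show ?thesis by (simp add: dyadic_def)
qed

text \<open>A family is coded by its pairs (k, l), with \<open>M k\<close> the heaps of the words l
  paired with k. The exponent j is implicit, as k and the length of l determine it; the same heap
  may occur in several \<open>M k\<close>.\<close>

lemma card_lyn_families:
  assumes lam: "is_partition lam"
  shows "card (lyn_families V E lam) = card {S \<in> type_sets V lam. (\<Union>b\<in>S. set (snd b)) = V}"
proof -
  define phi where "phi S = (\<lambda>k. heap_of E ` {l. (k, l) \<in> S})" for S :: "(nat \<times> 'a list) set"
  let ?B = "{S \<in> type_sets V lam. (\<Union>b\<in>S. set (snd b)) = V}"
  have inj: "inj_on (heap_of E) {l. (k, l) \<in> S}" if "S \<subseteq> dyadic (lyns V)" for k S
    by (rule inj_on_subset[OF inj_heap_of[of V]]) (use that in \<open>auto simp: dyadic_def\<close>)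
  have fins: "finite {l. (k, l) \<in> S}" if "finite S" for k and S :: "(nat \<times> 'a list) set"
    using finite_vimageI[OF that, of "Pair k"] by (simp add: vimage_def inj_on_def)
  have allowed: "{H. lyndon_heap V E H \<and> (\<exists>j. 2 ^ j dvd k \<and> heap_size H = k div 2 ^ j)} =
      heap_of E ` {l. (k, l) \<in> dyadic (lyns V)}" for k
  proof -
    have "{H. lyndon_heap V E H \<and> (\<exists>j. 2 ^ j dvd k \<and> heap_size H = k div 2 ^ j)} =
        {H. H \<in> {H. lyndon_heap V E H} \<and> (\<exists>j. 2 ^ j dvd k \<and> heap_size H = k div 2 ^ j)}" by simp
    also have "\<dots> = heap_of E ` {l. (k, l) \<in> dyadic (lyns V)}"
    proof (intro equalityI subsetI)
      fix H assume "H \<in> {H. H \<in> {H. lyndon_heap V E H} \<and> (\<exists>j. 2 ^ j dvd k \<and> heap_size H = k div 2 ^ j)}"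
      then obtain l where "l \<in> lyns V" "H = heap_of E l" "\<exists>j. 2 ^ j dvd k \<and> heap_size H = k div 2 ^ j"
        unfolding lyndon_heaps_eq by blast
      then show "H \<in> heap_of E ` {l. (k, l) \<in> dyadic (lyns V)}"
        unfolding mem_dyadic_iff by (simp add: heap_size_heap_of)
    next
      fix H assume "H \<in> heap_of E ` {l. (k, l) \<in> dyadic (lyns V)}"
      then obtain l where "l \<in> lyns V" "H = heap_of E l" "\<exists>j. 2 ^ j dvd k \<and> length l = k div 2 ^ j"
        unfolding mem_dyadic_iff by blast
      then show "H \<in> {H. H \<in> {H. lyndon_heap V E H} \<and> (\<exists>j. 2 ^ j dvd k \<and> heap_size H = k div 2 ^ j)}"
        unfolding lyndon_heaps_eq by (simp add: heap_size_heap_of)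
    qed
    finally show ?thesis .
  qed
  have "bij_betw phi ?B (lyn_families V E lam)"
  proof (rule bij_betw_imageI)
    have sub: "S \<subseteq> T" if "S \<in> ?B" "T \<in> ?B" "phi S = phi T" for S T
    proof
      fix b assume "b \<in> S"
      moreover obtain k l where b: "b = (k, l)" by fastforce
      ultimately have "heap_of E l \<in> phi T k" using that(3) unfolding phi_def by (metis imageI mem_Collect_eq)
      then obtain l' where l': "(k, l') \<in> T" "heap_of E l = heap_of E l'" by (auto simp: phi_def)
      have "l \<in> lyns V" "l' \<in> lyns V" using \<open>b \<in> S\<close> b l' that(1,2) by (auto simp: dyadic_def)
      then have "l = l'" by (rule inj_onD[OF inj_heap_of l'(2)])
      then show "b \<in> T" using l'(1) b by simp
    qed
    show "inj_on phi ?B"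
    proof (rule inj_onI)
      fix S T assume ST: "S \<in> ?B" "T \<in> ?B" "phi S = phi T"
      show "S = T" using sub[OF ST] sub[OF ST(2,1) ST(3)[symmetric]] by (rule equalityI)
    qed
    show "phi ` ?B = lyn_families V E lam"
    proof (intro equalityI subsetI)
      fix M assume "M \<in> phi ` ?B"
      then obtain S where S: "S \<subseteq> dyadic (lyns V)" "finite S" "type_of fst S = lam"
          "(\<Union>b\<in>S. set (snd b)) = V" and M: "M = phi S" by blast
      have cnt: "card {l. (k, l) \<in> S} = count_list lam k" for k
        using type_of_eq_iff[OF S(2) lam] S(3) by blast
      have "M k = {}" if "k = 0" for k
        using S(1) dyadic_lyns_bounds(1) that by (fastforce simp: M phi_def)
      moreover have "finite (M k) \<and> card (M k) = count_list lam k \<and>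
          M k \<subseteq> {H. lyndon_heap V E H \<and> (\<exists>j. 2 ^ j dvd k \<and> heap_size H = k div 2 ^ j)}" if "k > 0" for k
      proof (intro conjI)
        show "finite (M k)" using fins[OF S(2)] by (simp add: M phi_def)
        show "card (M k) = count_list lam k" unfolding M phi_def card_image[OF inj[OF S(1)]] by (rule cnt)
        show "M k \<subseteq> {H. lyndon_heap V E H \<and> (\<exists>j. 2 ^ j dvd k \<and> heap_size H = k div 2 ^ j)}"
          unfolding allowed M phi_def using S(1) by blast
      qed
      moreover have "\<exists>k. \<exists>H\<in>M k. heap_uses H v" if v: "v \<in> V" for v
      proof -
        obtain k l where kl: "(k, l) \<in> S" "v \<in> set l" using v S(4) by fastforce
        then have "heap_of E l \<in> M k" by (simp add: M phi_def)
        then show ?thesis using kl(2) heap_uses_heap_of by blast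
      qed
      ultimately show "M \<in> lyn_families V E lam" unfolding lyn_families_def by blast
    next
      fix M assume M: "M \<in> lyn_families V E lam"
      have M0: "M 0 = {}" using M unfolding lyn_families_def by blast
      have Mk: "finite (M k) \<and> card (M k) = count_list lam k \<and>
          M k \<subseteq> heap_of E ` {l. (k, l) \<in> dyadic (lyns V)}" if "k > 0" for k
        using M that unfolding lyn_families_def allowed by blast
      have cover: "\<exists>k. \<exists>H\<in>M k. heap_uses H v" if "v \<in> V" for v
        using M that unfolding lyn_families_def by blast
      define S where "S = {b \<in> dyadic (lyns V). heap_of E (snd b) \<in> M (fst b)}"
      have SD: "S \<subseteq> dyadic (lyns V)" by (auto simp: S_def)
      have MS: "M k = heap_of E ` {l. (k, l) \<in> S}" for k
      proof (cases "k = 0")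
        case True
        then show ?thesis using M0 by (auto simp: S_def)
      next
        case False
        then show ?thesis using Mk[of k] by (auto simp: S_def)
      qed
      have fin: "finite {l. (k, l) \<in> S}" for k
      proof -
        have "finite (M k)" using M0 Mk[of k] by (cases "k = 0") auto
        then show ?thesis using finite_imageD[OF _ inj[OF SD]] MS[of k] by simp
      qed
      have pos: "k > 0" if "(k, l) \<in> S" for k l using dyadic_lyns_bounds(1)[of "(k, l)"] that SD by auto
      have cnt: "card {l. (k, l) \<in> S} = count_list lam k" for k
      proof (cases "k = 0")
        case True
        then have "{l. (k, l) \<in> S} = {}" using pos by blast
        moreover have "count_list lam k = 0" using lam True by (simp add: is_partition_def count_list_0_iff)
        ultimately show ?thesis by simp
      next
        case False
        then show ?thesis using Mk[of k] MS[of k] card_image[OF inj[OF SD], of k] by simp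
      qed
      \<comment> \<open>Fibres are finite and nonempty only at parts of \<open>lam\<close>, so S is
        finite although \<open>dyadic (lyns V)\<close> may be infinite.\<close>
      have "S \<subseteq> (SIGMA k:set lam. {l. (k, l) \<in> S})"
      proof
        fix b assume "b \<in> S"
        moreover obtain k l where b: "b = (k, l)" by fastforce
        ultimately have "card {l. (k, l) \<in> S} > 0" using fin by (auto simp: card_gt_0_iff)
        then have "k \<in> set lam" using cnt[of k] count_list_0_iff[of lam k] by auto
        then show "b \<in> (SIGMA k:set lam. {l. (k, l) \<in> S})" using \<open>b \<in> S\<close> b by simp
      qed
      then have finS: "finite S" by (rule finite_subset) (simp add: fin)
      have "type_of fst S = lam" using type_of_eq_iff[OF finS lam] cnt by blast
      moreover have "(\<Union>b\<in>S. set (snd b)) = V"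
      proof
        show "(\<Union>b\<in>S. set (snd b)) \<subseteq> V" using SD dyadic_lyns_bounds(3) by blast
        show "V \<subseteq> (\<Union>b\<in>S. set (snd b))"
        proof
          fix v assume "v \<in> V"
          then obtain k H where "H \<in> M k" "heap_uses H v" using cover by blast
          then obtain l where "(k, l) \<in> S" "v \<in> set l" using MS[of k] heap_uses_heap_of by auto
          then show "v \<in> (\<Union>b\<in>S. set (snd b))" by force
        qed
      qed
      ultimately have "S \<in> ?B" using SD finS by simp
      moreover have "M = phi S" unfolding phi_def using MS by (rule ext)
      ultimately show "M \<in> phi ` ?B" by blast
    qed
  qed
  from bij_betw_same_card[OF this] show ?thesis by (rule sym)
qed

lemma lyn_families_inclusion_exclusion:
  assumes "finite V" "is_partition lam"
  shows "int (card (lyn_families V E lam)) =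
    (\<Sum>W\<in>Pow V. (-1) ^ card (V - W) * int (card (type_sets W lam)))"
proof -
  have "int (card (lyn_families V E lam)) = (\<Sum>W\<in>Pow V. (-1) ^ card (V - W) *
      int (card {S \<in> type_sets V lam. (\<Union>b\<in>S. set (snd b)) \<subseteq> W}))"
    unfolding card_lyn_families[OF assms(2)]
    by (rule card_onto_inclusion_exclusion[OF finite_type_sets[OF assms(1)] assms(1)])
  also have "\<dots> = (\<Sum>W\<in>Pow V. (-1) ^ card (V - W) * int (card (type_sets W lam)))"
  proof (rule sum.cong[OF refl])
    fix W assume "W \<in> Pow V"
    \<comment> \<open>Being a standard Lyndon word does not involve W, so passing to W only
      restricts the letters.\<close>
    then have "b \<in> dyadic (lyns W) \<longleftrightarrow> b \<in> dyadic (lyns V) \<and> set (snd b) \<subseteq> W" for b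
      by (cases b) (auto simp: dyadic_def lyns_def)
    then have "{S \<in> type_sets V lam. (\<Union>b\<in>S. set (snd b)) \<subseteq> W} = type_sets W lam" by blast
    then show "(-1) ^ card (V - W) * int (card {S \<in> type_sets V lam. (\<Union>b\<in>S. set (snd b)) \<subseteq> W}) =
        (-1) ^ card (V - W) * int (card (type_sets W lam))" by simp
  qed
  finally show ?thesis .
qed

section \<open>The alternating formula\<close>

lemma card_dyadic_fibre:
  assumes "finite W" "k > 0"
  shows "card {l. (k, l) \<in> dyadic (lyns W)} =
    (\<Sum>j\<in>{j. 2 ^ j dvd k}. card {l \<in> lyns W. length l = k div 2 ^ j})"
proof -
  have "j < k" if "2 ^ j dvd k" for j
    using dvd_imp_le[OF that assms(2)] less_exp[of j] by linarith
  then have "{j. 2 ^ j dvd k} \<subseteq> {..<k}" by blast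
  then have finJ: "finite {j. 2 ^ j dvd k}" by (rule finite_subset) simp
  have "{l. (k, l) \<in> dyadic (lyns W)} = (\<Union>j\<in>{j. 2 ^ j dvd k}. {l \<in> lyns W. length l = k div 2 ^ j})"
    unfolding mem_dyadic_iff by blast
  also have "card \<dots> = (\<Sum>j\<in>{j. 2 ^ j dvd k}. card {l \<in> lyns W. length l = k div 2 ^ j})"
  proof (rule card_UN_disjoint[OF finJ])
    show "\<forall>j\<in>{j. 2 ^ j dvd k}. finite {l \<in> lyns W. length l = k div 2 ^ j}"
    proof
      fix j
      show "finite {l \<in> lyns W. length l = k div 2 ^ j}"
        by (rule finite_subset[OF _ finite_lists_length_eq[OF assms(1), of "k div 2 ^ j"]]) (auto simp: lyns_def)
    qed
    show "\<forall>i\<in>{j. 2 ^ j dvd k}. \<forall>j\<in>{j. 2 ^ j dvd k}. i \<noteq> j \<longrightarrow>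
        {l \<in> lyns W. length l = k div 2 ^ i} \<inter> {l \<in> lyns W. length l = k div 2 ^ j} = {}"
    proof (intro ballI impI)
      fix i j assume ij: "i \<in> {j. 2 ^ j dvd k}" "j \<in> {j. 2 ^ j dvd k}" "i \<noteq> j"
      have "k div 2 ^ i \<noteq> k div 2 ^ j"
      proof
        assume eq: "k div 2 ^ i = k div 2 ^ j"
        have 1: "k div 2 ^ i * 2 ^ i = k" using ij(1) by simp
        have 2: "k div 2 ^ i * 2 ^ j = k" unfolding eq using ij(2) by simp
        have "k div 2 ^ i \<noteq> 0" using 1 assms(2) by (metis mult_zero_left less_irrefl)
        moreover have "k div 2 ^ i * 2 ^ i = k div 2 ^ i * 2 ^ j" using 1 2 by (rule trans[OF _ sym])
        ultimately have "(2::nat) ^ i = 2 ^ j" by (simp only: mult_cancel1) simp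
        then show False using ij(3) by simp
      qed
      then show "{l \<in> lyns W. length l = k div 2 ^ i} \<inter> {l \<in> lyns W. length l = k div 2 ^ j} = {}" by auto
    qed
  qed
  finally show ?thesis .
qed

text \<open>The type prescribes how many pairs have each weight k, and the choices for different k
  are independent; hence a product of binomial coefficients.\<close>

lemma card_type_sets:
  assumes W: "finite W" and lam: "is_partition lam"
  shows "card (type_sets W lam) = (\<Prod>k\<in>set lam. card {l. (k, l) \<in> dyadic (lyns W)} choose count_list lam k)"
proof -
  define L where "L k = {l. (k, l) \<in> dyadic (lyns W)}" for k
  have pos: "k > 0" if "k \<in> set lam" for k using that lam by (metis is_partition_def not_gr0)
  have finL: "finite (L k)" for k
    by (rule finite_subset[OF _ finite_lists_length_le[OF W, of k]])
      (use dyadic_lyns_bounds in \<open>fastforce simp: L_def\<close>)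
  let ?P = "PiE (set lam) (\<lambda>k. {T. T \<subseteq> L k \<and> card T = count_list lam k})"
  define f where "f S = restrict (\<lambda>k. {l. (k, l) \<in> S}) (set lam)" for S :: "(nat \<times> 'a list) set"
  have "bij_betw f (type_sets W lam) ?P"
  proof (rule bij_betw_byWitness[where f' = "\<lambda>T. SIGMA k:set lam. T k"])
    have cnt: "card {l. (k, l) \<in> S} = count_list lam k" if "S \<in> type_sets W lam" for S k
      using type_of_eq_iff[OF _ lam, of S] that by blast
    have fibre: "k \<in> set lam" if "S \<in> type_sets W lam" "(k, l) \<in> S" for S k l
    proof -
      have "finite {l. (k, l) \<in> S}"
        using finite_vimageI[of S "Pair k"] that(1) by (simp add: vimage_def inj_on_def)
      then have "card {l. (k, l) \<in> S} > 0" using that(2) by (auto simp: card_gt_0_iff)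
      then show ?thesis using cnt[OF that(1)] count_list_0_iff[of lam k] by auto
    qed
    show "\<forall>S\<in>type_sets W lam. (SIGMA k:set lam. f S k) = S"
    proof
      fix S assume S: "S \<in> type_sets W lam"
      show "(SIGMA k:set lam. f S k) = S" using fibre[OF S] by (auto simp: f_def)
    qed
    show "\<forall>T\<in>?P. f (SIGMA k:set lam. T k) = T"
      by (auto simp: f_def fun_eq_iff PiE_def extensional_def)
    show "f ` type_sets W lam \<subseteq> ?P"
    proof
      fix T assume "T \<in> f ` type_sets W lam"
      then obtain S where S: "S \<in> type_sets W lam" "T = f S" by blast
      then show "T \<in> ?P" using cnt[OF S(1)] by (auto simp: f_def L_def)
    qed
    show "(\<lambda>T. SIGMA k:set lam. T k) ` ?P \<subseteq> type_sets W lam"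
    proof
      fix S assume "S \<in> (\<lambda>T. SIGMA k:set lam. T k) ` ?P"
      then obtain T where T: "T \<in> ?P" "S = (SIGMA k:set lam. T k)" by blast
      have Tk: "T k \<subseteq> L k" "card (T k) = count_list lam k" if "k \<in> set lam" for k
        using PiE_mem[OF T(1) that] by auto
      have finS: "finite S" unfolding T(2)
        using finite_subset[OF Tk(1) finL] by (intro finite_SigmaI) auto
      have "card {l. (k, l) \<in> S} = count_list lam k" for k
      proof (cases "k \<in> set lam")
        case True
        then show ?thesis using Tk(2) T(2) by simp
      next
        case False
        then show ?thesis using T(2) by simp
      qed
      then have "type_of fst S = lam" using type_of_eq_iff[OF finS lam] by blast
      moreover have "S \<subseteq> dyadic (lyns W)" using T(2) Tk(1) by (auto simp: L_def)
      ultimately show "S \<in> type_sets W lam" using finS by simp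
    qed
  qed
  then have "card (type_sets W lam) = card ?P" by (rule bij_betw_same_card)
  also have "\<dots> = (\<Prod>k\<in>set lam. card (L k) choose count_list lam k)"
    using finL by (simp add: card_PiE n_subsets)
  finally show ?thesis by (simp add: L_def)
qed

end

text \<open>Between letters of W both graphs have the same dependence. This links the Lyndon heaps
  of the induced subgraphs in \<open>alt_formula\<close> to words over W that are standard for
  E.\<close>

lemma induced_std:
  assumes "trace_graph E" "trace_graph (induced E W)" "set w \<subseteq> W"
  shows "trace_graph.minl (induced E W) w = trace_graph.minl E w \<and>
    trace_graph.std (induced E W) w = trace_graph.std E w"
proof -
  interpret G: trace_graph E by fact
  interpret I: trace_graph "induced E W" by fact
  from assms(3) show ?thesis
  proof (induction w)
    case (Cons a w)
    have "I.dep a b \<longleftrightarrow> G.dep a b" if "b \<in> G.minl w" for b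
      using that G.minl_subset[of w] Cons.prems by (auto simp: I.dep_def G.dep_def induced_def)
    then show ?case using Cons by auto
  qed simp
qed

theorem theorem1p3:
  fixes V :: "'a::linorder set" and E :: "'a \<Rightarrow> 'a \<Rightarrow> bool"
  assumes "finite V"
    and "\<forall>u v. E u v \<longrightarrow> E v u"
    and "\<forall>v. \<not> E v v"
    and "\<forall>u v. E u v \<longrightarrow> u \<in> V \<and> v \<in> V"
  shows "omega (kromatic V E) = psum_ser (\<lambda>lam. real (card (lyn_families V E lam))) pbar_part
         \<and> (\<forall>lam. is_partition lam \<longrightarrow> int (card (lyn_families V E lam)) = alt_formula V E lam)"
proof (intro conjI allI impI)
  interpret trace_graph E
  proof
    show "E v u" if "E u v" for u v using assms(2)[rule_format, OF that] .
  qed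
  have fin: "finite W" if "W \<in> Pow V" for W using that assms(1) finite_subset by blast
  let ?s = "\<lambda>W. (-1 :: real) ^ card (V - W)"
  have "\<forall>W\<in>Pow V. \<exists>c. var_prod (indep_series E W) = psum_ser c p_part \<and>
      var_prod (heap_series W) = psum_ser (twist c) p_part"
    using var_prod_twist[OF indep_series_0 indep_series_heap_series] fin by metis
  then obtain c where c: "\<And>W. W \<in> Pow V \<Longrightarrow> var_prod (indep_series E W) = psum_ser (c W) p_part"
      "\<And>W. W \<in> Pow V \<Longrightarrow> var_prod (heap_series W) = psum_ser (twist (c W)) p_part"
    by (auto dest!: bchoice)
  have krom: "kromatic V E = psum_ser (\<lambda>lam. \<Sum>W\<in>Pow V. ?s W * c W lam) p_part"
    using kromatic_inclusion_exclusion[of V E] assms c(1)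
    by (simp add: fun_eq_iff psum_ser_sum)
  \<comment> \<open>The sign depends only on the partition, so the twist passes through the
    inclusion-exclusion sum.\<close>
  have tw: "twist (\<lambda>lam. \<Sum>W\<in>Pow V. ?s W * c W lam) = (\<lambda>lam. \<Sum>W\<in>Pow V. ?s W * twist (c W) lam)"
    by (simp add: twist_def fun_eq_iff sum_distrib_left mult.left_commute)
  have fam: "real (card (lyn_families V E lam)) = (\<Sum>W\<in>Pow V. ?s W * real (card (type_sets W lam)))"
    if "is_partition lam" for lam
    using arg_cong[OF lyn_families_inclusion_exclusion[OF assms(1) that], of real_of_int] by simp
  \<comment> \<open>The families carry the same signs as the colourings, so the two expansions can
    be matched for each W separately.\<close>
  have "psum_ser (\<lambda>lam. real (card (lyn_families V E lam))) pbar_part =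
      psum_ser (\<lambda>lam. \<Sum>W\<in>Pow V. ?s W * real (card (type_sets W lam))) pbar_part"
    by (rule psum_ser_cong) (rule fam)
  also have "\<dots> = psum_ser (twist (\<lambda>lam. \<Sum>W\<in>Pow V. ?s W * c W lam)) p_part"
    unfolding tw fun_eq_iff psum_ser_sum
    using fin by (simp add: psum_type_sets c(2))
  finally show "omega (kromatic V E) = psum_ser (\<lambda>lam. real (card (lyn_families V E lam))) pbar_part"
    using omega_eqI[OF krom] by simp

  fix lam assume lam: "is_partition lam"
  have "int (card (type_sets W lam)) = (\<Prod>k\<in>set lam.
      int ((\<Sum>j\<in>{j. 2 ^ j dvd k}. card (lyndon_set W (induced E W) (k div 2 ^ j))) choose count_list lam k))"
    if W: "W \<in> Pow V" for W
  proof -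
    interpret I: trace_graph "induced E W"
    proof
      show "induced E W v u" if "induced E W u v" for u v
        using that assms(2)[rule_format, of u v] unfolding induced_def by simp
    qed
    have "I.lyns W = lyns W"
      unfolding I.lyns_def lyns_def
      using induced_std[OF trace_graph_axioms I.trace_graph_axioms] by blast
    then have "card {l. (k, l) \<in> dyadic (lyns W)} =
        (\<Sum>j\<in>{j. 2 ^ j dvd k}. card (lyndon_set W (induced E W) (k div 2 ^ j)))" if "k \<in> set lam" for k
    proof -
      have "k > 0" using that lam by (metis is_partition_def not_gr0)
      show ?thesis
        unfolding card_dyadic_fibre[OF fin[OF W] \<open>k > 0\<close>] I.card_lyndon_set \<open>I.lyns W = lyns W\<close> ..
    qed
    then show ?thesis unfolding card_type_sets[OF fin[OF W] lam] by simp
  qed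
  then show "int (card (lyn_families V E lam)) = alt_formula V E lam"
    unfolding lyn_families_inclusion_exclusion[OF assms(1) lam] alt_formula_def by simp
qed

end
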